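(* Let $d\ge2$, let $q:\{1,\dots,d\}\times\{1,\dots,d\}\to\mathbb T$ satisfy $q(i,i)=1$ and $q(i,j)=\overline{q(j,i)}$, and let $(V_1,V_2,\dots,V_d)$ be a $q$-commutative $d$-tuple of isometries on a Hilbert space $\mathcal H$. For each $i$ put $q_i=\prod_{j=1}^dq(i,j)$ and $V_{(i)}=V_1\cdots V_{i-1}V_{i+1}\cdots V_d$. Then: (1) (BCL-1 $q$-model) There exist Hilbert spaces $\mathcal F$ and $\mathcal K_u$, projections $P_1,\dots,P_d$ and unitaries $U_1,\dots,U_d$ in $\mathcal B(\mathcal F)$, and a $q$-commutative tuple $(W_1,\dots,W_d)$ of unitaries in $\mathcal B(\mathcal K_u)$ such that for each $i=1,\dots,d$, $V_i$ is unitarily equivalent to $$\begin{bmatrix}R_{q_i}\otimes P_i^\perp U_i + M_zR_{q_i}\otimes P_i U_i &0\\0& W_i\end{bmatrix}\ \text{ on }\begin{bmatrix}H^2\otimes \mathcal F\\ \mathcal K_u\end{bmatrix}$$ and $V_{(i)}$ is unitarily equivalent to $$\begin{bmatrix}R_{\overline{q_i}}\otimes U_i^*P_i+R_{\overline{q_i}}M_z\otimes U_i^*P_i^\perp& 0\\0&W_{(i)}\end{bmatrix}\ \text{ on }\begin{bmatrix}H^2\otimes \mathcal F\\ \mathcal K_u\end{bmatrix},$$ where $W_{(i)}=W_1\cdots W_{i-1}W_{i+1}\cdots W_d$. Moreover, the tuple $(\mathcal F,\mathcal K_u;P_i,U_i,W_i)_{i=1}^d$ can be chosen such that $\mathcal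 F=\mathcal D_{V_1^*}\oplus\cdots\oplus\mathcal D_{V_d^*}$, $\mathcal K_u=\bigcap_{n\ge0}(V_1V_2\cdots V_d)^n\mathcal H$, $(W_1,\dots,W_d)=(V_1,\dots,V_d)|_{\mathcal K_u}$, $P_i$ is the projection of $\mathcal F$ onto $\mathcal D_{V_i^*}$, and $$U_i: D_{V_i^*}h\oplus\Delta_iD_{V_{(i)}^*}V_i^*h\mapsto D_{V_i^*}V_{(i)}^*h\oplus\Delta_iD_{V_{(i)}^*}h\qquad(h\in\mathcal H),$$ where $\Delta_i:\mathcal D_{V_{(i)}^*}\to\bigoplus_{j\ne i}\mathcal D_{V_j^*}$ is the unitary given by $$\Delta_i:D_{V_{(i)}^*}h\mapsto D_{V_1^*}V_2^*\cdots V_{i-1}^*V_{i+1}^*\cdots V_d^*h\oplus D_{V_2^*}V_3^*\cdots V_{i-1}^*V_{i+1}^*\cdots V_d^*h\oplus\cdots\oplus D_{V_{d-1}^*}V_d^*h\oplus D_{V_d^*}h$$ (the $j$-th component, $j\neq i$, being $D_{V_j^*}$ applied to the product of the $V_k^*$, $k>j$, $k\ne i$, in increasing order of $k$, applied to $h$). (2) (BCL-2 $q$-model) There exist Hilbert spaces $\mathcal F_\dag$ and $\mathcal K_{u\dag}$, projections $P_{1\dag},\dots,P_{d\dag}$ and unitaries $U_{1\dag},\dots,U_{d\dag}$ in $\mathcal B(\mathcal F_\dag)$, and a $q$-commutative tuple $(W_{1\dag},\dots,W_{d\dag})$ of unitaries in $\mathcal B(\mathcal K_{u\dag})$ such that for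 each $i=1,\dots,d$, $V_i$ is unitarily equivalent to $$\begin{bmatrix}R_{q_i}\otimes U_{i\dag}^*P_{i\dag}^\perp + M_zR_{q_i}\otimes U_{i\dag}^*P_{i\dag}&0\\0&W_{i\dag}\end{bmatrix}\ \text{ on }\begin{bmatrix}H^2\otimes \mathcal F_\dag\\ \mathcal K_{u\dag}\end{bmatrix}$$ and $V_{(i)}$ is unitarily equivalent to $$\begin{bmatrix}R_{\overline{q_i}}\otimes P_{i\dag} U_{i\dag}+R_{\overline{q_i}}M_z\otimes P_{i\dag}^\perp U_{i\dag}&0\\0&W_{(i)\dag}\end{bmatrix}\ \text{ on }\begin{bmatrix}H^2\otimes \mathcal F_\dag\\ \mathcal K_{u\dag}\end{bmatrix},$$ where $W_{(i)\dag}=W_{1\dag}\cdots W_{(i-1)\dag}W_{(i+1)\dag}\cdots W_{d\dag}$. Moreover, the tuple can be chosen such that $(\mathcal F_\dag,\mathcal K_{u\dag};P_{i\dag},U_{i\dag},W_{i\dag})=(\mathcal F,\mathcal K_u;P_i,U_i^*,W_i)$ for each $i$, where $(\mathcal F,\mathcal K_u;P_i,U_i,W_i)_{i=1}^d$ is the explicit tuple described in part (1).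
   Context: A $d$-tuple $(V_1,\dots,V_d)$ of operators is $q$-commutative, for a function $q$ as in the statement, if $V_iV_j=q(i,j)V_jV_i$ for all $i,j$. $\mathbb T$ is the unit circle. For a contraction $T$, $D_{T^*}=(I-TT^* )^{1/2}$ and $\mathcal D_{T^*}=\overline{\operatorname{Ran}}\,D_{T^*}$. Column notation $\begin{bmatrix}\mathcal A\\ \mathcal B\end{bmatrix}$ denotes the direct sum $\mathcal A\oplus\mathcal B$. "Projection" means orthogonal projection, and $P^\perp=I-P$. $H^2$ is the Hardy space of the unit disk, $M_z$ is multiplication by $z$ on $H^2$, and for unimodular $c$, $R_c$ is the unitary $(R_cf)(z)=f(cz)$ on $H^2$. In the formula for $U_i$, the space $\mathcal F=\bigoplus_{j=1}^d\mathcal D_{V_j^*}$ is identified with $\mathcal D_{V_i^*}\oplus\bigoplus_{j\ne i}\mathcal D_{V_j^*}$. *)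

theory Defs
  imports "HOL-Analysis.Analysis" "HOL-Library.Function_Algebras"
begin

section \<open>Complex Hilbert spaces\<close>

class complex_vector = ab_group_add +
  fixes scaleC :: "complex \<Rightarrow> 'a \<Rightarrow> 'a" (infixr \<open>*\<^sub>C\<close> 75)
  assumes scaleC_add_right: "c *\<^sub>C (x + y) = c *\<^sub>C x + c *\<^sub>C y"
    and scaleC_add_left: "(c + c') *\<^sub>C x = c *\<^sub>C x + c' *\<^sub>C x"
    and scaleC_scaleC: "c *\<^sub>C c' *\<^sub>C x = (c * c') *\<^sub>C x"
    and scaleC_one: "1 *\<^sub>C x = x"

instantiation complex :: complex_vector
begin
definition scaleC_complex_def: "c *\<^sub>C (x::complex) = c * x"
instance by standard (simp_all add: scaleC_complex_def algebra_simps)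
end

instantiation "fun" :: (type, complex_vector) complex_vector
begin
definition scaleC_fun_def: "c *\<^sub>C f = (\<lambda>x. c *\<^sub>C f x)"
instance
  by standard (simp_all add: scaleC_fun_def fun_eq_iff scaleC_add_right scaleC_add_left
      scaleC_scaleC scaleC_one)
end

instantiation prod :: (complex_vector, complex_vector) complex_vector
begin
definition scaleC_prod_def: "c *\<^sub>C p = (c *\<^sub>C fst p, c *\<^sub>C snd p)"
instance
  by standard (simp_all add: scaleC_prod_def prod_eq_iff scaleC_add_right scaleC_add_left
      scaleC_scaleC scaleC_one)
end

text \<open>A Hilbert space is a linear subspace \<open>carr H\<close> of an ambient complex vector space together
  with an inner product, linear in the first argument. All notions below only look at
  the inner product on the carrier.\<close>

record 'a hilb =
  carr :: "'a set"
  ip :: "'a \<Rightarrow> 'a \<Rightarrow> complex"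

definition hnorm :: "'a hilb \<Rightarrow> 'a \<Rightarrow> real"
  where "hnorm H x = sqrt (Re (ip H x x))"

definition hconv :: "'a::complex_vector hilb \<Rightarrow> (nat \<Rightarrow> 'a) \<Rightarrow> 'a \<Rightarrow> bool"
  where "hconv H X l \<longleftrightarrow> (\<lambda>n. hnorm H (X n - l)) \<longlonglongrightarrow> 0"

locale hilbert_space =
  fixes H :: "'a::complex_vector hilb"
  assumes zero_mem: "0 \<in> carr H"
    and add_mem: "x \<in> carr H \<Longrightarrow> y \<in> carr H \<Longrightarrow> x + y \<in> carr H"
    and scale_mem: "x \<in> carr H \<Longrightarrow> c *\<^sub>C x \<in> carr H"
    and ip_add: "x \<in> carr H \<Longrightarrow> y \<in> carr H \<Longrightarrow> z \<in> carr H \<Longrightarrow> ip H (x + y) z = ip H x z + ip H y z"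
    and ip_scale: "x \<in> carr H \<Longrightarrow> y \<in> carr H \<Longrightarrow> ip H (c *\<^sub>C x) y = c * ip H x y"
    and ip_sym: "x \<in> carr H \<Longrightarrow> y \<in> carr H \<Longrightarrow> ip H y x = cnj (ip H x y)"
    and ip_pos: "x \<in> carr H \<Longrightarrow> x \<noteq> 0 \<Longrightarrow> 0 < Re (ip H x x)"
    and complete: "\<lbrakk>\<And>n. X n \<in> carr H; \<And>e. 0 < e \<Longrightarrow> \<exists>N. \<forall>m\<ge>N. \<forall>n\<ge>N. hnorm H (X m - X n) < e\<rbrakk>
      \<Longrightarrow> \<exists>l\<in>carr H. hconv H X l"

definition complex_hilb :: "complex hilb"
  where "complex_hilb = \<lparr>carr = UNIV, ip = (\<lambda>x y. x * cnj y)\<rparr>"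

definition sub_hilb :: "'a hilb \<Rightarrow> 'a set \<Rightarrow> 'a hilb"
  where "sub_hilb H M = \<lparr>carr = M, ip = ip H\<rparr>"

definition hclosure :: "'a::complex_vector hilb \<Rightarrow> 'a set \<Rightarrow> 'a set"
  where "hclosure H M = {x \<in> carr H. \<exists>X. (\<forall>n. X n \<in> M) \<and> hconv H X x}"

text \<open>The Hilbert space direct sum over a finite index set; families are \<open>0\<close> off the index set.\<close>

definition dsum :: "nat set \<Rightarrow> (nat \<Rightarrow> 'a::zero hilb) \<Rightarrow> (nat \<Rightarrow> 'a) hilb"
  where "dsum I E = \<lparr>carr = {x. (\<forall>j\<in>I. x j \<in> carr (E j)) \<and> (\<forall>j. j \<notin> I \<longrightarrow> x j = 0)},
    ip = (\<lambda>x y. \<Sum>j\<in>I. ip (E j) (x j) (y j))\<rparr>"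

definition oplus :: "'a hilb \<Rightarrow> 'b hilb \<Rightarrow> ('a \<times> 'b) hilb"
  where "oplus A B = \<lparr>carr = carr A \<times> carr B,
    ip = (\<lambda>x y. ip A (fst x) (fst y) + ip B (snd x) (snd y))\<rparr>"

section \<open>Operators\<close>

definition linear_op :: "'a::complex_vector hilb \<Rightarrow> 'b::complex_vector hilb \<Rightarrow> ('a \<Rightarrow> 'b) \<Rightarrow> bool"
  where "linear_op A B T \<longleftrightarrow> (\<forall>x\<in>carr A. T x \<in> carr B) \<and>
    (\<forall>x\<in>carr A. \<forall>y\<in>carr A. T (x + y) = T x + T y) \<and>
    (\<forall>x\<in>carr A. \<forall>c. T (c *\<^sub>C x) = c *\<^sub>C T x)"

definition bounded_op :: "'a::complex_vector hilb \<Rightarrow> 'b::complex_vector hilb \<Rightarrow> ('a \<Rightarrow> 'b) \<Rightarrow> bool"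
  where "bounded_op A B T \<longleftrightarrow> linear_op A B T \<and> (\<exists>M. \<forall>x\<in>carr A. hnorm B (T x) \<le> M * hnorm A x)"

definition isometry_op :: "'a::complex_vector hilb \<Rightarrow> 'b::complex_vector hilb \<Rightarrow> ('a \<Rightarrow> 'b) \<Rightarrow> bool"
  where "isometry_op A B T \<longleftrightarrow> linear_op A B T \<and> (\<forall>x\<in>carr A. hnorm B (T x) = hnorm A x)"

definition unitary_op :: "'a::complex_vector hilb \<Rightarrow> 'b::complex_vector hilb \<Rightarrow> ('a \<Rightarrow> 'b) \<Rightarrow> bool"
  where "unitary_op A B T \<longleftrightarrow> isometry_op A B T \<and> T ` carr A = carr B"

text \<open>The adjoint and the square root are totalised by \<open>0\<close> outside the carrier, which makes
  the function described by \<open>THE\<close> unique.\<close>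

definition adj :: "'a::complex_vector hilb \<Rightarrow> 'b::complex_vector hilb \<Rightarrow> ('a \<Rightarrow> 'b) \<Rightarrow> 'b \<Rightarrow> 'a"
  where "adj A B T y = (if y \<in> carr B
    then THE x. x \<in> carr A \<and> (\<forall>u\<in>carr A. ip B (T u) y = ip A u x) else 0)"

definition positive_op :: "'a::complex_vector hilb \<Rightarrow> ('a \<Rightarrow> 'a) \<Rightarrow> bool"
  where "positive_op H T \<longleftrightarrow> bounded_op H H T \<and>
    (\<forall>x\<in>carr H. Im (ip H (T x) x) = 0 \<and> 0 \<le> Re (ip H (T x) x))"

definition sqrt_op :: "'a::complex_vector hilb \<Rightarrow> ('a \<Rightarrow> 'a) \<Rightarrow> 'a \<Rightarrow> 'a"
  where "sqrt_op H T = (THE S. positive_op H S \<and> (\<forall>x\<in>carr H. S (S x) = T x) \<and>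
    (\<forall>x. x \<notin> carr H \<longrightarrow> S x = 0))"

definition is_projection :: "'a::complex_vector hilb \<Rightarrow> ('a \<Rightarrow> 'a) \<Rightarrow> bool"
  where "is_projection H P \<longleftrightarrow> bounded_op H H P \<and> (\<forall>x\<in>carr H. P (P x) = P x) \<and>
    (\<forall>x\<in>carr H. \<forall>y\<in>carr H. ip H (P x) y = ip H x (P y))"

definition is_projection_onto :: "'a::complex_vector hilb \<Rightarrow> 'a set \<Rightarrow> ('a \<Rightarrow> 'a) \<Rightarrow> bool"
  where "is_projection_onto H M P \<longleftrightarrow> is_projection H P \<and> P ` carr H = M"

definition compl_op :: "('a::complex_vector \<Rightarrow> 'a) \<Rightarrow> 'a \<Rightarrow> 'a"
  where "compl_op P x = x - P x"

definition unitary_equiv_via ::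
    "('a::complex_vector \<Rightarrow> 'b::complex_vector) \<Rightarrow> 'a hilb \<Rightarrow> ('a \<Rightarrow> 'a) \<Rightarrow> 'b hilb \<Rightarrow> ('b \<Rightarrow> 'b) \<Rightarrow> bool"
  where "unitary_equiv_via \<Phi> H S K T \<longleftrightarrow> unitary_op H K \<Phi> \<and> (\<forall>h\<in>carr H. \<Phi> (S h) = T (\<Phi> h))"

text \<open>\<open>oprod V [j\<^sub>1, \<dots>, j\<^sub>k]\<close> is the operator product \<open>V j\<^sub>1 \<cdots> V j\<^sub>k\<close> (\<open>V j\<^sub>k\<close> acts first).\<close>

definition oprod :: "(nat \<Rightarrow> 'a \<Rightarrow> 'a) \<Rightarrow> nat list \<Rightarrow> 'a \<Rightarrow> 'a"
  where "oprod V js = foldr (\<lambda>j T. V j \<circ> T) js id"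

definition omit_prod :: "nat \<Rightarrow> (nat \<Rightarrow> 'a \<Rightarrow> 'a) \<Rightarrow> nat \<Rightarrow> 'a \<Rightarrow> 'a"
  where "omit_prod d V i = oprod V (filter (\<lambda>j. j \<noteq> i) [1..<Suc d])"

definition q_commutative ::
    "nat \<Rightarrow> (nat \<Rightarrow> nat \<Rightarrow> complex) \<Rightarrow> 'a::complex_vector hilb \<Rightarrow> (nat \<Rightarrow> 'a \<Rightarrow> 'a) \<Rightarrow> bool"
  where "q_commutative d q H V \<longleftrightarrow>
    (\<forall>i\<in>{1..d}. \<forall>j\<in>{1..d}. \<forall>h\<in>carr H. V i (V j h) = q i j *\<^sub>C V j (V i h))"

section \<open>The Hardy space and its tensor products\<close>

text \<open>\<open>has_taylor E f a\<close>: the \<open>E\<close>-valued function \<open>f\<close> is the sum of the power series with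
  coefficients \<open>a\<close> on the open unit disk (and \<open>0\<close> elsewhere), and \<open>a\<close> is square-summable.\<close>

definition has_taylor :: "'a::complex_vector hilb \<Rightarrow> (complex \<Rightarrow> 'a) \<Rightarrow> (nat \<Rightarrow> 'a) \<Rightarrow> bool"
  where "has_taylor E f a \<longleftrightarrow> (\<forall>n. a n \<in> carr E) \<and> summable (\<lambda>n. (hnorm E (a n))\<^sup>2) \<and>
    (\<forall>z. if cmod z < 1 then f z \<in> carr E \<and> hconv E (\<lambda>N. \<Sum>n<N. z ^ n *\<^sub>C a n) (f z) else f z = 0)"

definition taylor :: "'a::complex_vector hilb \<Rightarrow> (complex \<Rightarrow> 'a) \<Rightarrow> nat \<Rightarrow> 'a"
  where "taylor E f = (THE a. has_taylor E f a)"

definition hardy :: "'a::complex_vector hilb \<Rightarrow> (complex \<Rightarrow> 'a) hilb"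
  where "hardy E = \<lparr>carr = {f. \<exists>a. has_taylor E f a},
    ip = (\<lambda>f g. \<Sum>n. ip E (taylor E f n) (taylor E g n))\<rparr>"

definition H2 :: "(complex \<Rightarrow> complex) hilb"
  where "H2 = hardy complex_hilb"

definition mult_z :: "(complex \<Rightarrow> complex) \<Rightarrow> complex \<Rightarrow> complex"
  where "mult_z f z = z * f z"

definition rot :: "complex \<Rightarrow> (complex \<Rightarrow> complex) \<Rightarrow> complex \<Rightarrow> complex"
  where "rot c f z = f (c * z)"

definition hilbert_tensor_product :: "'a::complex_vector hilb \<Rightarrow> 'b::complex_vector hilb \<Rightarrow>
    'c::complex_vector hilb \<Rightarrow> ('a \<Rightarrow> 'b \<Rightarrow> 'c) \<Rightarrow> bool"
  where "hilbert_tensor_product A B T \<tau> \<longleftrightarrow> hilbert_space T \<and>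
    (\<forall>b\<in>carr B. linear_op A T (\<lambda>a. \<tau> a b)) \<and> (\<forall>a\<in>carr A. linear_op B T (\<tau> a)) \<and>
    (\<forall>a\<in>carr A. \<forall>a'\<in>carr A. \<forall>b\<in>carr B. \<forall>b'\<in>carr B.
      ip T (\<tau> a b) (\<tau> a' b') = ip A a a' * ip B b b') \<and>
    hclosure T {\<Sum>k<n. \<tau> (a k) (b k) | (n::nat) a b. range a \<subseteq> carr A \<and> range b \<subseteq> carr B} = carr T"

text \<open>\<open>H\<^sup>2 \<otimes> E\<close> is realised as the \<open>E\<close>-valued Hardy space, with \<open>f \<otimes> x\<close> the function
  \<open>z \<mapsto> f z *\<^sub>C x\<close>; the theorem \<open>hardy_is_tensor_product\<close> below shows that this is a Hilbert space
  tensor product of \<open>H\<^sup>2\<close> and \<open>E\<close>.\<close>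

abbreviation (input) H2_tensor :: "'a::complex_vector hilb \<Rightarrow> (complex \<Rightarrow> 'a) hilb"
  where "H2_tensor E \<equiv> hardy E"

definition elem_tensor :: "(complex \<Rightarrow> complex) \<Rightarrow> 'a::complex_vector \<Rightarrow> complex \<Rightarrow> 'a"
  where "elem_tensor f x = (\<lambda>z. f z *\<^sub>C x)"

text \<open>\<open>tensor_op E S X\<close> is the operator \<open>S \<otimes> X\<close> on \<open>H\<^sup>2 \<otimes> E\<close>.\<close>

definition tensor_op :: "'a::complex_vector hilb \<Rightarrow> ((complex \<Rightarrow> complex) \<Rightarrow> complex \<Rightarrow> complex) \<Rightarrow>
    ('a \<Rightarrow> 'a) \<Rightarrow> (complex \<Rightarrow> 'a) \<Rightarrow> complex \<Rightarrow> 'a"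
  where "tensor_op E S X = (THE L. bounded_op (H2_tensor E) (H2_tensor E) L \<and>
    (\<forall>f\<in>carr H2. \<forall>x\<in>carr E. L (elem_tensor f x) = elem_tensor (S f) (X x)) \<and>
    (\<forall>u. u \<notin> carr (H2_tensor E) \<longrightarrow> L u = 0))"

section \<open>The models\<close>

text \<open>\<open>defect_adj H T\<close> is \<open>D\<^bsub>T*\<^esub> = (I - T T*)\<^sup>1\<^sup>/\<^sup>2\<close>, and \<open>defect_space H T\<close> is the closure of its range.\<close>

definition defect_adj :: "'a::complex_vector hilb \<Rightarrow> ('a \<Rightarrow> 'a) \<Rightarrow> 'a \<Rightarrow> 'a"
  where "defect_adj H T = sqrt_op H (\<lambda>x. x - T (adj H H T x))"

definition defect_space :: "'a::complex_vector hilb \<Rightarrow> ('a \<Rightarrow> 'a) \<Rightarrow> 'a hilb"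
  where "defect_space H T = sub_hilb H (hclosure H (defect_adj H T ` carr H))"

definition qprod :: "nat \<Rightarrow> (nat \<Rightarrow> nat \<Rightarrow> complex) \<Rightarrow> nat \<Rightarrow> complex"
  where "qprod d q i = (\<Prod>j=1..d. q i j)"

definition model_data :: "nat \<Rightarrow> (nat \<Rightarrow> nat \<Rightarrow> complex) \<Rightarrow> 'f::complex_vector hilb \<Rightarrow> 'k::complex_vector hilb \<Rightarrow>
    (nat \<Rightarrow> 'f \<Rightarrow> 'f) \<Rightarrow> (nat \<Rightarrow> 'f \<Rightarrow> 'f) \<Rightarrow> (nat \<Rightarrow> 'k \<Rightarrow> 'k) \<Rightarrow> bool"
  where "model_data d q F K P U W \<longleftrightarrow> hilbert_space F \<and> hilbert_space K \<and>
    (\<forall>i\<in>{1..d}. is_projection F (P i) \<and> unitary_op F F (U i) \<and> unitary_op K K (W i)) \<and>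
    q_commutative d q K W"

text \<open>In both models one and the same unitary carries the pair \<open>(V\<^sub>i, V\<^bsub>(i)\<^esub>)\<close> to the pair of
  model operators; the unitary is allowed to depend on \<open>i\<close>.\<close>

definition BCL1_model :: "nat \<Rightarrow> (nat \<Rightarrow> nat \<Rightarrow> complex) \<Rightarrow> 'a::complex_vector hilb \<Rightarrow> (nat \<Rightarrow> 'a \<Rightarrow> 'a) \<Rightarrow>
    'f::complex_vector hilb \<Rightarrow> 'k::complex_vector hilb \<Rightarrow>
    (nat \<Rightarrow> 'f \<Rightarrow> 'f) \<Rightarrow> (nat \<Rightarrow> 'f \<Rightarrow> 'f) \<Rightarrow> (nat \<Rightarrow> 'k \<Rightarrow> 'k) \<Rightarrow> bool"
  where "BCL1_model d q H V F K P U W \<longleftrightarrow> model_data d q F K P U W \<and>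
    (\<forall>i\<in>{1..d}. \<exists>\<Phi>.
      unitary_equiv_via \<Phi> H (V i) (oplus (H2_tensor F) K)
        (map_prod
          (tensor_op F (rot (qprod d q i)) (compl_op (P i) \<circ> U i)
            + tensor_op F (mult_z \<circ> rot (qprod d q i)) (P i \<circ> U i))
          (W i)) \<and>
      unitary_equiv_via \<Phi> H (omit_prod d V i) (oplus (H2_tensor F) K)
        (map_prod
          (tensor_op F (rot (cnj (qprod d q i))) (adj F F (U i) \<circ> P i)
            + tensor_op F (rot (cnj (qprod d q i)) \<circ> mult_z) (adj F F (U i) \<circ> compl_op (P i)))
          (omit_prod d W i)))"

definition BCL2_model :: "nat \<Rightarrow> (nat \<Rightarrow> nat \<Rightarrow> complex) \<Rightarrow> 'a::complex_vector hilb \<Rightarrow> (nat \<Rightarrow> 'a \<Rightarrow> 'a) \<Rightarrow>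
    'f::complex_vector hilb \<Rightarrow> 'k::complex_vector hilb \<Rightarrow>
    (nat \<Rightarrow> 'f \<Rightarrow> 'f) \<Rightarrow> (nat \<Rightarrow> 'f \<Rightarrow> 'f) \<Rightarrow> (nat \<Rightarrow> 'k \<Rightarrow> 'k) \<Rightarrow> bool"
  where "BCL2_model d q H V F K P U W \<longleftrightarrow> model_data d q F K P U W \<and>
    (\<forall>i\<in>{1..d}. \<exists>\<Phi>.
      unitary_equiv_via \<Phi> H (V i) (oplus (H2_tensor F) K)
        (map_prod
          (tensor_op F (rot (qprod d q i)) (adj F F (U i) \<circ> compl_op (P i))
            + tensor_op F (mult_z \<circ> rot (qprod d q i)) (adj F F (U i) \<circ> P i))
          (W i)) \<and>
      unitary_equiv_via \<Phi> H (omit_prod d V i) (oplus (H2_tensor F) K)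
        (map_prod
          (tensor_op F (rot (cnj (qprod d q i))) (P i \<circ> U i)
            + tensor_op F (rot (cnj (qprod d q i)) \<circ> mult_z) (compl_op (P i) \<circ> U i))
          (omit_prod d W i)))"

definition F_explicit :: "nat \<Rightarrow> 'a::complex_vector hilb \<Rightarrow> (nat \<Rightarrow> 'a \<Rightarrow> 'a) \<Rightarrow> (nat \<Rightarrow> 'a) hilb"
  where "F_explicit d H V = dsum {1..d} (\<lambda>j. defect_space H (V j))"

definition Ku_explicit :: "nat \<Rightarrow> 'a::complex_vector hilb \<Rightarrow> (nat \<Rightarrow> 'a \<Rightarrow> 'a) \<Rightarrow> 'a hilb"
  where "Ku_explicit d H V = sub_hilb H (\<Inter>n. (oprod V [1..<Suc d] ^^ n) ` carr H)"

text \<open>Since families in \<open>dsum ({1..d} - {i})\<close> vanish at \<open>i\<close>, the element \<open>x \<oplus> y\<close> of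
  \<open>\<D>\<^sub>i \<oplus> \<Oplus>\<^bsub>j\<noteq>i\<^esub> \<D>\<^sub>j\<close> corresponds to \<open>y(i := x)\<close> in \<open>F_explicit d H V\<close>.\<close>

definition explicit_tuple :: "nat \<Rightarrow> 'a::complex_vector hilb \<Rightarrow> (nat \<Rightarrow> 'a \<Rightarrow> 'a) \<Rightarrow>
    (nat \<Rightarrow> 'a \<Rightarrow> nat \<Rightarrow> 'a) \<Rightarrow> (nat \<Rightarrow> (nat \<Rightarrow> 'a) \<Rightarrow> nat \<Rightarrow> 'a) \<Rightarrow>
    (nat \<Rightarrow> (nat \<Rightarrow> 'a) \<Rightarrow> nat \<Rightarrow> 'a) \<Rightarrow> bool"
  where "explicit_tuple d H V \<Delta> P U \<longleftrightarrow> (\<forall>i\<in>{1..d}.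
    unitary_op (defect_space H (omit_prod d V i)) (dsum ({1..d} - {i}) (\<lambda>j. defect_space H (V j))) (\<Delta> i) \<and>
    (\<forall>h\<in>carr H. \<Delta> i (defect_adj H (omit_prod d V i) h) =
      (\<lambda>j. if j \<in> {1..d} - {i}
        then defect_adj H (V j) (oprod (\<lambda>k. adj H H (V k)) (filter (\<lambda>k. k \<noteq> i) [Suc j..<Suc d]) h)
        else 0)) \<and>
    is_projection_onto (F_explicit d H V) {x \<in> carr (F_explicit d H V). \<forall>j. j \<noteq> i \<longrightarrow> x j = 0} (P i) \<and>
    unitary_op (F_explicit d H V) (F_explicit d H V) (U i) \<and>
    (\<forall>h\<in>carr H.
      U i ((\<Delta> i (defect_adj H (omit_prod d V i) (adj H H (V i) h)))(i := defect_adj H (V i) h)) =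
      (\<Delta> i (defect_adj H (omit_prod d V i) h))(i := defect_adj H (V i) (adj H H (omit_prod d V i) h))))"

section \<open>The vector-valued Hardy space is a Hilbert space tensor product\<close>

lemma scaleC_zero_left [simp]: "0 *\<^sub>C x = (0::'a::complex_vector)"
  using scaleC_add_left[of 0 0 x] by simp

lemma scaleC_zero_right [simp]: "c *\<^sub>C 0 = (0::'a::complex_vector)"
  using scaleC_add_right[of c 0 0] by simp

lemma scaleC_minus_one: "(-1) *\<^sub>C x = - (x::'a::complex_vector)"
  using scaleC_add_left[of "-1" 1 x] by (simp add: scaleC_one eq_neg_iff_add_eq_0)

lemma scaleC_minus_right: "c *\<^sub>C (- x) = - (c *\<^sub>C (x::'a::complex_vector))"
  using scaleC_add_right[of c x "-x"] by (simp add: eq_neg_iff_add_eq_0 add.commute)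

lemma scaleC_diff_right: "c *\<^sub>C (x - y) = c *\<^sub>C x - c *\<^sub>C (y::'a::complex_vector)"
  using scaleC_add_right[of c x "-y"] by (simp add: scaleC_minus_right)

lemma scaleC_minus_left: "(- c) *\<^sub>C x = - (c *\<^sub>C (x::'a::complex_vector))"
  using scaleC_add_left[of c "-c" x] by (simp add: eq_neg_iff_add_eq_0 add.commute)

lemma scaleC_diff_left: "(c - c') *\<^sub>C x = c *\<^sub>C x - c' *\<^sub>C (x::'a::complex_vector)"
  using scaleC_add_left[of c "-c'" x] by (simp add: scaleC_minus_left)

lemma scaleC_sum_right: "c *\<^sub>C sum f A = (\<Sum>i\<in>A. c *\<^sub>C (f i::'a::complex_vector))"
  by (induction A rule: infinite_finite_induct) (simp_all add: scaleC_add_right)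

lemma scaleC_sum_left: "sum f A *\<^sub>C (x::'a::complex_vector) = (\<Sum>i\<in>A. f i *\<^sub>C x)"
  by (induction A rule: infinite_finite_induct) (simp_all add: scaleC_add_left)

context hilbert_space
begin

lemma minus_mem: "x \<in> carr H \<Longrightarrow> - x \<in> carr H"
  using scale_mem[of x "-1"] by (simp add: scaleC_minus_one)

lemma diff_mem: "x \<in> carr H \<Longrightarrow> y \<in> carr H \<Longrightarrow> x - y \<in> carr H"
  using add_mem[of x "-y"] minus_mem[of y] by simp

lemma sum_mem: "(\<And>i. i \<in> A \<Longrightarrow> f i \<in> carr H) \<Longrightarrow> sum f A \<in> carr H"
  by (induction A rule: infinite_finite_induct) (auto simp: zero_mem add_mem)

lemmas mem = zero_mem add_mem scale_mem minus_mem diff_mem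

lemma ip_minus: "x \<in> carr H \<Longrightarrow> y \<in> carr H \<Longrightarrow> ip H (- x) y = - ip H x y"
  using ip_scale[of x y "-1"] by (simp add: scaleC_minus_one)

lemma ip_diff: "x \<in> carr H \<Longrightarrow> y \<in> carr H \<Longrightarrow> z \<in> carr H \<Longrightarrow> ip H (x - y) z = ip H x z - ip H y z"
  using ip_add[of x "-y" z] by (simp add: ip_minus minus_mem)

lemma ip_zero: "y \<in> carr H \<Longrightarrow> ip H 0 y = 0"
  using ip_scale[of 0 y 0] by (simp add: zero_mem)

lemma ip_add_right: "x \<in> carr H \<Longrightarrow> y \<in> carr H \<Longrightarrow> z \<in> carr H \<Longrightarrow> ip H z (x + y) = ip H z x + ip H z y"
  using ip_sym[of z "x+y"] ip_sym[of z x] ip_sym[of z y] ip_add[of x y z]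
  by (metis add_mem complex_cnj_add ip_sym)

lemma ip_scale_right: "x \<in> carr H \<Longrightarrow> y \<in> carr H \<Longrightarrow> ip H y (c *\<^sub>C x) = cnj c * ip H y x"
  by (metis complex_cnj_mult ip_scale ip_sym scale_mem)

lemma ip_diff_right: "x \<in> carr H \<Longrightarrow> y \<in> carr H \<Longrightarrow> z \<in> carr H \<Longrightarrow> ip H z (x - y) = ip H z x - ip H z y"
  by (metis diff_mem complex_cnj_diff ip_diff ip_sym)

lemma ip_sum: "(\<And>i. i \<in> A \<Longrightarrow> f i \<in> carr H) \<Longrightarrow> y \<in> carr H \<Longrightarrow> ip H (sum f A) y = (\<Sum>i\<in>A. ip H (f i) y)"
  by (induction A rule: infinite_finite_induct) (auto simp: ip_zero ip_add sum_mem)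

lemma ip_self: "x \<in> carr H \<Longrightarrow> ip H x x = of_real ((hnorm H x)\<^sup>2)"
proof -
  assume x: "x \<in> carr H"
  have "Im (ip H x x) = 0" using arg_cong[OF ip_sym[OF x x], of Im] by simp
  moreover have "0 \<le> Re (ip H x x)" using ip_pos[OF x] ip_zero[OF x] by (cases "x = 0") auto
  ultimately show ?thesis by (simp add: hnorm_def complex_eq_iff)
qed

lemma hnorm_nonneg: "x \<in> carr H \<Longrightarrow> 0 \<le> hnorm H x"
  using ip_pos[of x] ip_zero[of x] by (cases "x = 0") (auto simp: hnorm_def)

lemma hnorm_eq_0: "x \<in> carr H \<Longrightarrow> hnorm H x = 0 \<Longrightarrow> x = 0"
  using ip_pos[of x] by (auto simp: hnorm_def)

lemma hnorm_zero: "hnorm H 0 = 0"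
  by (simp add: hnorm_def ip_zero zero_mem)

lemma hnorm_scale: "x \<in> carr H \<Longrightarrow> hnorm H (c *\<^sub>C x) = cmod c * hnorm H x"
proof -
  assume x: "x \<in> carr H"
  have "ip H (c *\<^sub>C x) (c *\<^sub>C x) = (c * cnj c) * ip H x x"
    using x by (simp add: ip_scale ip_scale_right scale_mem)
  also have "\<dots> = of_real ((cmod c)\<^sup>2 * (hnorm H x)\<^sup>2)"
    using complex_norm_square[of c] by (simp add: ip_self x)
  finally have "hnorm H (c *\<^sub>C x) = sqrt ((cmod c * hnorm H x)\<^sup>2)"
    by (simp add: hnorm_def power_mult_distrib)
  thus ?thesis using hnorm_nonneg[OF x] by simp
qed

lemma hnorm_minus: "x \<in> carr H \<Longrightarrow> hnorm H (- x) = hnorm H x"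
  using hnorm_scale[of x "-1"] by (simp add: scaleC_minus_one)

lemma hnorm_diff_commute: "x \<in> carr H \<Longrightarrow> y \<in> carr H \<Longrightarrow> hnorm H (x - y) = hnorm H (y - x)"
  using hnorm_minus[of "x - y"] by (simp add: diff_mem)

lemma cauchy_schwarz: assumes x: "x \<in> carr H" and y: "y \<in> carr H"
  shows "cmod (ip H x y) \<le> hnorm H x * hnorm H y"
proof (cases "y = 0")
  case True
  then show ?thesis using ip_sym[OF y x] ip_zero[OF x] by (simp add: hnorm_zero)
next
  case False
  define N where "N = (hnorm H y)\<^sup>2"
  have N: "N > 0" using hnorm_eq_0[OF y] False by (auto simp: N_def)
  have yy: "ip H y y = of_real N" and xx: "ip H x x = of_real ((hnorm H x)\<^sup>2)"
    by (simp_all add: N_def ip_self x y)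
  define p where "p = ip H x y"
  define w where "w = of_real N *\<^sub>C x - p *\<^sub>C y"
  have w: "w \<in> carr H" by (simp add: w_def x y mem)
  have yx: "ip H y x = cnj p" by (simp add: p_def ip_sym[OF x y])
  have "ip H w w = of_real N * (of_real N * of_real ((hnorm H x)\<^sup>2)) - of_real N * (cnj p * p)"
    unfolding w_def
    by (simp add: ip_diff ip_diff_right ip_scale ip_scale_right x y mem yy yx xx p_def[symmetric] algebra_simps)
  also have "\<dots> = of_real (N * (N * (hnorm H x)\<^sup>2 - (cmod p)\<^sup>2))"
    using complex_norm_square[of p] by (simp add: algebra_simps)
  finally have "0 \<le> N * (N * (hnorm H x)\<^sup>2 - (cmod p)\<^sup>2)"
    using ip_self[OF w] by (metis of_real_eq_iff zero_le_power2)
  hence "(cmod p)\<^sup>2 \<le> (hnorm H x * hnorm H y)\<^sup>2"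
    using N by (simp add: zero_le_mult_iff N_def power_mult_distrib mult.commute)
  thus ?thesis unfolding p_def
    by (rule power2_le_imp_le) (simp add: hnorm_nonneg x y)
qed

lemma hnorm_triangle: assumes x: "x \<in> carr H" and y: "y \<in> carr H"
  shows "hnorm H (x + y) \<le> hnorm H x + hnorm H y"
proof -
  have "(hnorm H (x + y))\<^sup>2 = Re (ip H (x + y) (x + y))"
    using ip_self[of "x + y"] x y by (simp add: add_mem)
  also have "\<dots> = Re (ip H x x) + Re (ip H y y) + (Re (ip H x y) + Re (ip H y x))"
    using x y by (simp add: ip_add ip_add_right add_mem)
  also have "Re (ip H y x) = Re (ip H x y)" using ip_sym[OF x y] by simp
  also have "Re (ip H x x) + Re (ip H y y) + (Re (ip H x y) + Re (ip H x y))
      \<le> (hnorm H x)\<^sup>2 + (hnorm H y)\<^sup>2 + 2 * (hnorm H x * hnorm H y)"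
    using cauchy_schwarz[OF x y] complex_Re_le_cmod[of "ip H x y"] by (simp add: ip_self x y)
  finally have "(hnorm H (x + y))\<^sup>2 \<le> (hnorm H x + hnorm H y)\<^sup>2"
    by (simp add: power2_sum)
  thus ?thesis by (rule power2_le_imp_le) (simp add: hnorm_nonneg x y)
qed

lemma hnorm_triangle_diff: assumes "x \<in> carr H" "y \<in> carr H"
  shows "hnorm H (x - y) \<le> hnorm H x + hnorm H y"
  using hnorm_triangle[of x "-y"] assms by (simp add: minus_mem hnorm_minus)

lemma hnorm_triangle3: assumes "x \<in> carr H" "y \<in> carr H" "z \<in> carr H"
  shows "hnorm H (x - z) \<le> hnorm H (x - y) + hnorm H (y - z)"
  using hnorm_triangle[of "x - y" "y - z"] assms by (simp add: diff_mem)

lemma hnorm_sum: "(\<And>i. i \<in> A \<Longrightarrow> f i \<in> carr H) \<Longrightarrow> hnorm H (sum f A) \<le> (\<Sum>i\<in>A. hnorm H (f i))"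
proof (induction A rule: infinite_finite_induct)
  case (insert a A)
  then show ?case using hnorm_triangle[of "f a" "sum f A"] by (auto simp: sum_mem)
qed (auto simp: hnorm_zero)

lemma hnorm_add_sq_le: assumes x: "x \<in> carr H" and y: "y \<in> carr H"
  shows "(hnorm H (x + y))\<^sup>2 \<le> 2 * (hnorm H x)\<^sup>2 + 2 * (hnorm H y)\<^sup>2"
proof -
  have "(hnorm H (x + y))\<^sup>2 \<le> (hnorm H x + hnorm H y)\<^sup>2"
    using hnorm_triangle[OF x y] by (intro power_mono hnorm_nonneg add_mem x y)
  also have "\<dots> \<le> 2 * (hnorm H x)\<^sup>2 + 2 * (hnorm H y)\<^sup>2"
    using zero_le_power2[of "hnorm H x - hnorm H y"] by (simp add: power2_sum power2_diff)
  finally show ?thesis .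
qed

lemma hconv_unique: assumes "\<And>n. X n \<in> carr H" "l \<in> carr H" "l' \<in> carr H" "hconv H X l" "hconv H X l'"
  shows "l = l'"
proof -
  have "(\<lambda>n. hnorm H (X n - l) + hnorm H (X n - l')) \<longlonglongrightarrow> 0 + 0"
    using assms(4,5) unfolding hconv_def by (rule tendsto_add)
  moreover have "hnorm H (l - l') \<le> hnorm H (X n - l) + hnorm H (X n - l')" for n
    using hnorm_triangle3[of l "X n" l'] hnorm_diff_commute[of l "X n"] assms by simp
  ultimately have "hnorm H (l - l') \<le> 0 + 0"
    by (intro LIMSEQ_le_const[where X = "\<lambda>n. hnorm H (X n - l) + hnorm H (X n - l')"]) auto
  hence "l - l' = 0" using hnorm_nonneg[of "l - l'"] hnorm_eq_0[of "l - l'"] assms by (auto simp: diff_mem)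
  thus ?thesis by simp
qed

lemma hconv_add: assumes "\<And>n. X n \<in> carr H" "\<And>n. Y n \<in> carr H" "l \<in> carr H" "m \<in> carr H" "hconv H X l" "hconv H Y m"
  shows "hconv H (\<lambda>n. X n + Y n) (l + m)"
  unfolding hconv_def
proof (rule tendsto_sandwich[OF _ _ tendsto_const])
  show "(\<lambda>n. hnorm H (X n - l) + hnorm H (Y n - m)) \<longlonglongrightarrow> 0"
    using tendsto_add[OF assms(5,6)[unfolded hconv_def]] by simp
  show "\<forall>\<^sub>F n in sequentially. 0 \<le> hnorm H (X n + Y n - (l + m))"
    by (simp add: hnorm_nonneg assms mem)
  have "hnorm H (X n + Y n - (l + m)) \<le> hnorm H (X n - l) + hnorm H (Y n - m)" for n
    using hnorm_triangle[of "X n - l" "Y n - m"] assms(1-4) by (simp add: mem algebra_simps)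
  thus "\<forall>\<^sub>F n in sequentially. hnorm H (X n + Y n - (l + m)) \<le> hnorm H (X n - l) + hnorm H (Y n - m)"
    by simp
qed

lemma hconv_scale: assumes "\<And>n. X n \<in> carr H" "l \<in> carr H" "hconv H X l"
  shows "hconv H (\<lambda>n. c *\<^sub>C X n) (c *\<^sub>C l)"
proof -
  have "hnorm H (c *\<^sub>C X n - c *\<^sub>C l) = cmod c * hnorm H (X n - l)" for n
    using assms by (simp add: scaleC_diff_right[symmetric] hnorm_scale diff_mem)
  thus ?thesis using tendsto_mult_left[OF assms(3)[unfolded hconv_def], of "cmod c"]
    by (simp add: hconv_def)
qed

lemma hconv_ip: assumes "\<And>n. X n \<in> carr H" "l \<in> carr H" "y \<in> carr H" "hconv H X l"
  shows "(\<lambda>n. ip H (X n) y) \<longlonglongrightarrow> ip H l y"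
proof -
  have "(\<lambda>n. ip H (X n) y - ip H l y) \<longlonglongrightarrow> 0"
  proof (rule Lim_null_comparison)
    show "\<forall>\<^sub>F n in sequentially. norm (ip H (X n) y - ip H l y) \<le> hnorm H (X n - l) * hnorm H y"
      using cauchy_schwarz[of "X n - l" y for n] assms(1-3) by (simp add: ip_diff diff_mem)
    show "(\<lambda>n. hnorm H (X n - l) * hnorm H y) \<longlonglongrightarrow> 0"
      using tendsto_mult_right[OF assms(4)[unfolded hconv_def], of "hnorm H y"] by simp
  qed
  thus ?thesis by (simp add: LIM_zero_iff)
qed

lemma hconv_norm: assumes "\<And>n. X n \<in> carr H" "l \<in> carr H" "hconv H X l"
  shows "(\<lambda>n. hnorm H (X n)) \<longlonglongrightarrow> hnorm H l"
proof -
  have "(\<lambda>n. hnorm H (X n) - hnorm H l) \<longlonglongrightarrow> 0"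
  proof (rule Lim_null_comparison)
    have "norm (hnorm H (X n) - hnorm H l) \<le> hnorm H (X n - l)" for n
      using hnorm_triangle[of "X n - l" l] hnorm_triangle[of "l - X n" "X n"]
        hnorm_diff_commute[of l "X n"] assms(1,2) by (simp add: diff_mem abs_le_iff)
    thus "\<forall>\<^sub>F n in sequentially. norm (hnorm H (X n) - hnorm H l) \<le> hnorm H (X n - l)" by simp
  qed (use assms(3) in \<open>simp add: hconv_def\<close>)
  thus ?thesis by (simp add: LIM_zero_iff)
qed

lemma summable_hconv:
  assumes f: "\<And>n. f n \<in> carr H" and s: "summable (\<lambda>n. hnorm H (f n))"
  shows "\<exists>l\<in>carr H. hconv H (\<lambda>N. \<Sum>n<N. f n) l"
proof (rule complete)
  show "(\<Sum>n<N. f n) \<in> carr H" for N by (simp add: f sum_mem)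
  fix e :: real assume e: "0 < e"
  obtain N where N: "\<And>m n. N \<le> m \<Longrightarrow> norm (\<Sum>k\<in>{m..<n}. hnorm H (f k)) < e"
    using s e unfolding summable_Cauchy by blast
  have 1: "hnorm H ((\<Sum>k<n. f k) - (\<Sum>k<m. f k)) < e" if "N \<le> m" "m \<le> n" for m n
  proof -
    have "(\<Sum>k<n. f k) - (\<Sum>k<m. f k) = (\<Sum>k\<in>{m..<n}. f k)"
      using that sum_diff_nat_ivl[of 0 m n f] by (simp add: atLeast0LessThan)
    thus ?thesis using hnorm_sum[of "{m..<n}" f] N[OF that(1), of n] by (simp add: f)
  qed
  show "\<exists>N. \<forall>m\<ge>N. \<forall>n\<ge>N. hnorm H ((\<Sum>k<m. f k) - (\<Sum>k<n. f k)) < e"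
  proof (intro exI[of _ N] allI impI)
    fix m n assume "N \<le> m" "N \<le> n"
    thus "hnorm H ((\<Sum>k<m. f k) - (\<Sum>k<n. f k)) < e"
      using 1[of m n] 1[of n m] hnorm_diff_commute[of "\<Sum>k<m. f k" "\<Sum>k<n. f k"]
      by (cases "m \<le> n") (auto simp: f sum_mem)
  qed
qed

end

lemma hilbert_space_complex: "hilbert_space complex_hilb"
proof
  fix X :: "nat \<Rightarrow> complex"
  assume *: "\<And>e. 0 < e \<Longrightarrow> \<exists>N. \<forall>m\<ge>N. \<forall>n\<ge>N. hnorm complex_hilb (X m - X n) < e"
  have n: "hnorm complex_hilb = cmod"
    by (rule ext) (simp add: hnorm_def complex_hilb_def cmod_def power2_eq_square)
  have "Cauchy X" using * by (auto simp: Cauchy_def dist_norm n)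
  then obtain l where "X \<longlonglongrightarrow> l" using Cauchy_convergent convergent_def by blast
  thus "\<exists>l\<in>carr complex_hilb. hconv complex_hilb X l"
    unfolding hconv_def n by (auto simp: complex_hilb_def tendsto_norm_zero_iff LIM_zero_iff)
next
  fix x :: complex assume "x \<noteq> 0"
  thus "0 < Re (ip complex_hilb x x)"
    by (auto simp: complex_hilb_def complex_eq_iff sum_squares_gt_zero_iff)
qed (auto simp: complex_hilb_def scaleC_complex_def algebra_simps)

lemma hnorm_complex: "hnorm complex_hilb = cmod"
    by (rule ext) (simp add: hnorm_def complex_hilb_def cmod_def power2_eq_square)


lemma powser_coeff_zero:
  fixes c :: "nat \<Rightarrow> complex"
  assumes "\<And>z. cmod z < 1 \<Longrightarrow> (\<lambda>n. c n * z ^ n) sums 0"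
  shows "c n = 0"
proof (induction n rule: less_induct)
  case (less n)
  have "(\<lambda>k. c (k + n) * z ^ k) sums 0" if z: "z \<noteq> 0" "cmod z < 1" for z
  proof -
    have "(\<lambda>k. c (k + n) * z ^ (k + n)) sums (0 - (\<Sum>i<n. c i * z ^ i))"
      by (rule sums_split_initial_segment[OF assms[OF z(2)]])
    hence "(\<lambda>k. c (k + n) * z ^ (k + n) * (1 / z ^ n)) sums (0 * (1 / z ^ n))"
      using less by (intro sums_mult2) simp
    thus ?thesis using z by (simp add: power_add)
  qed
  hence "((\<lambda>_. 0) \<longlongrightarrow> c (0 + n)) (at (0::complex))"
    using powser_limit_0_strong[of 1 "\<lambda>k. c (k + n)" "\<lambda>_. 0"] by simp
  thus "c n = 0" using LIM_unique[of "\<lambda>_. 0" "c n" 0 0] by simp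
qed

context hilbert_space
begin

definition l2 :: "(nat \<Rightarrow> 'a) \<Rightarrow> bool"
  where "l2 a \<longleftrightarrow> (\<forall>n. a n \<in> carr H) \<and> summable (\<lambda>n. (hnorm H (a n))\<^sup>2)"

lemma l2_mem: "l2 a \<Longrightarrow> a n \<in> carr H"
  by (simp add: l2_def)

lemma l2_add: "l2 a \<Longrightarrow> l2 b \<Longrightarrow> l2 (\<lambda>n. a n + b n)"
  unfolding l2_def
  by (auto simp: add_mem intro!: summable_comparison_test'[OF summable_add[OF summable_mult[of _ 2] summable_mult[of _ 2]], of "\<lambda>n. (hnorm H (a n))\<^sup>2" "\<lambda>n. (hnorm H (b n))\<^sup>2" 0] hnorm_add_sq_le)

lemma l2_scale: "l2 a \<Longrightarrow> l2 (\<lambda>n. c *\<^sub>C a n)"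
  unfolding l2_def by (auto simp: scale_mem hnorm_scale power_mult_distrib intro!: summable_mult)

lemma l2_diff: "l2 a \<Longrightarrow> l2 b \<Longrightarrow> l2 (\<lambda>n. a n - b n)"
  using l2_add[of a "\<lambda>n. (-1) *\<^sub>C b n"] l2_scale[of b "-1"] by (simp add: scaleC_minus_one)

lemma l2_finite: "(\<And>n. a n \<in> carr H) \<Longrightarrow> (\<And>n. N \<le> n \<Longrightarrow> a n = 0) \<Longrightarrow> l2 a"
  unfolding l2_def by (intro conjI allI summable_finite[of "{..<N}"]) (auto simp: hnorm_zero not_less)

lemma l2_summable_ip: assumes a: "l2 a" and b: "l2 b" shows "summable (\<lambda>n. ip H (a n) (b n))"
proof (rule summable_comparison_test'[where N = 0])
  show "summable (\<lambda>n. (hnorm H (a n))\<^sup>2 + (hnorm H (b n))\<^sup>2)"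
    using a b by (auto simp: l2_def intro: summable_add)
  fix n
  have "norm (ip H (a n) (b n)) \<le> hnorm H (a n) * hnorm H (b n)"
    by (rule cauchy_schwarz) (use a b in \<open>auto simp: l2_def\<close>)
  also have "\<dots> \<le> (hnorm H (a n))\<^sup>2 + (hnorm H (b n))\<^sup>2"
    using zero_le_power2[of "hnorm H (a n) - hnorm H (b n)"]
      zero_le_power2[of "hnorm H (a n)"] zero_le_power2[of "hnorm H (b n)"]
    unfolding power2_diff by linarith
  finally show "norm (ip H (a n) (b n)) \<le> (hnorm H (a n))\<^sup>2 + (hnorm H (b n))\<^sup>2" .
qed

lemma has_taylor_l2: "has_taylor H f a \<Longrightarrow> l2 a"
  by (simp add: has_taylor_def l2_def)

lemma ex_has_taylor: assumes a: "l2 a" shows "\<exists>f. has_taylor H f a"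
proof -
  have "\<exists>l. if cmod z < 1 then l \<in> carr H \<and> hconv H (\<lambda>N. \<Sum>n<N. z ^ n *\<^sub>C a n) l else l = 0" for z
  proof (cases "cmod z < 1")
    case True
    have "summable (\<lambda>n. hnorm H (z ^ n *\<^sub>C a n))"
    proof (rule summable_comparison_test'[where N = 0])
      have "(cmod z)\<^sup>2 < 1" using True by (simp add: power_less_one_iff)
      thus "summable (\<lambda>n. ((cmod z)\<^sup>2) ^ n + (hnorm H (a n))\<^sup>2)"
        using a by (auto simp: l2_def intro!: summable_add summable_geometric)
      fix n
      have "norm (hnorm H (z ^ n *\<^sub>C a n)) = cmod z ^ n * hnorm H (a n)"
        using l2_mem[OF a] by (simp add: hnorm_scale hnorm_nonneg norm_power)
      also have "\<dots> \<le> (cmod z ^ n)\<^sup>2 + (hnorm H (a n))\<^sup>2"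
        using zero_le_power2[of "cmod z ^ n - hnorm H (a n)"]
          zero_le_power2[of "cmod z ^ n"] zero_le_power2[of "hnorm H (a n)"]
        unfolding power2_diff by linarith
      finally show "norm (hnorm H (z ^ n *\<^sub>C a n)) \<le> ((cmod z)\<^sup>2) ^ n + (hnorm H (a n))\<^sup>2"
        by (simp add: power_mult[symmetric] mult.commute)
    qed
    then show ?thesis using summable_hconv[of "\<lambda>n. z ^ n *\<^sub>C a n"] l2_mem[OF a] True
      by (auto simp: scale_mem)
  qed auto
  then obtain f where "\<forall>z. if cmod z < 1 then f z \<in> carr H \<and> hconv H (\<lambda>N. \<Sum>n<N. z ^ n *\<^sub>C a n) (f z) else f z = 0"
    by metis
  hence "has_taylor H f a" using a unfolding has_taylor_def l2_def by blast
  thus ?thesis by blast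
qed

lemma has_taylor_add: "has_taylor H f a \<Longrightarrow> has_taylor H g b \<Longrightarrow> has_taylor H (f + g) (\<lambda>n. a n + b n)"
  using l2_add[OF has_taylor_l2 has_taylor_l2, of f a g b]
    hconv_add[of "\<lambda>N. \<Sum>n<N. z ^ n *\<^sub>C a n" "\<lambda>N. \<Sum>n<N. z ^ n *\<^sub>C b n" "f z" "g z" for z]
  unfolding has_taylor_def l2_def
  by (auto simp: add_mem scale_mem sum_mem scaleC_add_right sum.distrib)

lemma has_taylor_scale: "has_taylor H f a \<Longrightarrow> has_taylor H (c *\<^sub>C f) (\<lambda>n. c *\<^sub>C a n)"
  using l2_scale[OF has_taylor_l2, of f a c]
    hconv_scale[of "\<lambda>N. \<Sum>n<N. z ^ n *\<^sub>C a n" "f z" c for z]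
  unfolding has_taylor_def l2_def
  by (auto simp: scale_mem sum_mem scaleC_sum_right scaleC_scaleC scaleC_fun_def mult.commute)

lemma has_taylor_unique_fun: assumes "has_taylor H f a" "has_taylor H g a" shows "f = g"
proof
  fix z show "f z = g z"
    using assms hconv_unique[of "\<lambda>N. \<Sum>n<N. z ^ n *\<^sub>C a n" "f z" "g z"]
    unfolding has_taylor_def by (cases "cmod z < 1") (auto simp: sum_mem scale_mem)
qed

lemma has_taylor_zero: "has_taylor H 0 (\<lambda>n. 0)"
  by (auto simp: has_taylor_def zero_mem hnorm_zero hconv_def)

lemma has_taylor_zero_coeff: assumes "has_taylor H 0 a" shows "a n = 0"
proof -
  have mem: "a n \<in> carr H" for n using assms by (simp add: has_taylor_def)
  have "ip H (a n) y = 0" if y: "y \<in> carr H" for y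
  proof (rule powser_coeff_zero)
    fix z :: complex assume "cmod z < 1"
    hence "hconv H (\<lambda>N. \<Sum>n<N. z ^ n *\<^sub>C a n) 0"
      using assms by (auto simp: has_taylor_def split: if_splits)
    hence "(\<lambda>N. ip H (\<Sum>n<N. z ^ n *\<^sub>C a n) y) \<longlonglongrightarrow> ip H 0 y"
      by (intro hconv_ip) (auto simp: sum_mem scale_mem mem zero_mem y)
    thus "(\<lambda>n. ip H (a n) y * z ^ n) sums 0"
      by (simp add: sums_def ip_sum ip_scale ip_zero scale_mem mem y mult.commute)
  qed
  hence "ip H (a n) (a n) = 0" by (simp add: mem)
  thus ?thesis using hnorm_eq_0[OF mem[of n]] by (simp add: ip_self mem)
qed

lemma has_taylor_unique: assumes "has_taylor H f a" "has_taylor H f b" shows "a = b"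
proof
  fix n
  have "has_taylor H (f + (-1) *\<^sub>C f) (\<lambda>n. a n + (-1) *\<^sub>C b n)"
    by (intro has_taylor_add has_taylor_scale assms)
  hence "has_taylor H 0 (\<lambda>n. a n + (-1) *\<^sub>C b n)" by (simp only: scaleC_minus_one) simp
  from has_taylor_zero_coeff[OF this, of n] show "a n = b n" by (simp add: scaleC_minus_one)
qed

lemma taylor_eq: "has_taylor H f a \<Longrightarrow> taylor H f = a"
  unfolding taylor_def using has_taylor_unique by blast

lemma hardy_carr: "f \<in> carr (hardy H) \<longleftrightarrow> has_taylor H f (taylor H f)"
  using taylor_eq by (auto simp: hardy_def)

lemma hardy_memI: "has_taylor H f a \<Longrightarrow> f \<in> carr (hardy H)"
  by (auto simp: hardy_def)

lemma taylor_l2: "f \<in> carr (hardy H) \<Longrightarrow> l2 (taylor H f)"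
  using has_taylor_l2 hardy_carr by blast

lemma taylor_add: "f \<in> carr (hardy H) \<Longrightarrow> g \<in> carr (hardy H) \<Longrightarrow> taylor H (f + g) = (\<lambda>n. taylor H f n + taylor H g n)"
  by (intro taylor_eq has_taylor_add) (simp_all add: hardy_carr)

lemma taylor_scale: "f \<in> carr (hardy H) \<Longrightarrow> taylor H (c *\<^sub>C f) = (\<lambda>n. c *\<^sub>C taylor H f n)"
  by (intro taylor_eq has_taylor_scale) (simp_all add: hardy_carr)

lemma hardy_add: "f \<in> carr (hardy H) \<Longrightarrow> g \<in> carr (hardy H) \<Longrightarrow> f + g \<in> carr (hardy H)"
  using has_taylor_add hardy_carr hardy_memI by blast

lemma hardy_scale: "f \<in> carr (hardy H) \<Longrightarrow> c *\<^sub>C f \<in> carr (hardy H)"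
  using has_taylor_scale hardy_carr hardy_memI by blast

lemma hardy_diff: "f \<in> carr (hardy H) \<Longrightarrow> g \<in> carr (hardy H) \<Longrightarrow> f - g \<in> carr (hardy H)"
  using hardy_add[of f "(-1) *\<^sub>C g"] hardy_scale[of g "-1"] unfolding scaleC_minus_one by simp

lemma taylor_diff: "f \<in> carr (hardy H) \<Longrightarrow> g \<in> carr (hardy H) \<Longrightarrow> taylor H (f - g) = (\<lambda>n. taylor H f n - taylor H g n)"
  using taylor_add[of f "(-1) *\<^sub>C g"] hardy_scale[of g "-1"] taylor_scale[of g "-1"]
  unfolding scaleC_minus_one by simp

lemma hardy_ip: "ip (hardy H) f g = (\<Sum>n. ip H (taylor H f n) (taylor H g n))"
  by (simp add: hardy_def)

lemma hardy_ip_self: "f \<in> carr (hardy H) \<Longrightarrow> ip (hardy H) f f = of_real (\<Sum>n. (hnorm H (taylor H f n))\<^sup>2)"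
  using taylor_l2[of f] suminf_of_real[of "\<lambda>n. (hnorm H (taylor H f n))\<^sup>2", where 'a = complex]
  by (auto simp: hardy_ip ip_self l2_def simp flip: of_real_power)

lemma hardy_norm: "f \<in> carr (hardy H) \<Longrightarrow> hnorm (hardy H) f = sqrt (\<Sum>n. (hnorm H (taylor H f n))\<^sup>2)"
  by (simp add: hnorm_def[of "hardy H"] hardy_ip_self)

lemma hardy_norm_sq: "f \<in> carr (hardy H) \<Longrightarrow> (hnorm (hardy H) f)\<^sup>2 = (\<Sum>n. (hnorm H (taylor H f n))\<^sup>2)"
  using taylor_l2[of f] by (simp add: hardy_norm suminf_nonneg l2_def)

lemma hardy_norm_le:
  assumes "f \<in> carr (hardy H)" "0 \<le> e" "\<And>k. (\<Sum>n<k. (hnorm H (taylor H f n))\<^sup>2) \<le> e\<^sup>2"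
  shows "hnorm (hardy H) f \<le> e"
proof -
  have "(\<Sum>n. (hnorm H (taylor H f n))\<^sup>2) \<le> e\<^sup>2"
    using assms taylor_l2[of f] by (intro suminf_le_const) (auto simp: l2_def)
  thus ?thesis using assms(1,2) by (simp add: hardy_norm real_le_lsqrt real_sqrt_le_iff real_le_rsqrt sqrt_le_D suminf_nonneg real_sqrt_le_mono order_trans[OF real_sqrt_le_mono])
qed

lemma hardy_complete:
  assumes X: "\<And>n. X n \<in> carr (hardy H)"
    and cau: "\<And>e. 0 < e \<Longrightarrow> \<exists>N. \<forall>m\<ge>N. \<forall>n\<ge>N. hnorm (hardy H) (X m - X n) < e"
  shows "\<exists>l\<in>carr (hardy H). hconv (hardy H) X l"
proof -
  define A where "A m = taylor H (X m)" for m
  have A: "l2 (A m)" for m unfolding A_def by (rule taylor_l2[OF X])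
  have Am: "A m n \<in> carr H" for m n by (rule l2_mem[OF A])
  have tA: "taylor H (X m - X p) = (\<lambda>n. A m n - A p n)" for m p
    by (simp add: A_def taylor_diff X)
  have part: "(\<Sum>n<k. (hnorm H (A m n - A p n))\<^sup>2) \<le> (hnorm (hardy H) (X m - X p))\<^sup>2" for m p k
    unfolding hardy_norm_sq[OF hardy_diff[OF X X]] tA
    using l2_diff[OF A A, of m p] by (intro sum_le_suminf) (auto simp: l2_def)
  have nn: "0 \<le> hnorm (hardy H) (X m - X p)" for m p
    using l2_diff[OF A A, of m p] by (auto simp: hardy_norm hardy_diff X tA l2_def suminf_nonneg)
  have coord: "hnorm H (A m n - A p n) \<le> hnorm (hardy H) (X m - X p)" for m p n
  proof (rule power2_le_imp_le[OF order_trans[OF _ part[where k = "Suc n"]]])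
    show "(hnorm H (A m n - A p n))\<^sup>2 \<le> (\<Sum>i<Suc n. (hnorm H (A m i - A p i))\<^sup>2)"
      by (rule member_le_sum) auto
  qed (rule nn)
  have "\<exists>l\<in>carr H. hconv H (\<lambda>m. A m n) l" for n
  proof (rule complete)
    fix e :: real assume "0 < e"
    from cau[OF this] show "\<exists>N. \<forall>m\<ge>N. \<forall>p\<ge>N. hnorm H (A m n - A p n) < e"
      using coord[of _ n] by (meson le_less_trans)
  qed (rule Am)
  then obtain l where l: "\<And>n. l n \<in> carr H" "\<And>n. hconv H (\<lambda>m. A m n) (l n)" by metis
  have lim: "(\<Sum>n<k. (hnorm H (A m n - l n))\<^sup>2) \<le> e\<^sup>2"
    if N: "\<forall>m\<ge>N. \<forall>n\<ge>N. hnorm (hardy H) (X m - X n) < e" and m: "N \<le> m" for e N m k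
  proof (rule LIMSEQ_le_const2)
    show "(\<lambda>p. \<Sum>n<k. (hnorm H (A m n - A p n))\<^sup>2) \<longlonglongrightarrow> (\<Sum>n<k. (hnorm H (A m n - l n))\<^sup>2)"
    proof (intro tendsto_sum tendsto_power hconv_norm)
      fix n
      have "hnorm H (A m n - A p n - (A m n - l n)) = hnorm H (A p n - l n)" for p
        using hnorm_diff_commute[of "l n" "A p n"] by (simp add: Am l)
      thus "hconv H (\<lambda>p. A m n - A p n) (A m n - l n)"
        using l(2)[of n] by (simp add: hconv_def)
    qed (auto simp: Am l diff_mem)
    show "\<exists>M. \<forall>p\<ge>M. (\<Sum>n<k. (hnorm H (A m n - A p n))\<^sup>2) \<le> e\<^sup>2"
    proof (intro exI[of _ N] allI impI)
      fix p assume "N \<le> p"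
      hence "(hnorm (hardy H) (X m - X p))\<^sup>2 \<le> e\<^sup>2"
        using N m nn[of m p] by (intro power_mono) (auto simp: less_imp_le)
      with part[where k = k and m = m and p = p] show "(\<Sum>n<k. (hnorm H (A m n - A p n))\<^sup>2) \<le> e\<^sup>2" by linarith
    qed
  qed
  have l2d: "l2 (\<lambda>n. A m n - l n)" if N: "\<forall>m\<ge>N. \<forall>n\<ge>N. hnorm (hardy H) (X m - X n) < e" and m: "N \<le> m" for e N m
    unfolding l2_def
  proof
    show "summable (\<lambda>n. (hnorm H (A m n - l n))\<^sup>2)"
      by (rule summableI_nonneg_bounded[of _ "e\<^sup>2"]) (use lim[OF N m] in auto)
  qed (auto simp: Am l diff_mem)
  obtain N1 where N1: "\<forall>m\<ge>N1. \<forall>n\<ge>N1. hnorm (hardy H) (X m - X n) < 1" using cau[of 1] by auto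
  have "l2 l" using l2_diff[OF A[of N1] l2d[OF N1, of N1]] by simp
  then obtain f where f: "has_taylor H f l" using ex_has_taylor by blast
  hence fm: "f \<in> carr (hardy H)" and tf: "taylor H f = l" by (auto intro: hardy_memI taylor_eq)
  have "hconv (hardy H) X f"
    unfolding hconv_def
  proof (rule LIMSEQ_I)
    fix r :: real assume r: "0 < r"
    obtain N where N: "\<forall>m\<ge>N. \<forall>n\<ge>N. hnorm (hardy H) (X m - X n) < r / 2" using cau[of "r/2"] r by auto
    have "norm (hnorm (hardy H) (X m - f) - 0) < r" if "N \<le> m" for m
    proof -
      have d: "X m - f \<in> carr (hardy H)" "taylor H (X m - f) = (\<lambda>n. A m n - l n)"
        by (simp_all add: hardy_diff taylor_diff X fm tf A_def)
      have "hnorm (hardy H) (X m - f) \<le> r / 2"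
        using lim[OF N that] r by (intro hardy_norm_le) (auto simp: d)
      moreover have "0 \<le> hnorm (hardy H) (X m - f)"
        using taylor_l2[OF d(1)] by (simp add: hardy_norm d(1) suminf_nonneg l2_def)
      ultimately show ?thesis using r by simp
    qed
    thus "\<exists>N. \<forall>n\<ge>N. norm (hnorm (hardy H) (X n - f) - 0) < r" by blast
  qed
  thus ?thesis using fm by blast
qed

theorem hilbert_space_hardy: "hilbert_space (hardy H)"
proof
  show "0 \<in> carr (hardy H)" using has_taylor_zero by (rule hardy_memI)
  fix f g h :: "complex \<Rightarrow> 'a" and c
  assume f: "f \<in> carr (hardy H)"
  show "c *\<^sub>C f \<in> carr (hardy H)" by (rule hardy_scale[OF f])
  show "0 < Re (ip (hardy H) f f)" if "f \<noteq> 0"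
  proof -
    have "taylor H f \<noteq> (\<lambda>n. 0)"
      using that f has_taylor_unique_fun[OF _ has_taylor_zero] hardy_carr by metis
    then obtain n where "taylor H f n \<noteq> 0" by auto
    hence "0 < (hnorm H (taylor H f n))\<^sup>2" using hnorm_eq_0 l2_mem[OF taylor_l2[OF f]] by auto
    moreover have "summable (\<lambda>n. (hnorm H (taylor H f n))\<^sup>2)" using taylor_l2[OF f] by (simp add: l2_def)
    ultimately show ?thesis by (auto simp: hardy_ip_self[OF f] intro: suminf_pos2)
  qed
  assume g: "g \<in> carr (hardy H)"
  note l2 = taylor_l2[OF f] taylor_l2[OF g]
  show "f + g \<in> carr (hardy H)" by (rule hardy_add[OF f g])
  show "ip (hardy H) (c *\<^sub>C f) g = c * ip (hardy H) f g"
    using l2_summable_ip[OF l2] by (simp add: hardy_ip taylor_scale f ip_scale l2_mem l2 suminf_mult)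
  show "ip (hardy H) g f = cnj (ip (hardy H) f g)"
  proof -
    have "(\<lambda>n. ip H (taylor H f n) (taylor H g n)) sums ip (hardy H) f g"
      using l2_summable_ip[OF l2] by (simp add: hardy_ip summable_sums)
    hence "(\<lambda>n. cnj (ip H (taylor H f n) (taylor H g n))) sums cnj (ip (hardy H) f g)"
      by (simp add: sums_cnj)
    thus ?thesis using ip_sym[OF l2_mem[OF l2(1)] l2_mem[OF l2(2)]] by (simp add: hardy_ip sums_iff)
  qed
  assume h: "h \<in> carr (hardy H)"
  show "ip (hardy H) (f + g) h = ip (hardy H) f h + ip (hardy H) g h"
    using l2_summable_ip[OF l2(1) taylor_l2[OF h]] l2_summable_ip[OF l2(2) taylor_l2[OF h]]
    by (simp add: hardy_ip taylor_add f g h ip_add l2_mem l2 taylor_l2 suminf_add)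
qed (rule hardy_complete)

end

lemma linear_op_elem_tensor_left:
  assumes "hilbert_space E" "\<And>f x. f \<in> carr H2 \<Longrightarrow> x \<in> carr E \<Longrightarrow> elem_tensor f x \<in> carr (H2_tensor E)"
    and "x \<in> carr E"
  shows "linear_op H2 (H2_tensor E) (\<lambda>f. elem_tensor f x)"
  using assms(2,3) by (simp add: linear_op_def elem_tensor_def fun_eq_iff scaleC_fun_def scaleC_complex_def scaleC_add_left scaleC_scaleC)

lemma has_taylor_elem_tensor:
  assumes E: "hilbert_space E" and f: "has_taylor complex_hilb f a" and x: "x \<in> carr E"
  shows "has_taylor E (elem_tensor f x) (\<lambda>n. a n *\<^sub>C x)"
proof -
  interpret E: hilbert_space E by fact
  show ?thesis unfolding has_taylor_def
  proof (intro conjI allI)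
    show "a n *\<^sub>C x \<in> carr E" for n by (rule E.scale_mem[OF x])
    show "summable (\<lambda>n. (hnorm E (a n *\<^sub>C x))\<^sup>2)"
      using f by (auto simp: has_taylor_def E.hnorm_scale x hnorm_complex power_mult_distrib intro: summable_mult2)
    fix z
    have "hnorm E ((\<Sum>n<N. z ^ n *\<^sub>C a n *\<^sub>C x) - f z *\<^sub>C x) = cmod ((\<Sum>n<N. z ^ n *\<^sub>C a n) - f z) * hnorm E x" for N
      by (simp add: scaleC_sum_left[symmetric] scaleC_scaleC scaleC_diff_left[symmetric] E.hnorm_scale x scaleC_complex_def)
    moreover have "cmod z < 1 \<Longrightarrow> (\<lambda>N. cmod ((\<Sum>n<N. z ^ n *\<^sub>C a n) - f z) * hnorm E x) \<longlonglongrightarrow> 0"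
    proof (rule tendsto_mult_left_zero)
      assume "cmod z < 1"
      hence "hconv complex_hilb (\<lambda>N. \<Sum>n<N. z ^ n *\<^sub>C a n) (f z)"
        using f unfolding has_taylor_def by presburger
      thus "(\<lambda>N. cmod ((\<Sum>n<N. z ^ n *\<^sub>C a n) - f z)) \<longlonglongrightarrow> 0"
        by (simp add: hconv_def hnorm_complex)
    qed
    ultimately show "if cmod z < 1 then elem_tensor f x z \<in> carr E \<and> hconv E (\<lambda>N. \<Sum>n<N. z ^ n *\<^sub>C a n *\<^sub>C x) (elem_tensor f x z)
        else elem_tensor f x z = 0"
      using f by (auto simp: elem_tensor_def E.scale_mem x hconv_def has_taylor_def)
  qed
qed

theorem hardy_is_tensor_product:
  assumes E: "hilbert_space E"
  shows "hilbert_tensor_product H2 E (H2_tensor E) elem_tensor"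
proof -
  interpret E: hilbert_space E by fact
  interpret C: hilbert_space complex_hilb by (rule hilbert_space_complex)
  interpret T: hilbert_space "hardy E" by (rule E.hilbert_space_hardy)
  have H2: "has_taylor complex_hilb f (taylor complex_hilb f)" if "f \<in> carr H2" for f
    using that by (simp add: H2_def C.hardy_carr)
  have mem: "elem_tensor f x \<in> carr (hardy E)" if "f \<in> carr H2" "x \<in> carr E" for f x
    using has_taylor_elem_tensor[OF E H2] that by (blast intro: E.hardy_memI)
  have tay: "taylor E (elem_tensor f x) = (\<lambda>n. taylor complex_hilb f n *\<^sub>C x)" if "f \<in> carr H2" "x \<in> carr E" for f x
    using has_taylor_elem_tensor[OF E H2] that by (blast intro: E.taylor_eq)
  have ip: "ip (hardy E) (elem_tensor f x) (elem_tensor g y) = ip H2 f g * ip E x y"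
    if "f \<in> carr H2" "g \<in> carr H2" "x \<in> carr E" "y \<in> carr E" for f g x y
  proof -
    have "summable (\<lambda>n. ip complex_hilb (taylor complex_hilb f n) (taylor complex_hilb g n))"
      using that by (intro C.l2_summable_ip C.taylor_l2) (auto simp: H2_def)
    from suminf_mult2[OF this, of "ip E x y"]
    have "ip H2 f g * ip E x y = (\<Sum>n. ip complex_hilb (taylor complex_hilb f n) (taylor complex_hilb g n) * ip E x y)"
      by (simp add: H2_def C.hardy_ip)
    moreover have "ip E (taylor complex_hilb f n *\<^sub>C x) (taylor complex_hilb g n *\<^sub>C y)
        = ip complex_hilb (taylor complex_hilb f n) (taylor complex_hilb g n) * ip E x y" for n
      using that by (simp add: E.ip_scale E.ip_scale_right E.scale_mem) (simp add: complex_hilb_def)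
    ultimately show ?thesis using that by (simp add: E.hardy_ip tay)
  qed
  define S where "S = {\<Sum>k<n. elem_tensor (a k) (b k) | (n::nat) a b. range a \<subseteq> carr H2 \<and> range b \<subseteq> carr E}"
  have "u \<in> hclosure (hardy E) S" if u: "u \<in> carr (hardy E)" for u
  proof -
    define a where "a = taylor E u"
    have a: "E.l2 a" unfolding a_def by (rule E.taylor_l2[OF u])
    have "\<exists>f. has_taylor complex_hilb f (\<lambda>k. if k = n then 1 else 0)" for n
      by (rule C.ex_has_taylor, rule C.l2_finite[of _ "Suc n"]) (auto simp: complex_hilb_def)
    then obtain e where e: "\<And>n. has_taylor complex_hilb (e n) (\<lambda>k. if k = n then 1 else 0)" by metis
    have eH: "e n \<in> carr H2" for n unfolding H2_def by (rule C.hardy_memI[OF e])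
    define s where "s N = (\<Sum>n<N. elem_tensor (e n) (a n))" for N
    have sm: "s N \<in> carr (hardy E)" for N
      unfolding s_def by (intro T.sum_mem mem eH E.l2_mem[OF a])
    have ts: "taylor E (s N) = (\<lambda>n. if n < N then a n else 0)" for N
    proof (induction N)
      case 0
      then show ?case using E.taylor_eq[OF E.has_taylor_zero] by (simp add: s_def zero_fun_def)
    next
      case (Suc N)
      have "taylor E (s N + elem_tensor (e N) (a N)) = (\<lambda>n. taylor E (s N) n + taylor E (elem_tensor (e N) (a N)) n)"
        by (intro E.taylor_add sm mem eH E.l2_mem[OF a])
      also have "taylor E (elem_tensor (e N) (a N)) = (\<lambda>k. (if k = N then 1 else 0) *\<^sub>C a N)"
        by (intro E.taylor_eq has_taylor_elem_tensor E e E.l2_mem[OF a])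
      finally show ?case using Suc by (auto simp: s_def fun_eq_iff scaleC_one less_Suc_eq)
    qed
    have "hconv (hardy E) s u"
    proof -
      have sum: "summable (\<lambda>n. (hnorm E (a n))\<^sup>2)" using a by (simp add: E.l2_def)
      have "hnorm (hardy E) (s N - u) = sqrt (\<Sum>n. (hnorm E (a (n + N)))\<^sup>2)" for N
      proof -
        have d: "taylor E (s N - u) = (\<lambda>n. if n < N then 0 else - a n)"
          by (auto simp: E.taylor_diff sm u ts a_def fun_eq_iff)
        have sq: "(\<lambda>n. (hnorm E (taylor E (s N - u) n))\<^sup>2) = (\<lambda>n. if n < N then 0 else (hnorm E (a n))\<^sup>2)"
          by (auto simp: d fun_eq_iff E.hnorm_zero E.hnorm_minus E.l2_mem[OF a])
        have "summable (\<lambda>n. if n < N then 0 else (hnorm E (a n))\<^sup>2)"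
          by (rule summable_comparison_test'[OF sum, of 0]) auto
        from suminf_split_initial_segment[OF this, of N]
        have "(\<Sum>n. if n < N then 0 else (hnorm E (a n))\<^sup>2) = (\<Sum>n. (hnorm E (a (n + N)))\<^sup>2)" by simp
        thus ?thesis by (simp add: E.hardy_norm E.hardy_diff sm u sq)
      qed
      moreover have "(\<lambda>N. \<Sum>n. (hnorm E (a (n + N)))\<^sup>2) \<longlonglongrightarrow> 0"
        by (rule suminf_exist_split2[OF sum])
      ultimately show ?thesis using tendsto_real_sqrt[of _ 0] by (simp add: hconv_def)
    qed
    moreover have "s N \<in> S" for N
      unfolding S_def s_def using eH E.l2_mem[OF a] by blast
    ultimately show ?thesis using u by (auto simp: hclosure_def)
  qed
  hence "hclosure (hardy E) S = carr (hardy E)" by (auto simp: hclosure_def)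
  moreover have "linear_op E (hardy E) (elem_tensor f)" if "f \<in> carr H2" for f
    using mem[OF that]
    by (simp add: linear_op_def elem_tensor_def fun_eq_iff scaleC_fun_def scaleC_add_right scaleC_scaleC mult.commute)
  ultimately show ?thesis
    unfolding hilbert_tensor_product_def S_def
    using linear_op_elem_tensor_left[OF E mem] ip T.hilbert_space_axioms by blast
qed

end

theory Submission
  imports Defs
begin

text \<open>
  Fix \<open>i\<close> and write \<open>A = V\<^sub>i\<close>, \<open>B = V\<^bsub>(i)\<^esub>\<close> and \<open>T = A B = q\<^sub>i B A\<close>, which is the product of all
  \<open>V\<^sub>j\<close> up to a unimodular factor. Expanding \<open>I - T T*\<close> in the two orders \<open>A B\<close> and \<open>B A\<close> shows
  that \<open>\<Gamma>\<^sub>1 h = D\<^bsub>A*\<^esub> h \<oplus> \<Delta>\<^sub>i D\<^bsub>B*\<^esub> A* h\<close> and \<open>\<Gamma>\<^sub>2 h = D\<^bsub>A*\<^esub> B* h \<oplus> \<Delta>\<^sub>i D\<^bsub>B*\<^esub> h\<close> both map onto \<open>F\<close> with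
  \<open>\<parallel>\<Gamma> h\<parallel>\<^sup>2 = \<parallel>h\<parallel>\<^sup>2 - \<parallel>T* h\<parallel>\<^sup>2\<close>; hence \<open>\<Gamma>\<^sub>1 h \<mapsto> \<Gamma>\<^sub>2 h\<close> is the unitary \<open>U\<^sub>i\<close>. The Wold decomposition
  of \<open>T\<close> sends \<open>h\<close> to the function with Taylor coefficients \<open>\<Gamma> (T*\<^sup>n h)\<close> together with the projection of \<open>h\<close>
  to \<open>\<Inter>\<^sub>n T\<^sup>n H\<close>, which reduces \<open>A\<close> and \<open>B\<close>. Since \<open>T* A = B*\<close>, \<open>T* B = cnj q\<^sub>i A*\<close>, and \<open>A*\<close> and \<open>B*\<close>
  commute with \<open>T*\<close> up to powers of \<open>q\<^sub>i\<close>, comparing coefficients yields the first model for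
  \<open>\<Gamma> = \<Gamma>\<^sub>1\<close> and the second one for \<open>\<Gamma> = \<Gamma>\<^sub>2\<close>.
\<close>

section \<open>Orthogonal projections and isometries\<close>

text \<open>For an isometry \<open>V\<close> the operator \<open>I - V V*\<close> is already a
  projection, hence its own square root, and its range is the kernel of \<open>V*\<close>. So the
  closures in the defect spaces add nothing, both maps \<open>\<Gamma>\<^sub>1\<close> and
  \<open>\<Gamma>\<^sub>2\<close> are exactly onto, and equality of norms alone makes the assignment
  between them well defined and unitary. The unitary onto the model depends on \<open>i\<close>
  through \<open>T\<close> and \<open>\<Gamma>\<close>. The space \<open>K_u\<close> does not: the
  products \<open>V_i V_(i)\<close> for different \<open>i\<close> differ by unimodular factors,
  which leave the ranges of all powers unchanged. The factors \<open>U_i\<close> come from a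
  crossing. The coefficients of \<open>A h\<close> under \<open>\<Gamma>\<^sub>1\<close> are
  naturally written with \<open>\<Gamma>\<^sub>2\<close>, and those of \<open>B h\<close> under
  \<open>\<Gamma>\<^sub>2\<close> with \<open>\<Gamma>\<^sub>1\<close>. Passing between the two maps
  by \<open>U_i\<close> or \<open>U_i*\<close> produces both models from the same two
  computations.\<close>

lemma hnorm_sub_hilb [simp]: "hnorm (sub_hilb H M) = hnorm H"
  by (simp add: hnorm_def sub_hilb_def fun_eq_iff)

lemma hconv_sub_hilb [simp]: "hconv (sub_hilb H M) = hconv H"
  by (simp add: hconv_def fun_eq_iff)

lemma carr_sub_hilb [simp]: "carr (sub_hilb H M) = M"
  by (simp add: sub_hilb_def)

lemma ip_sub_hilb [simp]: "ip (sub_hilb H M) = ip H"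
  by (simp add: sub_hilb_def)

lemma linear_opD:
  assumes "linear_op A B T" "x \<in> carr A"
  shows "T x \<in> carr B" "y \<in> carr A \<Longrightarrow> T (x + y) = T x + T y" "T (c *\<^sub>C x) = c *\<^sub>C T x"
  using assms by (auto simp: linear_op_def)

lemma linear_op_zero: "hilbert_space A \<Longrightarrow> linear_op A B T \<Longrightarrow> T 0 = 0"
  using linear_opD(3)[of A B T 0 0] hilbert_space.zero_mem[of A] by simp

lemma linear_op_diff:
  assumes "hilbert_space A" "linear_op A B T" "x \<in> carr A" "y \<in> carr A"
  shows "T (x - y) = T x - T y"
  using linear_opD(2)[OF assms(2,3), of "(-1) *\<^sub>C y"] linear_opD(3)[OF assms(2,4), of "-1"]
    hilbert_space.scale_mem[OF assms(1,4), of "-1"] by (simp add: scaleC_minus_one)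

lemma linear_op_sum:
  assumes "hilbert_space A" "linear_op A B T" "\<And>i. i \<in> I \<Longrightarrow> f i \<in> carr A"
  shows "T (sum f I) = (\<Sum>i\<in>I. T (f i))"
  using assms(3)
  by (induction I rule: infinite_finite_induct)
    (auto simp: linear_op_zero[OF assms(1,2)] linear_opD(2)[OF assms(2)] hilbert_space.sum_mem[OF assms(1)])

lemma linear_op_comp: "linear_op A B T \<Longrightarrow> linear_op B C S \<Longrightarrow> linear_op A C (\<lambda>x. S (T x))"
  by (simp add: linear_op_def)

lemma isometry_op_comp: "isometry_op A B T \<Longrightarrow> isometry_op B C S \<Longrightarrow> isometry_op A C (\<lambda>x. S (T x))"
  by (simp add: isometry_op_def linear_op_def)

lemma isometry_opD:
  assumes "isometry_op A B T"
  shows "linear_op A B T" "x \<in> carr A \<Longrightarrow> T x \<in> carr B" "x \<in> carr A \<Longrightarrow> hnorm B (T x) = hnorm A x"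
  using assms by (auto simp: isometry_op_def linear_op_def)

lemma unitary_opD:
  assumes "unitary_op A B T"
  shows "isometry_op A B T" "T ` carr A = carr B"
  using assms by (auto simp: unitary_op_def)

lemma isometry_op_funpow: "isometry_op A A T \<Longrightarrow> isometry_op A A (T ^^ n)"
proof (induction n)
  case 0
  show ?case by (simp add: isometry_op_def linear_op_def)
next
  case (Suc n)
  then show ?case using isometry_op_comp[of A A "T ^^ n" A T] by (simp add: comp_def)
qed

lemma isometry_op_bounded: "isometry_op A B T \<Longrightarrow> bounded_op A B T"
  unfolding isometry_op_def bounded_op_def by (auto intro!: exI[of _ 1])

section \<open>Polarisation, closed subspaces and the projection theorem\<close>

context hilbert_space
begin

lemma hnorm_add_sq:
  assumes "x \<in> carr H" "y \<in> carr H"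
  shows "(hnorm H (x + y))\<^sup>2 = (hnorm H x)\<^sup>2 + 2 * Re (ip H x y) + (hnorm H y)\<^sup>2"
proof -
  have "(hnorm H (x + y))\<^sup>2 = Re (ip H (x + y) (x + y))"
    using assms by (simp add: ip_self mem)
  also have "\<dots> = (hnorm H x)\<^sup>2 + (Re (ip H x y) + Re (ip H y x)) + (hnorm H y)\<^sup>2"
    using assms by (simp add: ip_add ip_add_right ip_self[OF assms(1)] ip_self[OF assms(2)] mem)
  finally show ?thesis using ip_sym[OF assms] by simp
qed

lemma hnorm_diff_sq:
  assumes "x \<in> carr H" "y \<in> carr H"
  shows "(hnorm H (x - y))\<^sup>2 = (hnorm H x)\<^sup>2 - 2 * Re (ip H x y) + (hnorm H y)\<^sup>2"
  using hnorm_add_sq[of x "(-1) *\<^sub>C y"] ip_scale_right[OF assms(2,1), of "-1"] hnorm_scale[OF assms(2), of "-1"] assms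
  by (simp add: scale_mem) (simp add: scaleC_minus_one)

text \<open>Multiplying the second argument by \<open>\<i>\<close> turns the imaginary part into a
  real part, so it is enough to compare real parts of inner products, which norms determine.\<close>

lemma ip_eq_Re: "x \<in> carr H \<Longrightarrow> y \<in> carr H \<Longrightarrow> ip H x y = Complex (Re (ip H x y)) (Re (ip H x (\<i> *\<^sub>C y)))"
  by (simp add: ip_scale_right complex_eq_iff)

lemma ip_zero_right: "x \<in> carr H \<Longrightarrow> ip H x 0 = 0"
  using ip_scale_right[of 0 x 0] by (simp add: zero_mem)

lemma eq_of_ip_eq:
  assumes "x \<in> carr H" "y \<in> carr H" "\<And>u. u \<in> carr H \<Longrightarrow> ip H u x = ip H u y"
  shows "x = y"
proof -
  have "ip H (x - y) (x - y) = 0" using assms by (simp add: ip_diff_right mem)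
  hence "hnorm H (x - y) = 0" by (simp add: hnorm_def)
  thus ?thesis using hnorm_eq_0[of "x - y"] assms by (simp add: mem)
qed

lemma hconv_bounded_op:
  assumes B: "hilbert_space B" and L: "bounded_op H B L"
    and X: "\<And>n. X n \<in> carr H" "l \<in> carr H" "hconv H X l"
  shows "hconv B (\<lambda>n. L (X n)) (L l)"
proof -
  obtain M where lin: "linear_op H B L" and M: "\<And>x. x \<in> carr H \<Longrightarrow> hnorm B (L x) \<le> M * hnorm H x"
    using L by (auto simp: bounded_op_def)
  show ?thesis unfolding hconv_def
  proof (rule Lim_null_comparison)
    show "(\<lambda>n. M * hnorm H (X n - l)) \<longlonglongrightarrow> 0"
      using tendsto_mult_left[OF X(3)[unfolded hconv_def], of M] by simp
    show "\<forall>\<^sub>F n in sequentially. norm (hnorm B (L (X n) - L l)) \<le> M * hnorm H (X n - l)"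
      using M[of "X n - l" for n] hilbert_space.hnorm_nonneg[OF B] linear_opD(1)[OF lin]
      by (simp add: linear_op_diff[OF hilbert_space_axioms lin, symmetric] X mem)
  qed
qed

text \<open>Supplies the uniqueness behind \<open>tensor_op\<close>, where \<open>M\<close> consists
  of the finite sums of elementary tensors.\<close>

lemma bounded_op_eq_on_hclosure:
  assumes B: "hilbert_space B" and L: "bounded_op H B L" "bounded_op H B L'"
    and M: "M \<subseteq> carr H" "\<And>x. x \<in> M \<Longrightarrow> L x = L' x" and x: "x \<in> hclosure H M"
  shows "L x = L' x"
proof -
  obtain X where X: "\<And>n. X n \<in> M" "hconv H X x" and xH: "x \<in> carr H" using x by (auto simp: hclosure_def)
  have XH: "X n \<in> carr H" for n using X M by auto
  have m: "y \<in> carr H \<Longrightarrow> L y \<in> carr B" "y \<in> carr H \<Longrightarrow> L' y \<in> carr B" for y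
    using L by (auto simp: bounded_op_def linear_op_def)
  show ?thesis
    using hconv_bounded_op[OF B L(1) XH xH X(2)] hconv_bounded_op[OF B L(2) XH xH X(2)]
    by (intro hilbert_space.hconv_unique[OF B, of "\<lambda>n. L (X n)"]) (auto simp: m XH xH M X)
qed

lemma hilbert_space_sub_hilb:
  assumes sub: "M \<subseteq> carr H" and M: "0 \<in> M" "\<And>x y. x \<in> M \<Longrightarrow> y \<in> M \<Longrightarrow> x + y \<in> M" "\<And>c x. x \<in> M \<Longrightarrow> c *\<^sub>C x \<in> M"
    and closed: "\<And>X l. (\<And>n. X n \<in> M) \<Longrightarrow> l \<in> carr H \<Longrightarrow> hconv H X l \<Longrightarrow> l \<in> M"
  shows "hilbert_space (sub_hilb H M)"
proof
  fix X :: "nat \<Rightarrow> 'a"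
  assume X: "\<And>n. X n \<in> carr (sub_hilb H M)"
    and C: "\<And>e. 0 < e \<Longrightarrow> \<exists>N. \<forall>m\<ge>N. \<forall>n\<ge>N. hnorm (sub_hilb H M) (X m - X n) < e"
  obtain l where l: "l \<in> carr H" "hconv H X l" using complete[of X] X C sub by (auto simp: subset_iff)
  with closed[of X l] X show "\<exists>l\<in>carr (sub_hilb H M). hconv (sub_hilb H M) X l" by auto
qed (auto simp: M(1) subsetD[OF sub] ip_add ip_scale ip_pos intro: M(2,3) ip_sym)

text \<open>The sum enters through its half because the midpoint of two points of a subspace stays
  in the subspace, where the minimal distance bounds it from below.\<close>

lemma parallelogram:
  assumes "x \<in> carr H" "y \<in> carr H"
  shows "(hnorm H (x - y))\<^sup>2 = 2 * (hnorm H x)\<^sup>2 + 2 * (hnorm H y)\<^sup>2 - 4 * (hnorm H ((1/2) *\<^sub>C (x + y)))\<^sup>2"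
proof -
  have "4 * (hnorm H ((1/2) *\<^sub>C (x + y)))\<^sup>2 = (hnorm H (x + y))\<^sup>2"
    using assms by (simp add: hnorm_scale mem power_divide)
  thus ?thesis using assms by (simp add: hnorm_diff_sq hnorm_add_sq)
qed

lemma nearest_point_orthogonal:
  assumes M: "hilbert_space (sub_hilb H M)" "M \<subseteq> carr H" and x: "x \<in> carr H" and m: "m \<in> M"
    and min: "\<And>u. u \<in> M \<Longrightarrow> hnorm H (x - m) \<le> hnorm H (x - u)" and u: "u \<in> M"
  shows "ip H (x - m) u = 0"
proof (cases "u = 0")
  case True
  then show ?thesis using x m M by (auto simp: ip_zero_right mem)
next
  case False
  interpret M: hilbert_space "sub_hilb H M" by fact
  have H: "m \<in> carr H" "u \<in> carr H" using M m u by auto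
  define p where "p = ip H (x - m) u"
  define N where "N = (hnorm H u)\<^sup>2"
  have N: "0 < N" using hnorm_eq_0[OF H(2)] False by (auto simp: N_def)
  \<comment> \<open>The coefficient that minimises the distance along \<open>u\<close>. It lowers
    the squared distance by \<open>\<bar>p\<bar>^2 / N\<close>, so minimality of \<open>m\<close>
    forces \<open>p = 0\<close>.\<close>
  define c where "c = p / of_real N"
  have "m + c *\<^sub>C u \<in> M" using m u M.add_mem M.scale_mem by simp
  hence "(hnorm H (x - m))\<^sup>2 \<le> (hnorm H (x - (m + c *\<^sub>C u)))\<^sup>2"
    using x H by (intro power_mono min hnorm_nonneg mem)
  also have "x - (m + c *\<^sub>C u) = (x - m) - c *\<^sub>C u" by (simp add: algebra_simps)
  also have "(hnorm H \<dots>)\<^sup>2 = (hnorm H (x - m))\<^sup>2 - 2 * Re (cnj c * p) + (cmod c)\<^sup>2 * N"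
    using H x by (subst hnorm_diff_sq) (auto simp: mem ip_scale_right hnorm_scale p_def N_def power_mult_distrib)
  also have "Re (cnj c * p) = (cmod p)\<^sup>2 / N"
    using complex_norm_square[of p] by (simp add: c_def mult.commute[of "cnj p"] del: of_real_power flip: complex_norm_square)
  also have "(cmod c)\<^sup>2 * N = (cmod p)\<^sup>2 / N"
    using N by (simp add: c_def norm_divide power_divide power2_eq_square)
  finally have "(cmod p)\<^sup>2 / N \<le> 0" by simp
  thus ?thesis using N by (simp add: p_def divide_le_0_iff)
qed

text \<open>A minimising sequence for the distance to \<open>M\<close> is Cauchy by the
  parallelogram law, and completeness of \<open>M\<close> itself puts the nearest point into
  \<open>M\<close>.\<close>

theorem ex_orthogonal_projection:
  assumes M: "hilbert_space (sub_hilb H M)" "M \<subseteq> carr H" and x: "x \<in> carr H"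
  obtains m where "m \<in> M" "\<And>u. u \<in> M \<Longrightarrow> ip H (x - m) u = 0"
proof -
  interpret M: hilbert_space "sub_hilb H M" by fact
  have MH: "u \<in> carr H" if "u \<in> M" for u using that M by auto
  define \<delta> where "\<delta> = (INF u\<in>M. (hnorm H (x - u))\<^sup>2)"
  have bdd: "bdd_below ((\<lambda>u. (hnorm H (x - u))\<^sup>2) ` M)" by (rule bdd_belowI[of _ 0]) auto
  have \<delta>: "\<delta> \<le> (hnorm H (x - u))\<^sup>2" if "u \<in> M" for u
    unfolding \<delta>_def using bdd that by (rule cINF_lower)
  have "\<exists>u\<in>M. (hnorm H (x - u))\<^sup>2 < \<delta> + 1 / real (Suc n)" for n
  proof (rule ccontr)
    assume "\<not> ?thesis"
    hence "\<delta> + 1 / real (Suc n) \<le> \<delta>"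
      unfolding \<delta>_def[symmetric] using M.zero_mem
      by (subst (2) \<delta>_def, intro cINF_greatest) (auto simp: not_less)
    thus False by (simp add: field_simps)
  qed
  then obtain m where m: "\<And>n. m n \<in> M" "\<And>n. (hnorm H (x - m n))\<^sup>2 < \<delta> + 1 / real (Suc n)" by metis
  \<comment> \<open>The midpoint has squared distance at least \<open>\<delta>\<close>, so the terms
    with \<open>\<delta>\<close> cancel and only the two errors \<open>1 / Suc n\<close> survive,
    each doubled.\<close>
  have gap: "(hnorm H (m j - m k))\<^sup>2 \<le> 2 / real (Suc j) + 2 / real (Suc k)" for j k
  proof -
    have mid: "(1/2) *\<^sub>C (m j + m k) \<in> M" using m M.add_mem M.scale_mem by simp
    have "(1/2) *\<^sub>C ((x - m k) + (x - m j)) = (1/2) *\<^sub>C ((2::complex) *\<^sub>C x - (m j + m k))"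
      using scaleC_add_left[of 1 1 x] by (simp add: scaleC_one algebra_simps)
    also have "\<dots> = x - (1/2) *\<^sub>C (m j + m k)" by (simp add: scaleC_diff_right scaleC_scaleC scaleC_one)
    finally have e: "(1/2) *\<^sub>C ((x - m k) + (x - m j)) = x - (1/2) *\<^sub>C (m j + m k)" .
    have "m j - m k = (x - m k) - (x - m j)" by simp
    hence "(hnorm H (m j - m k))\<^sup>2 = 2 * (hnorm H (x - m k))\<^sup>2 + 2 * (hnorm H (x - m j))\<^sup>2
        - 4 * (hnorm H (x - (1/2) *\<^sub>C (m j + m k)))\<^sup>2"
      using parallelogram[of "x - m k" "x - m j"] m(1) by (simp only: e) (simp add: x MH mem)
    thus ?thesis using \<delta>[OF mid] m(2)[of j] m(2)[of k] by linarith
  qed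
  have "\<exists>l\<in>carr (sub_hilb H M). hconv (sub_hilb H M) m l"
  proof (rule M.complete)
    fix e :: real assume e: "0 < e"
    \<comment> \<open>Chosen so that each of the two terms of \<open>gap\<close> is below
      \<open>e^2 / 2\<close>.\<close>
    obtain N where N: "4 / e\<^sup>2 < real N" using reals_Archimedean2 by blast
    show "\<exists>N. \<forall>j\<ge>N. \<forall>k\<ge>N. hnorm (sub_hilb H M) (m j - m k) < e"
    proof (intro exI[of _ N] allI impI)
      fix j k assume jk: "N \<le> j" "N \<le> k"
      have small: "2 / real (Suc i) < e\<^sup>2 / 2" if "N \<le> i" for i
      proof -
        have "4 / e\<^sup>2 < real (Suc i)" using N that by linarith
        thus ?thesis using e by (simp add: field_simps)
      qed
      have "(hnorm H (m j - m k))\<^sup>2 < e\<^sup>2" using gap[of j k] small[OF jk(1)] small[OF jk(2)] by linarith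
      thus "hnorm (sub_hilb H M) (m j - m k) < e" using e by (simp add: power2_less_imp_less)
    qed
  qed (simp add: m)
  then obtain l where l: "l \<in> M" "hconv H m l" by auto
  have "(\<lambda>n. hnorm H (x - m n)) \<longlonglongrightarrow> hnorm H (x - l)"
  proof (rule hconv_norm)
    have "hnorm H (x - m n - (x - l)) = hnorm H (m n - l)" for n
      using hnorm_diff_commute[of l "m n"] m l by (simp add: MH)
    thus "hconv H (\<lambda>n. x - m n) (x - l)" using l by (simp add: hconv_def)
  qed (auto simp: x MH m l mem)
  hence lim: "(\<lambda>n. (hnorm H (x - m n))\<^sup>2) \<longlonglongrightarrow> (hnorm H (x - l))\<^sup>2" by (rule tendsto_power)
  have "(\<lambda>n. \<delta> + 1 / real (Suc n)) \<longlonglongrightarrow> \<delta> + 0"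
    using LIMSEQ_inverse_real_of_nat by (intro tendsto_add tendsto_const) (simp add: inverse_eq_divide)
  from LIMSEQ_le[OF lim this] m(2) have le: "(hnorm H (x - l))\<^sup>2 \<le> \<delta>"
    by (simp add: less_imp_le)
  have "hnorm H (x - l) \<le> hnorm H (x - u)" if "u \<in> M" for u
    using power2_le_imp_le[OF order_trans[OF le \<delta>[OF that]]] that x by (simp add: hnorm_nonneg MH mem)
  with nearest_point_orthogonal[OF M x l(1)] that l(1) show ?thesis by blast
qed

end

text \<open>Isometries are defined by norms only; polarisation at \<open>x + y\<close> and
  \<open>x + \<i> y\<close> recovers the inner product.\<close>

lemma isometry_ip:
  assumes A: "hilbert_space A" and B: "hilbert_space B" and T: "isometry_op A B T" and xy: "x \<in> carr A" "y \<in> carr A"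
  shows "ip B (T x) (T y) = ip A x y"
proof -
  interpret A: hilbert_space A by fact
  interpret B: hilbert_space B by fact
  note Tm = isometry_opD[OF T]
  have re: "Re (ip B (T x) (T v)) = Re (ip A x v)" if v: "v \<in> carr A" for v
    using A.hnorm_add_sq[OF xy(1) v] B.hnorm_add_sq[OF Tm(2)[OF xy(1)] Tm(2)[OF v]] Tm(3)[of "x + v"]
    by (simp add: Tm xy v A.mem linear_opD(2)[OF Tm(1), symmetric])
  show ?thesis
    using B.ip_eq_Re[OF Tm(2)[OF xy(1)] Tm(2)[OF xy(2)]] A.ip_eq_Re[OF xy] re[OF xy(2)]
      re[OF A.scale_mem[OF xy(2)], of \<i>] by (simp add: linear_opD(3)[OF Tm(1) xy(2)])
qed

text \<open>Distances are preserved, so a convergent sequence in the range has Cauchy preimages, and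
  the image of their limit is the given limit.\<close>

lemma hilbert_space_isometry_range:
  assumes A: "hilbert_space A" and B: "hilbert_space B" and T: "isometry_op A B T"
  shows "hilbert_space (sub_hilb B (T ` carr A))"
proof -
  interpret A: hilbert_space A by fact
  interpret B: hilbert_space B by fact
  note Tm = isometry_opD[OF T]
  show ?thesis
  proof (rule B.hilbert_space_sub_hilb)
    show "0 \<in> T ` carr A" using imageI[OF A.zero_mem, of T] by (simp add: linear_op_zero[OF A Tm(1)])
    show "x + y \<in> T ` carr A" if "x \<in> T ` carr A" "y \<in> T ` carr A" for x y
      using that by (auto simp: A.add_mem linear_opD(2)[OF Tm(1), symmetric])
    show "c *\<^sub>C x \<in> T ` carr A" if "x \<in> T ` carr A" for c x
      using that by (auto simp: A.scale_mem linear_opD(3)[OF Tm(1), symmetric])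
    fix X l assume X: "\<And>n. X n \<in> T ` carr A" and l: "l \<in> carr B" "hconv B X l"
    have XB: "X n \<in> carr B" for n using X[of n] Tm(2) by auto
    have "\<forall>n. \<exists>y. y \<in> carr A \<and> X n = T y" using X by blast
    from choice[OF this] obtain x where x: "\<And>n. x n \<in> carr A" "\<And>n. X n = T (x n)" by blast
    have dist: "hnorm A (x m - x n) = hnorm B (X m - X n)" for m n
      using Tm(3)[of "x m - x n"] linear_op_diff[OF A Tm(1) x(1) x(1)] by (simp add: x A.mem)
    have "\<exists>k\<in>carr A. hconv A x k"
    proof (rule A.complete)
      fix e :: real assume "0 < e"
      then obtain N where N: "\<And>n. N \<le> n \<Longrightarrow> hnorm B (X n - l) < e / 2"
        using LIMSEQ_D[OF l(2)[unfolded hconv_def], of "e/2"] by fastforce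
      have "hnorm A (x m - x n) < e" if "N \<le> m" "N \<le> n" for m n
        using B.hnorm_triangle3[OF XB l(1) XB, of m n] B.hnorm_diff_commute[OF XB l(1), of n] N[OF that(1)] N[OF that(2)]
        by (simp add: dist)
      thus "\<exists>N. \<forall>m\<ge>N. \<forall>n\<ge>N. hnorm A (x m - x n) < e" by blast
    qed (rule x)
    then obtain k where k: "k \<in> carr A" "hconv A x k" by blast
    have "hconv B X (T k)"
      using A.hconv_bounded_op[OF B isometry_op_bounded[OF T] x(1) k] by (simp add: x(2)[symmetric])
    hence "l = T k" using B.hconv_unique[OF XB l(1) Tm(2)[OF k(1)] l(2)] by simp
    thus "l \<in> T ` carr A" using k by auto
  qed (use Tm in auto)
qed

text \<open>Subtracting from \<open>y\<close> its projection to the closed range leaves a vector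
  orthogonal to the range, so surjectivity reduces to an orthogonality test.\<close>

lemma isometry_unitaryI:
  assumes A: "hilbert_space A" and B: "hilbert_space B" and T: "isometry_op A B T"
    and orth: "\<And>y. y \<in> carr B \<Longrightarrow> (\<And>x. x \<in> carr A \<Longrightarrow> ip B y (T x) = 0) \<Longrightarrow> y = 0"
  shows "unitary_op A B T"
proof -
  interpret B: hilbert_space B by fact
  have sub: "T ` carr A \<subseteq> carr B" using isometry_opD[OF T] by auto
  moreover have "y \<in> T ` carr A" if y: "y \<in> carr B" for y
  proof (rule B.ex_orthogonal_projection[OF hilbert_space_isometry_range[OF A B T] sub y])
    fix m assume m: "m \<in> T ` carr A" and *: "\<And>u. u \<in> T ` carr A \<Longrightarrow> ip B (y - m) u = 0"
    have "y - m = 0" by (rule orth) (use y m sub * in \<open>auto intro: B.diff_mem\<close>)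
    thus ?thesis using m by simp
  qed
  ultimately show ?thesis using T by (auto simp: unitary_op_def)
qed

text \<open>The source of both \<open>\<Delta>\<close> and \<open>U\<close>. Applied to
  \<open>k - h\<close>, the equality of norms shows that \<open>S k = S h\<close> forces
  \<open>T k = T h\<close>, so the choice of a preimage does not matter.\<close>

lemma ex_unitary_of_equal_norms:
  assumes H: "hilbert_space H" and A: "hilbert_space A" and B: "hilbert_space B"
    and S: "linear_op H A S" "S ` carr H = carr A" and T: "linear_op H B T" "T ` carr H = carr B"
    and norms: "\<And>h. h \<in> carr H \<Longrightarrow> hnorm A (S h) = hnorm B (T h)"
  shows "\<exists>U. unitary_op A B U \<and> (\<forall>h\<in>carr H. U (S h) = T h)"
proof -
  interpret H: hilbert_space H by fact
  interpret A: hilbert_space A by fact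
  interpret B: hilbert_space B by fact
  define U where "U x = T (SOME h. h \<in> carr H \<and> S h = x)" for x
  have U: "U (S h) = T h" if h: "h \<in> carr H" for h
  proof -
    define k where "k = (SOME k. k \<in> carr H \<and> S k = S h)"
    have k: "k \<in> carr H" "S k = S h" using someI[of "\<lambda>k. k \<in> carr H \<and> S k = S h" h] h by (auto simp: k_def)
    have "hnorm B (T k - T h) = hnorm A (S k - S h)"
      using norms[of "k - h"] h k by (simp add: linear_op_diff[OF H S(1)] linear_op_diff[OF H T(1)] H.mem)
    hence "T k - T h = 0" using h k by (intro B.hnorm_eq_0) (auto simp: A.hnorm_zero B.mem linear_opD[OF T(1)])
    thus ?thesis by (simp add: U_def k_def)
  qed
  have ex: "\<exists>h\<in>carr H. x = S h" if "x \<in> carr A" for x using that S(2) by blast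
  have "unitary_op A B U" unfolding unitary_op_def isometry_op_def linear_op_def
  proof (intro conjI ballI allI)
    show "U ` carr A = carr B" using U by (simp add: S(2)[symmetric] T(2)[symmetric] image_image)
    fix x assume x: "x \<in> carr A"
    then obtain h where h: "h \<in> carr H" "x = S h" using ex by blast
    show "U x \<in> carr B" "hnorm B (U x) = hnorm A x" using h by (simp_all add: U norms linear_opD[OF T(1)])
    show "U (c *\<^sub>C x) = c *\<^sub>C U x" for c
      using U[of "c *\<^sub>C h"] h by (simp add: U H.mem linear_opD(3)[OF T(1)] linear_opD(3)[OF S(1)])
    fix y assume "y \<in> carr A"
    then obtain k where k: "k \<in> carr H" "y = S k" using ex by blast
    show "U (x + y) = U x + U y"
      using U[of "h + k"] h k by (simp add: U H.mem linear_opD(2)[OF T(1)] linear_opD(2)[OF S(1)])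
  qed
  thus ?thesis using U by blast
qed

section \<open>Adjoints and defect operators of isometries\<close>

lemma bounded_opI: "linear_op A B T \<Longrightarrow> (\<And>x. x \<in> carr A \<Longrightarrow> hnorm B (T x) \<le> M * hnorm A x) \<Longrightarrow> bounded_op A B T"
  by (auto simp: bounded_op_def)

lemma adj_eqI:
  assumes "hilbert_space A" "y \<in> carr B" "x \<in> carr A" "\<And>u. u \<in> carr A \<Longrightarrow> ip B (T u) y = ip A u x"
  shows "adj A B T y = x"
proof -
  have "(THE x. x \<in> carr A \<and> (\<forall>u\<in>carr A. ip B (T u) y = ip A u x)) = x"
    using assms(3,4) by (intro the_equality) (auto intro: hilbert_space.eq_of_ip_eq[OF assms(1)])
  thus ?thesis using assms(2) by (simp add: adj_def)
qed

text \<open>For an isometry the adjoint comes from the projection theorem: \<open>T* y\<close> is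
  the preimage of the projection of \<open>y\<close> to the range of \<open>T\<close>.\<close>

lemma
  assumes A: "hilbert_space A" and B: "hilbert_space B" and T: "isometry_op A B T" and y: "y \<in> carr B"
  shows adj_isometry_mem: "adj A B T y \<in> carr A"
    and adj_isometry_ip: "u \<in> carr A \<Longrightarrow> ip B (T u) y = ip A u (adj A B T y)"
proof -
  interpret A: hilbert_space A by fact
  interpret B: hilbert_space B by fact
  have sub: "T ` carr A \<subseteq> carr B" using isometry_opD[OF T] by auto
  obtain m where m: "m \<in> T ` carr A" and orth: "\<And>v. v \<in> T ` carr A \<Longrightarrow> ip B (y - m) v = 0"
    using B.ex_orthogonal_projection[OF hilbert_space_isometry_range[OF A B T] sub y] by blast
  from m obtain x where x: "x \<in> carr A" and mx: "m = T x" by blast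
  have *: "ip B (y - T x) (T u) = 0" if "u \<in> carr A" for u using orth[of "T u"] that mx by simp
  have eq: "ip B (T u) y = ip A u x" if u: "u \<in> carr A" for u
  proof -
    have "ip B (T u) (y - T x) = 0"
      using *[OF u] B.ip_sym[of "y - T x" "T u"] isometry_opD(2)[OF T] y u x by (simp add: B.mem)
    thus ?thesis using isometry_ip[OF A B T u x] isometry_opD(2)[OF T] y u x by (simp add: B.ip_diff_right)
  qed
  have "adj A B T y = x" by (rule adj_eqI[OF A y x eq])
  thus "adj A B T y \<in> carr A" "u \<in> carr A \<Longrightarrow> ip B (T u) y = ip A u (adj A B T y)" by (simp_all add: x eq)
qed

lemma adj_isometry_cancel:
  assumes "hilbert_space A" "hilbert_space B" "isometry_op A B T" "x \<in> carr A"
  shows "adj A B T (T x) = x"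
  by (rule adj_eqI) (use assms in \<open>auto simp: isometry_ip isometry_opD\<close>)

lemma unitary_adj_cancel:
  assumes "hilbert_space A" "hilbert_space B" "unitary_op A B T" "y \<in> carr B"
  shows "T (adj A B T y) = y"
proof -
  obtain x where "x \<in> carr A" "y = T x" using assms unitary_opD(2) by blast
  thus ?thesis using adj_isometry_cancel[OF assms(1,2) unitary_opD(1)[OF assms(3)]] by simp
qed

lemma linear_op_adj:
  assumes A: "hilbert_space A" and B: "hilbert_space B" and T: "isometry_op A B T"
  shows "linear_op B A (adj A B T)"
proof -
  interpret A: hilbert_space A by fact
  interpret B: hilbert_space B by fact
  note [simp] = adj_isometry_mem[OF A B T] adj_isometry_ip[OF A B T] isometry_opD(2)[OF T]
  have "adj A B T (x + y) = adj A B T x + adj A B T y" if "x \<in> carr B" "y \<in> carr B" for x y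
    by (rule adj_eqI[OF A]) (use that in \<open>auto simp: A.mem B.mem A.ip_add_right B.ip_add_right\<close>)
  moreover have "adj A B T (c *\<^sub>C x) = c *\<^sub>C adj A B T x" if "x \<in> carr B" for c x
    by (rule adj_eqI[OF A]) (use that in \<open>auto simp: A.mem B.mem A.ip_scale_right B.ip_scale_right\<close>)
  ultimately show ?thesis by (simp add: linear_op_def)
qed

lemma unitary_op_adj:
  assumes A: "hilbert_space A" and B: "hilbert_space B" and T: "unitary_op A B T"
  shows "unitary_op B A (adj A B T)"
proof -
  note c = adj_isometry_cancel[OF A B unitary_opD(1)[OF T]] unitary_adj_cancel[OF A B T]
  note m = adj_isometry_mem[OF A B unitary_opD(1)[OF T]] isometry_opD(2)[OF unitary_opD(1)[OF T]]
  have "hnorm A (adj A B T y) = hnorm B y" if "y \<in> carr B" for y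
    using isometry_opD(3)[OF unitary_opD(1)[OF T] m(1)[OF that]] by (simp add: c that)
  moreover have "adj A B T ` carr B = carr A" using c m by (auto simp: image_iff) metis
  ultimately show ?thesis
    using linear_op_adj[OF A B unitary_opD(1)[OF T]] by (simp add: unitary_op_def isometry_op_def)
qed

text \<open>In the second model the unitary is \<open>U_i*\<close>, and the adjoint occurring there
  has to be \<open>U_i\<close> again.\<close>

lemma adj_adj_unitary:
  assumes A: "hilbert_space A" and B: "hilbert_space B" and T: "unitary_op A B T" and x: "x \<in> carr A"
  shows "adj B A (adj A B T) x = T x"
  using adj_isometry_cancel[OF B A unitary_opD(1)[OF unitary_op_adj[OF A B T]], of "T x"] x
    adj_isometry_cancel[OF A B unitary_opD(1)[OF T] x] isometry_opD(2)[OF unitary_opD(1)[OF T] x]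
  by simp

section \<open>Positive square roots of projections\<close>

context hilbert_space
begin

lemma hconv_const: "x \<in> carr H \<Longrightarrow> hconv H (\<lambda>n. x) x"
  by (simp add: hconv_def hnorm_zero)

text \<open>The quadratic form is real at \<open>x + y\<close> and at \<open>x + \<i> y\<close>. The
  first fact compares the imaginary parts of the two inner products, the second their real
  parts.\<close>

lemma positive_op_symmetric:
  assumes S: "positive_op H S" and xy: "x \<in> carr H" "y \<in> carr H"
  shows "ip H (S x) y = ip H x (S y)"
proof -
  have lin: "linear_op H H S" using S by (simp add: positive_op_def bounded_op_def)
  note [simp] = linear_opD(1)[OF lin]
  have re: "ip H (S u) u \<in> \<real>" if "u \<in> carr H" for u
    using S that by (simp add: positive_op_def complex_is_Real_iff)
  have sym: "Im (ip H (S u) v) + Im (ip H (S v) u) = 0" if u: "u \<in> carr H" and v: "v \<in> carr H" for u v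
    using re[OF add_mem[OF u v]] re[OF u] re[OF v]
    by (simp add: linear_opD(2)[OF lin u v] ip_add ip_add_right u v mem complex_is_Real_iff)
  have 1: "Im (ip H (S x) y) + Im (ip H (S y) x) = 0" by (rule sym[OF xy])
  have 2: "Re (ip H (S y) x) - Re (ip H (S x) y) = 0"
    using sym[OF xy(1) scale_mem[OF xy(2), of \<i>]]
    by (simp add: linear_opD(3)[OF lin xy(2)] ip_scale ip_scale_right xy mem)
  show ?thesis using 1 2 ip_sym[of "S y" x] by (simp add: xy complex_eq_iff)
qed

text \<open>The point is uniqueness: a positive \<open>S\<close> with \<open>S S = P\<close> is
  determined separately on the kernel and on the range of \<open>P\<close>, and every vector is a
  sum of one from each.\<close>

lemma sqrt_op_projection:
  assumes P: "is_projection H P" and x: "x \<in> carr H"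
  shows "sqrt_op H P x = P x"
proof -
  have bd: "bounded_op H H P" and lin: "linear_op H H P" and idem: "\<And>x. x \<in> carr H \<Longrightarrow> P (P x) = P x"
    and sym: "\<And>x y. x \<in> carr H \<Longrightarrow> y \<in> carr H \<Longrightarrow> ip H (P x) y = ip H x (P y)"
    using P by (auto simp: is_projection_def bounded_op_def)
  note Pm [simp] = linear_opD(1)[OF lin]
  \<comment> \<open>\<open>sqrt_op\<close> selects a function that vanishes outside the carrier, so
    the candidate has to be cut off there.\<close>
  define P0 where "P0 = (\<lambda>x. if x \<in> carr H then P x else 0)"
  have "sqrt_op H P = P0" unfolding sqrt_op_def
  proof (rule the_equality)
    have pos: "ip H (P x) x = of_real ((hnorm H (P x))\<^sup>2)" if "x \<in> carr H" for x
      using sym[of "P x" x] that by (simp add: idem ip_self)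
    have "positive_op H P0"
      using bd by (auto simp: positive_op_def bounded_op_def linear_op_def P0_def mem pos)
    thus "positive_op H P0 \<and> (\<forall>x\<in>carr H. P0 (P0 x) = P x) \<and> (\<forall>x. x \<notin> carr H \<longrightarrow> P0 x = 0)"
      by (simp add: P0_def idem)
    fix S assume S: "positive_op H S \<and> (\<forall>x\<in>carr H. S (S x) = P x) \<and> (\<forall>x. x \<notin> carr H \<longrightarrow> S x = 0)"
    hence lS: "linear_op H H S" and pos: "\<And>x. x \<in> carr H \<Longrightarrow> 0 \<le> Re (ip H (S x) x)"
      and SS: "\<And>x. x \<in> carr H \<Longrightarrow> S (S x) = P x" and S0: "\<And>x. x \<notin> carr H \<Longrightarrow> S x = 0"
      by (auto simp: positive_op_def bounded_op_def)
    note Sm [simp] = linear_opD(1)[OF lS]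
    have ker: "S v = 0" if v: "v \<in> carr H" "P v = 0" for v
    proof -
      have "ip H (S v) (S v) = 0"
        using positive_op_symmetric[of S v "S v"] S v by (simp add: SS ip_zero_right)
      thus ?thesis using hnorm_eq_0[of "S v"] v by (simp add: hnorm_def)
    qed
    have fix_: "S v = v" if v: "v \<in> carr H" "P v = v" for v
    proof -
      \<comment> \<open>Since \<open>S (S v) = v\<close>, this vector satisfies
        \<open>S w = - w\<close>. Unless it is zero, it would give a positive operator the
        eigenvalue \<open>-1\<close>.\<close>
      define w where "w = S v - v"
      have w: "w \<in> carr H" using v by (simp add: w_def mem)
      have "S w = - w"
        using v by (simp add: w_def linear_op_diff[OF hilbert_space_axioms lS] SS)
      hence "Re (ip H w w) \<le> 0" using pos[OF w] w by (simp add: ip_minus)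
      hence "w = 0" using ip_pos[OF w] by fastforce
      thus ?thesis by (simp add: w_def)
    qed
    show "S = P0"
    proof
      fix v show "S v = P0 v"
      proof (cases "v \<in> carr H")
        case True
        have "S v = S (v - P v) + S (P v)"
          using True by (simp add: linear_opD(2)[OF lS, symmetric] mem)
        thus ?thesis using True
          by (simp add: P0_def ker fix_ idem mem linear_op_diff[OF hilbert_space_axioms lin])
      qed (simp add: P0_def S0)
    qed
  qed
  thus ?thesis using x by (simp add: P0_def)
qed

section \<open>One isometry, its adjoint and its defect projection\<close>

context
  fixes A :: "'a \<Rightarrow> 'a"
  assumes A: "isometry_op H H A"
begin

lemmas iso_mem = isometry_opD(2)[OF A]
lemmas iso_norm = isometry_opD(3)[OF A]
lemmas iso_add = linear_opD(2)[OF isometry_opD(1)[OF A]]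
lemmas iso_scale = linear_opD(3)[OF isometry_opD(1)[OF A]]
lemmas iso_diff = linear_op_diff[OF hilbert_space_axioms isometry_opD(1)[OF A]]
lemmas iso_zero = linear_op_zero[OF hilbert_space_axioms isometry_opD(1)[OF A]]
lemmas iso_ip = isometry_ip[OF hilbert_space_axioms hilbert_space_axioms A]
lemmas adj_mem = adj_isometry_mem[OF hilbert_space_axioms hilbert_space_axioms A]
lemmas adj_ip = adj_isometry_ip[OF hilbert_space_axioms hilbert_space_axioms A]
lemmas adj_cancel = adj_isometry_cancel[OF hilbert_space_axioms hilbert_space_axioms A]
lemmas adj_linear = linear_op_adj[OF hilbert_space_axioms hilbert_space_axioms A]
lemmas adj_add = linear_opD(2)[OF adj_linear]
lemmas adj_scale = linear_opD(3)[OF adj_linear]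
lemmas adj_diff = linear_op_diff[OF hilbert_space_axioms adj_linear]
lemmas adj_zero = linear_op_zero[OF hilbert_space_axioms adj_linear]

text \<open>Pythagoras for the projection \<open>A A*\<close>, whose value at \<open>x\<close> has
  norm \<open>\<parallel>A* x\<parallel>\<close>. The norm identities for defect families below
  telescope differences of this form.\<close>

lemma defect_norm_sq:
  assumes x: "x \<in> carr H"
  shows "(hnorm H (x - A (adj H H A x)))\<^sup>2 = (hnorm H x)\<^sup>2 - (hnorm H (adj H H A x))\<^sup>2"
proof -
  have "ip H x (A (adj H H A x)) = ip H (adj H H A x) (adj H H A x)"
    using adj_ip[OF x adj_mem[OF x]] ip_sym[of "A (adj H H A x)" x] ip_self[of "adj H H A x"]
    by (simp add: x iso_mem adj_mem)
  thus ?thesis using x by (simp add: hnorm_diff_sq iso_mem adj_mem iso_norm ip_self)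
qed

lemma adj_contractive:
  assumes "x \<in> carr H"
  shows "hnorm H (adj H H A x) \<le> hnorm H x"
proof (rule power2_le_imp_le[OF _ hnorm_nonneg[OF assms]])
  show "(hnorm H (adj H H A x))\<^sup>2 \<le> (hnorm H x)\<^sup>2"
    using defect_norm_sq[OF assms] zero_le_power2[of "hnorm H (x - A (adj H H A x))"] by linarith
qed

lemma adj_bounded: "bounded_op H H (adj H H A)"
  by (rule bounded_opI[OF adj_linear, where M = 1]) (simp add: adj_contractive)

lemma is_projection_defect: "is_projection H (\<lambda>x. x - A (adj H H A x))"
proof -
  have "hnorm H (x - A (adj H H A x)) \<le> 1 * hnorm H x" if x: "x \<in> carr H" for x
    unfolding mult_1
  proof (rule power2_le_imp_le[OF _ hnorm_nonneg[OF x]])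
    show "(hnorm H (x - A (adj H H A x)))\<^sup>2 \<le> (hnorm H x)\<^sup>2"
      using defect_norm_sq[OF x] zero_le_power2[of "hnorm H (adj H H A x)"] by linarith
  qed
  moreover have "linear_op H H (\<lambda>x. x - A (adj H H A x))"
    by (simp add: linear_op_def mem iso_mem adj_mem iso_add adj_add iso_scale adj_scale scaleC_diff_right)
  ultimately have "bounded_op H H (\<lambda>x. x - A (adj H H A x))" by (rule bounded_opI[rotated])
  moreover have "ip H (x - A (adj H H A x)) y = ip H x (y - A (adj H H A y))"
    if "x \<in> carr H" "y \<in> carr H" for x y
  proof -
    have "ip H x (A (adj H H A y)) = ip H (adj H H A x) (adj H H A y)"
      using that adj_ip[of x "adj H H A y"] ip_sym[of "A (adj H H A y)" x] ip_sym[of "adj H H A y" "adj H H A x"]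
      by (simp add: iso_mem adj_mem)
    thus ?thesis using that by (simp add: ip_diff ip_diff_right iso_mem adj_mem adj_ip)
  qed
  ultimately show ?thesis unfolding is_projection_def
    by (auto simp: mem iso_mem adj_mem adj_diff adj_cancel iso_zero)
qed

lemma defect_adj_isometry: "x \<in> carr H \<Longrightarrow> defect_adj H A x = x - A (adj H H A x)"
  unfolding defect_adj_def by (rule sqrt_op_projection[OF is_projection_defect])

lemma defect_adj_mem: "x \<in> carr H \<Longrightarrow> defect_adj H A x \<in> carr H"
  by (simp add: defect_adj_isometry mem iso_mem adj_mem)

lemma adj_defect: "x \<in> carr H \<Longrightarrow> adj H H A (defect_adj H A x) = 0"
  by (simp add: defect_adj_isometry mem iso_mem adj_mem adj_diff adj_cancel)

lemma defect_adj_id: "x \<in> carr H \<Longrightarrow> adj H H A x = 0 \<Longrightarrow> defect_adj H A x = x"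
  by (simp add: defect_adj_isometry iso_zero)

lemma defect_adj_range_zero: "x \<in> carr H \<Longrightarrow> defect_adj H A (A x) = 0"
  by (simp add: defect_adj_isometry iso_mem adj_cancel)

lemma defect_adj_hnorm_sq: "x \<in> carr H \<Longrightarrow> (hnorm H (defect_adj H A x))\<^sup>2 = (hnorm H x)\<^sup>2 - (hnorm H (adj H H A x))\<^sup>2"
  by (simp add: defect_adj_isometry defect_norm_sq)

lemma linear_op_defect_adj: "linear_op H H (defect_adj H A)"
  unfolding linear_op_def
  by (auto simp: defect_adj_isometry mem iso_mem adj_mem iso_add adj_add iso_scale adj_scale scaleC_diff_right)

lemma defect_adj_image: "defect_adj H A ` carr H = {x \<in> carr H. adj H H A x = 0}"
  using defect_adj_id by (force simp: defect_adj_mem adj_defect image_iff)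

text \<open>The range of the defect projection is the kernel of \<open>A*\<close>, which is already
  closed because \<open>A*\<close> is contractive.\<close>

lemma carr_defect_space: "carr (defect_space H A) = {x \<in> carr H. adj H H A x = 0}"
proof -
  have "adj H H A x = 0" if x: "x \<in> carr H" and X: "\<And>n. X n \<in> carr H \<and> adj H H A (X n) = 0" "hconv H X x" for X x
    using hconv_bounded_op[OF hilbert_space_axioms adj_bounded _ x X(2)] X(1)
      hconv_unique[of "\<lambda>n. 0" "adj H H A x" 0] hconv_const[OF zero_mem] by (simp add: x mem adj_mem)
  thus ?thesis unfolding defect_space_def defect_adj_image
    using hconv_const by (auto simp: hclosure_def)
qed

lemma defect_space_simps [simp]: "ip (defect_space H A) = ip H" "hnorm (defect_space H A) = hnorm H"
  by (simp_all add: defect_space_def)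

lemma hilbert_space_defect_space: "hilbert_space (defect_space H A)"
proof -
  have "hilbert_space (sub_hilb H {x \<in> carr H. adj H H A x = 0})"
  proof (rule hilbert_space_sub_hilb)
    fix X l assume X: "\<And>n. X n \<in> {x \<in> carr H. adj H H A x = 0}" and l: "l \<in> carr H" "hconv H X l"
    have "hconv H (\<lambda>n. 0) (adj H H A l)"
      using hconv_bounded_op[OF hilbert_space_axioms adj_bounded _ l] X by simp
    from hconv_unique[OF _ _ _ this hconv_const[OF zero_mem]] l
    show "l \<in> {x \<in> carr H. adj H H A x = 0}" by (simp add: mem adj_mem)
  qed (auto simp: mem adj_zero adj_add adj_scale)
  moreover have "defect_space H A = sub_hilb H {x \<in> carr H. adj H H A x = 0}"
    using carr_defect_space by (simp add: defect_space_def)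
  ultimately show ?thesis by simp
qed

end

text \<open>\<open>C\<close> is compared with the product on the carrier only, because relations
  such as q-commutativity are available just there.\<close>

lemma adj_comp:
  assumes A: "isometry_op H H A" and B: "isometry_op H H B" and C: "\<And>x. x \<in> carr H \<Longrightarrow> C x = A (B x)"
    and y: "y \<in> carr H"
  shows "adj H H C y = adj H H B (adj H H A y)"
  by (rule adj_eqI[OF hilbert_space_axioms y])
    (simp_all add: C adj_mem[OF A] adj_mem[OF B] y adj_ip[OF A] adj_ip[OF B] iso_mem[OF B])

lemma adj_scaled:
  assumes A: "isometry_op H H A" and C: "\<And>x. x \<in> carr H \<Longrightarrow> C x = c *\<^sub>C A x" and y: "y \<in> carr H"
  shows "adj H H C y = cnj c *\<^sub>C adj H H A y"
  by (rule adj_eqI[OF hilbert_space_axioms y])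
    (simp_all add: C adj_mem[OF A] y adj_ip[OF A] iso_mem[OF A] mem ip_scale ip_scale_right)

end

section \<open>Direct sums\<close>

text \<open>The remainder \<open>l - m\<close> is orthogonal to every \<open>X n\<close>, hence to
  the limit \<open>l\<close>, and also to \<open>m\<close>; so it is orthogonal to itself.\<close>

lemma (in hilbert_space) closed_of_complete:
  assumes M: "hilbert_space (sub_hilb H M)" "M \<subseteq> carr H" and X: "\<And>n. X n \<in> M" and l: "l \<in> carr H" "hconv H X l"
  shows "l \<in> M"
proof -
  obtain m where m: "m \<in> M" and orth: "\<And>u. u \<in> M \<Longrightarrow> ip H (l - m) u = 0"
    using ex_orthogonal_projection[OF M l(1)] by blast
  have H: "m \<in> carr H" "X n \<in> carr H" for n using m X M(2) by auto
  have z: "ip H u (l - m) = 0" if "u \<in> M" for u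
    using orth[OF that] ip_sym[of "l - m" u] l that M(2) H by (auto simp: mem)
  have "(\<lambda>n. ip H (X n) (l - m)) \<longlonglongrightarrow> ip H l (l - m)"
    by (rule hconv_ip) (auto simp: H l mem)
  hence "(\<lambda>n. 0) \<longlonglongrightarrow> ip H l (l - m)" by (simp add: z X)
  hence "ip H l (l - m) = 0" using LIMSEQ_unique[OF tendsto_const] by metis
  hence "ip H (l - m) (l - m) = 0" using z[OF m] by (simp add: ip_diff H l mem)
  hence "l - m = 0" by (intro hnorm_eq_0) (auto simp: hnorm_def H l mem)
  thus ?thesis using m by simp
qed

lemma (in hilbert_space) hnorm_sq: "x \<in> carr H \<Longrightarrow> (hnorm H x)\<^sup>2 = Re (ip H x x)"
  by (simp add: ip_self)

lemma hilbert_space_oplus: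
  assumes A: "hilbert_space A" and B: "hilbert_space B"
  shows "hilbert_space (oplus A B)"
    and hnorm_oplus: "\<And>x. x \<in> carr (oplus A B) \<Longrightarrow> (hnorm (oplus A B) x)\<^sup>2 = (hnorm A (fst x))\<^sup>2 + (hnorm B (snd x))\<^sup>2"
proof -
  interpret A: hilbert_space A by fact
  interpret B: hilbert_space B by fact
  have c: "x \<in> carr (oplus A B) \<longleftrightarrow> fst x \<in> carr A \<and> snd x \<in> carr B" for x
    by (auto simp: oplus_def mem_Times_iff)
  have i: "ip (oplus A B) x y = ip A (fst x) (fst y) + ip B (snd x) (snd y)" for x y
    by (simp add: oplus_def)
  have sq: "Re (ip (oplus A B) x x) = (hnorm A (fst x))\<^sup>2 + (hnorm B (snd x))\<^sup>2" if "x \<in> carr (oplus A B)" for x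
    using that by (simp add: c i A.hnorm_sq B.hnorm_sq)
  show n: "(hnorm (oplus A B) x)\<^sup>2 = (hnorm A (fst x))\<^sup>2 + (hnorm B (snd x))\<^sup>2" if "x \<in> carr (oplus A B)" for x
    using sq[OF that] by (simp add: hnorm_def[of "oplus A B"])
  show "hilbert_space (oplus A B)"
  proof
    show "0 < Re (ip (oplus A B) x x)" if "x \<in> carr (oplus A B)" "x \<noteq> 0" for x
      using that A.ip_pos[of "fst x"] B.ip_pos[of "snd x"] zero_le_power2[of "hnorm A (fst x)"] zero_le_power2[of "hnorm B (snd x)"]
      by (cases "fst x = 0") (auto simp: sq A.hnorm_sq B.hnorm_sq c prod_eq_iff intro: add_pos_nonneg add_nonneg_pos)
    fix X :: "nat \<Rightarrow> 'a \<times> 'b" assume X: "\<And>n. X n \<in> carr (oplus A B)"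
      and C: "\<And>e. 0 < e \<Longrightarrow> \<exists>N. \<forall>m\<ge>N. \<forall>n\<ge>N. hnorm (oplus A B) (X m - X n) < e"
    have dif: "x - y \<in> carr (oplus A B)" if "x \<in> carr (oplus A B)" "y \<in> carr (oplus A B)" for x y
      using that by (auto simp: c A.mem B.mem)
    have nn: "0 \<le> hnorm (oplus A B) x" if "x \<in> carr (oplus A B)" for x
      using sq[OF that] by (simp add: hnorm_def[of "oplus A B"])
    have le: "hnorm A (fst x) \<le> hnorm (oplus A B) x" "hnorm B (snd x) \<le> hnorm (oplus A B) x" if "x \<in> carr (oplus A B)" for x
      using n[OF that] nn[OF that] by (auto intro: power2_le_imp_le)
    have "\<exists>l\<in>carr A. hconv A (\<lambda>n. fst (X n)) l"
    proof (rule A.complete)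
      fix e :: real assume "0 < e"
      from C[OF this] show "\<exists>N. \<forall>m\<ge>N. \<forall>n\<ge>N. hnorm A (fst (X m) - fst (X n)) < e"
        using le(1)[OF dif[OF X X]] by (metis fst_diff le_less_trans)
    qed (use X c in blast)
    then obtain l where l: "l \<in> carr A" "hconv A (\<lambda>n. fst (X n)) l" by blast
    have "\<exists>l\<in>carr B. hconv B (\<lambda>n. snd (X n)) l"
    proof (rule B.complete)
      fix e :: real assume "0 < e"
      from C[OF this] show "\<exists>N. \<forall>m\<ge>N. \<forall>n\<ge>N. hnorm B (snd (X m) - snd (X n)) < e"
        using le(2)[OF dif[OF X X]] by (metis snd_diff le_less_trans)
    qed (use X c in blast)
    then obtain k where k: "k \<in> carr B" "hconv B (\<lambda>n. snd (X n)) k" by blast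
    have lk: "(l, k) \<in> carr (oplus A B)" using l k by (simp add: c)
    have "(\<lambda>n. sqrt ((hnorm A (fst (X n) - l))\<^sup>2 + (hnorm B (snd (X n) - k))\<^sup>2)) \<longlonglongrightarrow> sqrt (0\<^sup>2 + 0\<^sup>2)"
      using l(2) k(2) unfolding hconv_def by (intro tendsto_intros)
    moreover have "hnorm (oplus A B) (X n - (l, k)) = sqrt ((hnorm A (fst (X n) - l))\<^sup>2 + (hnorm B (snd (X n) - k))\<^sup>2)" for n
      using n[OF dif[OF X[of n] lk]] nn[OF dif[OF X[of n] lk]] by (simp add: real_sqrt_unique)
    ultimately have "hconv (oplus A B) X (l, k)" by (simp add: hconv_def)
    thus "\<exists>l\<in>carr (oplus A B). hconv (oplus A B) X l" using lk by blast
  qed (auto simp: c i A.mem B.mem A.ip_add B.ip_add A.ip_scale B.ip_scale scaleC_prod_def algebra_simps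
      intro: A.ip_sym B.ip_sym arg_cong2[where f = "(+)"])
qed

lemma hilbert_space_dsum:
  assumes I: "finite I" and E: "\<And>j. j \<in> I \<Longrightarrow> hilbert_space (E j)"
  shows "hilbert_space (dsum I E)"
    and hnorm_dsum: "\<And>x. x \<in> carr (dsum I E) \<Longrightarrow> (hnorm (dsum I E) x)\<^sup>2 = (\<Sum>j\<in>I. (hnorm (E j) (x j))\<^sup>2)"
proof -
  note E' = hilbert_space.mem[OF E] hilbert_space.ip_add[OF E] hilbert_space.ip_scale[OF E]
  have c: "x \<in> carr (dsum I E) \<longleftrightarrow> (\<forall>j\<in>I. x j \<in> carr (E j)) \<and> (\<forall>j. j \<notin> I \<longrightarrow> x j = 0)" for x
    by (simp add: dsum_def)
  have i: "ip (dsum I E) x y = (\<Sum>j\<in>I. ip (E j) (x j) (y j))" for x y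
    by (simp add: dsum_def)
  have sq: "Re (ip (dsum I E) x x) = (\<Sum>j\<in>I. (hnorm (E j) (x j))\<^sup>2)" if "x \<in> carr (dsum I E)" for x
    using that by (simp add: c i hilbert_space.hnorm_sq[OF E])
  show n: "(hnorm (dsum I E) x)\<^sup>2 = (\<Sum>j\<in>I. (hnorm (E j) (x j))\<^sup>2)" if "x \<in> carr (dsum I E)" for x
    using sq[OF that] by (simp add: hnorm_def[of "dsum I E"] sum_nonneg)
  have nn: "0 \<le> hnorm (dsum I E) x" if "x \<in> carr (dsum I E)" for x
    using sq[OF that] by (simp add: hnorm_def[of "dsum I E"] sum_nonneg)
  have le: "hnorm (E j) (x j) \<le> hnorm (dsum I E) x" if "x \<in> carr (dsum I E)" "j \<in> I" for x j
    by (rule power2_le_imp_le[OF _ nn[OF that(1)]], subst n[OF that(1)], rule member_le_sum) (auto simp: I that)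
  have dif: "x - y \<in> carr (dsum I E)" if "x \<in> carr (dsum I E)" "y \<in> carr (dsum I E)" for x y
    using that by (auto simp: c E')
  show "hilbert_space (dsum I E)"
  proof
    show "0 < Re (ip (dsum I E) x x)" if x: "x \<in> carr (dsum I E)" "x \<noteq> 0" for x
    proof -
      obtain j where j: "x j \<noteq> 0" "j \<in> I" using x by (auto simp: c fun_eq_iff)
      hence "0 < (hnorm (E j) (x j))\<^sup>2"
        using hilbert_space.ip_pos[OF E, of j "x j"] x by (simp add: hilbert_space.hnorm_sq[OF E] c)
      thus ?thesis unfolding sq[OF x(1)] using I j(2) by (intro sum_pos2) auto
    qed
    show "ip (dsum I E) y x = cnj (ip (dsum I E) x y)" if "x \<in> carr (dsum I E)" "y \<in> carr (dsum I E)" for x y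
      using that unfolding i cnj_sum by (intro sum.cong) (auto simp: c intro: hilbert_space.ip_sym[OF E])
    fix X :: "nat \<Rightarrow> nat \<Rightarrow> 'a" assume X: "\<And>n. X n \<in> carr (dsum I E)"
      and C: "\<And>e. 0 < e \<Longrightarrow> \<exists>N. \<forall>m\<ge>N. \<forall>n\<ge>N. hnorm (dsum I E) (X m - X n) < e"
    have "\<exists>l\<in>carr (E j). hconv (E j) (\<lambda>n. X n j) l" if j: "j \<in> I" for j
    proof (rule hilbert_space.complete[OF E[OF j]])
      fix e :: real assume "0 < e"
      from C[OF this] show "\<exists>N. \<forall>m\<ge>N. \<forall>n\<ge>N. hnorm (E j) (X m j - X n j) < e"
        using le[OF dif[OF X X] j] by (metis minus_apply le_less_trans)
    qed (use X c j in blast)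
    then obtain l where l: "\<And>j. j \<in> I \<Longrightarrow> l j \<in> carr (E j)" "\<And>j. j \<in> I \<Longrightarrow> hconv (E j) (\<lambda>n. X n j) (l j)" by metis
    define k where "k j = (if j \<in> I then l j else 0)" for j
    have k: "k \<in> carr (dsum I E)" by (simp add: c k_def l)
    have "(\<lambda>n. sqrt (\<Sum>j\<in>I. (hnorm (E j) (X n j - k j))\<^sup>2)) \<longlonglongrightarrow> sqrt (\<Sum>j\<in>I. 0\<^sup>2)"
      using l(2) unfolding hconv_def by (intro tendsto_intros) (simp add: k_def)
    moreover have "hnorm (dsum I E) (X n - k) = sqrt (\<Sum>j\<in>I. (hnorm (E j) (X n j - k j))\<^sup>2)" for n
      using n[OF dif[OF X[of n] k]] nn[OF dif[OF X[of n] k]] by (simp add: real_sqrt_unique)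
    ultimately have "hconv (dsum I E) X k" by (simp add: hconv_def)
    thus "\<exists>l\<in>carr (dsum I E). hconv (dsum I E) X l" using k by blast
  qed (auto simp: c i E' sum.distrib sum_distrib_left scaleC_fun_def)
qed

section \<open>The Wold decomposition\<close>

context hilbert_space
begin

context
  fixes T :: "'a \<Rightarrow> 'a"
  assumes T: "isometry_op H H T"
begin

lemma funpow_mem: "x \<in> carr H \<Longrightarrow> (T ^^ n) x \<in> carr H"
  by (rule isometry_opD(2)[OF isometry_op_funpow[OF T]])

lemma adj_funpow: "y \<in> carr H \<Longrightarrow> (adj H H T ^^ n) y = adj H H (T ^^ n) y"
proof (induction n arbitrary: y)
  case 0
  show ?case using 0 adj_eqI[OF hilbert_space_axioms 0 0, of "\<lambda>x. x"] by (simp add: id_def)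
next
  case (Suc n)
  have "adj H H (T ^^ Suc n) y = adj H H (T ^^ n) (adj H H T y)"
    by (rule adj_comp[OF T isometry_op_funpow[OF T] _ Suc.prems]) simp
  moreover have "(adj H H T ^^ Suc n) y = (adj H H T ^^ n) (adj H H T y)" by (simp add: funpow_swap1)
  ultimately show ?case using Suc by (simp only: adj_mem[OF T])
qed

lemma adj_funpow_mem: "y \<in> carr H \<Longrightarrow> (adj H H T ^^ n) y \<in> carr H"
  by (simp add: adj_funpow adj_mem[OF isometry_op_funpow[OF T]])

lemma adj_funpow_cancel: "x \<in> carr H \<Longrightarrow> (adj H H T ^^ n) ((T ^^ n) x) = x"
  by (simp add: adj_funpow funpow_mem adj_cancel[OF isometry_op_funpow[OF T]])

lemma linear_op_adj_funpow: "linear_op H H (adj H H T ^^ n)"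
  using adj_linear[OF isometry_op_funpow[OF T], of n] by (simp add: linear_op_def adj_funpow mem)

text \<open>The unitary part of the Wold decomposition. For the product of all \<open>V j\<close> it
  is the carrier of \<open>Ku_explicit\<close>.\<close>

definition wold_core :: "'a set"
  where "wold_core = (\<Inter>n. (T ^^ n) ` carr H)"

lemma wold_core_subset: "wold_core \<subseteq> carr H"
  unfolding wold_core_def by (rule INF_lower2[of 0]) auto

lemma wold_coreE:
  assumes "u \<in> wold_core"
  obtains v where "v \<in> carr H" "u = (T ^^ n) v"
  using assms unfolding wold_core_def by blast

lemma hilbert_space_wold_core: "hilbert_space (sub_hilb H wold_core)"
proof (rule hilbert_space_sub_hilb[OF wold_core_subset])
  have R: "hilbert_space (sub_hilb H ((T ^^ n) ` carr H))" for n
    by (rule hilbert_space_isometry_range[OF hilbert_space_axioms hilbert_space_axioms isometry_op_funpow[OF T]])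
  show "0 \<in> wold_core" "\<And>x y. x \<in> wold_core \<Longrightarrow> y \<in> wold_core \<Longrightarrow> x + y \<in> wold_core"
    "\<And>c x. x \<in> wold_core \<Longrightarrow> c *\<^sub>C x \<in> wold_core"
    using hilbert_space.mem(1-3)[OF R] unfolding wold_core_def by simp_all
  show "l \<in> wold_core" if X: "\<And>n. X n \<in> wold_core" and l: "l \<in> carr H" "hconv H X l" for X l
  proof -
    have "l \<in> (T ^^ n) ` carr H" for n
      by (rule closed_of_complete[OF R _ _ l]) (use X in \<open>auto simp: wold_core_def funpow_mem\<close>)
    thus ?thesis by (simp add: wold_core_def)
  qed
qed

lemma wold_core_projection_unique:
  assumes h: "h \<in> carr H" and p: "p \<in> wold_core" "\<And>u. u \<in> wold_core \<Longrightarrow> ip H (h - p) u = 0"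
    and p': "p' \<in> wold_core" "\<And>u. u \<in> wold_core \<Longrightarrow> ip H (h - p') u = 0"
  shows "p = p'"
proof -
  have H: "p \<in> carr H" "p' \<in> carr H" using p p' wold_core_subset by auto
  have d: "p - p' \<in> wold_core" using hilbert_space.diff_mem[OF hilbert_space_wold_core] p p' by simp
  have "ip H (p - p') (p - p') = ip H ((h - p') - (h - p)) (p - p')" by simp
  also have "\<dots> = ip H (h - p') (p - p') - ip H (h - p) (p - p')"
    using H h by (intro ip_diff) (auto simp: mem)
  also have "\<dots> = 0" using p p' d by simp
  finally have "p - p' = 0" using H by (intro hnorm_eq_0) (auto simp: hnorm_def mem)
  thus ?thesis by simp
qed

text \<open>The vectors \<open>T^n T*^n h\<close> are the projections of \<open>h\<close> to the
  decreasing ranges of \<open>T^n\<close>, and they converge to the projection to the intersection.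
  The norm of the limit is recorded because it is the end term of the telescoping sum in the Wold
  decomposition.\<close>

lemma wold_core_projection_limit:
  assumes h: "h \<in> carr H"
  obtains p where "p \<in> wold_core" "\<And>u. u \<in> wold_core \<Longrightarrow> ip H (h - p) u = 0"
    "(\<lambda>n. (hnorm H ((adj H H T ^^ n) h))\<^sup>2) \<longlonglongrightarrow> (hnorm H p)\<^sup>2"
proof -
  define S where "S n = (adj H H T ^^ n)" for n
  define e where "e n = (T ^^ n) (S n h)" for n
  define a where "a n = (hnorm H (S n h))\<^sup>2" for n
  have Sm: "S n x \<in> carr H" if "x \<in> carr H" for n x using that by (simp add: S_def adj_funpow_mem)
  have em: "e n \<in> carr H" for n by (simp add: e_def Sm funpow_mem h)
  \<comment> \<open>\<open>T^m\<close> factors out of the difference and leaves the defect of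
    \<open>T^k\<close> at \<open>T*^m h\<close>. Distances between the \<open>e n\<close> are thus
    controlled by the decreasing sequence \<open>a\<close>.\<close>
  have gap: "(hnorm H (e m - e (m + k)))\<^sup>2 = a m - a (m + k)" for m k
  proof -
    let ?g = "S m h"
    have Sk: "S (m + k) h = S k ?g" by (simp add: S_def add.commute[of m] funpow_add)
    have "e m - e (m + k) = (T ^^ m) (?g - (T ^^ k) (S k ?g))"
      by (simp add: e_def Sk funpow_add iso_diff[OF isometry_op_funpow[OF T]] Sm h funpow_mem)
    hence "(hnorm H (e m - e (m + k)))\<^sup>2 = (hnorm H (?g - (T ^^ k) (S k ?g)))\<^sup>2"
      by (simp add: iso_norm[OF isometry_op_funpow[OF T]] Sm h funpow_mem mem)
    also have "\<dots> = a m - a (m + k)"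
      using defect_norm_sq[OF isometry_op_funpow[OF T, of k] Sm[OF h, of m]]
      by (simp only: a_def Sk) (simp add: S_def adj_funpow adj_mem[OF isometry_op_funpow[OF T]] h)
    finally show ?thesis .
  qed
  have "decseq a"
  proof (rule decseq_SucI)
    show "a (Suc n) \<le> a n" for n using gap[of n 1] zero_le_power2[of "hnorm H (e n - e (n + 1))"] by simp
  qed
  then obtain L where "a \<longlonglongrightarrow> L" by (rule decseq_convergent[where B = 0]) (auto simp: a_def)
  hence "Cauchy a" by (rule LIMSEQ_imp_Cauchy)
  have "\<exists>l\<in>carr H. hconv H e l"
  proof (rule complete)
    fix r :: real assume r: "0 < r"
    obtain N where N: "\<And>m n. N \<le> m \<Longrightarrow> N \<le> n \<Longrightarrow> norm (a m - a n) < r\<^sup>2"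
      using CauchyD[OF \<open>Cauchy a\<close>, of "r\<^sup>2"] r by auto
    have 1: "hnorm H (e m - e n) < r" if "N \<le> m" "m \<le> n" for m n
    proof (rule power2_less_imp_less)
      show "(hnorm H (e m - e n))\<^sup>2 < r\<^sup>2"
        using gap[of m "n - m"] N[of m n] that by simp
    qed (use r in simp)
    show "\<exists>N. \<forall>m\<ge>N. \<forall>n\<ge>N. hnorm H (e m - e n) < r"
    proof (intro exI[of _ N] allI impI)
      fix m n assume "N \<le> m" "N \<le> n"
      thus "hnorm H (e m - e n) < r"
        using 1[of m n] 1[of n m] hnorm_diff_commute[OF em em, of m n] by (cases "m \<le> n") auto
    qed
  qed (rule em)
  then obtain p where p: "p \<in> carr H" "hconv H e p" by blast
  have "p \<in> (T ^^ m) ` carr H" for m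
  proof (rule closed_of_complete[OF hilbert_space_isometry_range[OF hilbert_space_axioms hilbert_space_axioms isometry_op_funpow[OF T]]])
    \<comment> \<open>From index \<open>m\<close> on, all terms lie in the closed range of
      \<open>T^m\<close>.\<close>
    have "e (n + m) = (T ^^ m) ((T ^^ n) (S (n + m) h))" for n
      by (simp add: e_def add.commute[of n] funpow_add)
    thus "e (n + m) \<in> (T ^^ m) ` carr H" for n by (simp add: funpow_mem Sm h)
    show "hconv H (\<lambda>n. e (n + m)) p"
      using LIMSEQ_ignore_initial_segment[OF p(2)[unfolded hconv_def], of m] by (simp add: hconv_def)
  qed (auto simp: funpow_mem p)
  hence pK: "p \<in> wold_core" by (simp add: wold_core_def)
  moreover have "ip H (h - p) u = 0" if u: "u \<in> wold_core" for u
  proof -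
    have uH: "u \<in> carr H" using u wold_core_subset by auto
    have "ip H (e n) u = ip H h u" for n
    proof -
      obtain v where v: "v \<in> carr H" "u = (T ^^ n) v" using u by (rule wold_coreE)
      have "ip H v (S n h) = ip H u h"
        using adj_ip[OF isometry_op_funpow[OF T] h v(1), of n] by (simp add: v(2) S_def adj_funpow h)
      thus ?thesis using ip_sym[of v "S n h"] ip_sym[of u h] uH v
        by (simp add: e_def iso_ip[OF isometry_op_funpow[OF T]] Sm h)
    qed
    hence "(\<lambda>n. ip H h u) \<longlonglongrightarrow> ip H p u" using hconv_ip[OF em p(1) uH p(2)] by simp
    hence "ip H h u = ip H p u" by (rule LIMSEQ_unique[OF tendsto_const])
    thus ?thesis by (simp add: ip_diff h p uH)
  qed
  moreover have "(\<lambda>n. (hnorm H (S n h))\<^sup>2) \<longlonglongrightarrow> (hnorm H p)\<^sup>2"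
    using tendsto_power[OF hconv_norm[OF em p], of 2]
    by (simp add: e_def iso_norm[OF isometry_op_funpow[OF T]] Sm h)
  ultimately show ?thesis using that by (simp add: S_def)
qed

lemma linear_op_wold_core_projection:
  assumes p: "\<And>h. h \<in> carr H \<Longrightarrow> p h \<in> wold_core"
    and orth: "\<And>h u. h \<in> carr H \<Longrightarrow> u \<in> wold_core \<Longrightarrow> ip H (h - p h) u = 0"
  shows "linear_op H (sub_hilb H wold_core) p"
proof -
  note K = hilbert_space.mem[OF hilbert_space_wold_core, unfolded carr_sub_hilb]
  have pH: "p h \<in> carr H" if "h \<in> carr H" for h using p[OF that] wold_core_subset by auto
  have "p (x + y) = p x + p y" if xy: "x \<in> carr H" "y \<in> carr H" for x y
  proof (rule wold_core_projection_unique[of "x + y"])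
    fix u assume u: "u \<in> wold_core"
    show "ip H (x + y - (p x + p y)) u = 0"
      unfolding add_diff_add using u wold_core_subset xy by (auto simp: ip_add mem pH orth subset_iff)
  qed (use xy in \<open>auto simp: p orth K mem\<close>)
  moreover have "p (c *\<^sub>C x) = c *\<^sub>C p x" if x: "x \<in> carr H" for x c
  proof (rule wold_core_projection_unique[of "c *\<^sub>C x"])
    fix u assume u: "u \<in> wold_core"
    show "ip H (c *\<^sub>C x - c *\<^sub>C p x) u = 0"
      using u wold_core_subset x by (auto simp: scaleC_diff_right[symmetric] ip_scale mem pH orth subset_iff)
  qed (use x in \<open>auto simp: p orth K mem\<close>)
  ultimately show ?thesis by (simp add: linear_op_def p)
qed

text \<open>Besides unitarity this records the Taylor coefficients and the orthogonality that
  characterises the second component, since intertwining relations are checked on exactly these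
  data.\<close>

definition wold_model :: "'f::complex_vector hilb \<Rightarrow> ('a \<Rightarrow> 'f) \<Rightarrow> ('a \<Rightarrow> (complex \<Rightarrow> 'f) \<times> 'a) \<Rightarrow> bool"
  where "wold_model F \<Gamma> \<Phi> \<longleftrightarrow> unitary_op H (oplus (hardy F) (sub_hilb H wold_core)) \<Phi> \<and>
    (\<forall>h\<in>carr H. has_taylor F (fst (\<Phi> h)) (\<lambda>n. \<Gamma> ((adj H H T ^^ n) h)) \<and>
      snd (\<Phi> h) \<in> wold_core \<and> (\<forall>u\<in>wold_core. ip H (h - snd (\<Phi> h)) u = 0))"

text \<open>The norm hypothesis says that \<open>\<Gamma>\<close> identifies \<open>F\<close> with
  the wandering space, the kernel of \<open>T*\<close>. Leaving \<open>\<Gamma>\<close> abstract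
  lets the same decomposition serve \<open>\<Gamma>\<^sub>1\<close> and
  \<open>\<Gamma>\<^sub>2\<close>.\<close>

theorem wold_decomposition:
  fixes F :: "'f::complex_vector hilb"
  assumes F: "hilbert_space F" and \<Gamma>: "linear_op H F \<Gamma>" "\<Gamma> ` carr H = carr F"
    and norm: "\<And>h. h \<in> carr H \<Longrightarrow> (hnorm F (\<Gamma> h))\<^sup>2 = (hnorm H h)\<^sup>2 - (hnorm H (adj H H T h))\<^sup>2"
  shows "\<exists>\<Phi>. wold_model F \<Gamma> \<Phi>"
proof -
  interpret F: hilbert_space F by fact
  interpret HF: hilbert_space "hardy F" by (rule F.hilbert_space_hardy)
  interpret K: hilbert_space "sub_hilb H wold_core" by (rule hilbert_space_wold_core)
  let ?K = "oplus (hardy F) (sub_hilb H wold_core)"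
  interpret O: hilbert_space ?K by (rule hilbert_space_oplus[OF HF.hilbert_space_axioms K.hilbert_space_axioms])
  define S where "S n = (adj H H T ^^ n)" for n
  have Sm: "S n x \<in> carr H" if "x \<in> carr H" for n x using that by (simp add: S_def adj_funpow_mem)
  have lin: "linear_op H F (\<lambda>h. \<Gamma> (S n h))" for n
    using linear_op_comp[OF linear_op_adj_funpow \<Gamma>(1)] by (simp add: S_def)
  \<comment> \<open>At \<open>T x\<close> the norm hypothesis reads
    \<open>\<parallel>T x\<parallel>^2 - \<parallel>x\<parallel>^2 = 0\<close>.\<close>
  have kill: "\<Gamma> (T x) = 0" if "x \<in> carr H" for x
    using norm[of "T x"] F.hnorm_eq_0[of "\<Gamma> (T x)"] that linear_opD(1)[OF \<Gamma>(1)]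
    by (simp add: iso_mem[OF T] iso_norm[OF T] adj_cancel[OF T])
  have "\<exists>p. p \<in> wold_core \<and> (\<forall>u\<in>wold_core. ip H (h - p) u = 0) \<and> (\<lambda>n. (hnorm H (S n h))\<^sup>2) \<longlonglongrightarrow> (hnorm H p)\<^sup>2"
    if h: "h \<in> carr H" for h
    by (rule wold_core_projection_limit[OF h]) (auto simp: S_def)
  then obtain p where p: "\<And>h. h \<in> carr H \<Longrightarrow> p h \<in> wold_core"
    and orth: "\<And>h u. h \<in> carr H \<Longrightarrow> u \<in> wold_core \<Longrightarrow> ip H (h - p h) u = 0"
    and lim: "\<And>h. h \<in> carr H \<Longrightarrow> (\<lambda>n. (hnorm H (S n h))\<^sup>2) \<longlonglongrightarrow> (hnorm H (p h))\<^sup>2"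
    by metis
  have pH: "p h \<in> carr H" if "h \<in> carr H" for h using p[OF that] wold_core_subset by auto
  \<comment> \<open>The sum telescopes, and what the coefficients miss of
    \<open>\<parallel>h\<parallel>^2\<close> is exactly the part of \<open>h\<close> in the core;
    hence \<open>\<Phi>\<close> is isometric.\<close>
  have sums: "(\<lambda>n. (hnorm F (\<Gamma> (S n h)))\<^sup>2) sums ((hnorm H h)\<^sup>2 - (hnorm H (p h))\<^sup>2)" if h: "h \<in> carr H" for h
  proof -
    have "(hnorm F (\<Gamma> (S n h)))\<^sup>2 = (hnorm H (S n h))\<^sup>2 - (hnorm H (S (Suc n) h))\<^sup>2" for n
      using norm[OF Sm[OF h]] by (simp add: S_def)
    hence "(\<lambda>n. (hnorm F (\<Gamma> (S n h)))\<^sup>2) sums ((hnorm H (S 0 h))\<^sup>2 - (hnorm H (p h))\<^sup>2)"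
      using telescope_sums'[OF lim[OF h]] by simp
    thus ?thesis by (simp add: S_def)
  qed
  have "F.l2 (\<lambda>n. \<Gamma> (S n h))" if "h \<in> carr H" for h
    using sums[OF that] linear_opD(1)[OF lin that] by (auto simp: F.l2_def sums_iff)
  hence "\<forall>h. \<exists>f. h \<in> carr H \<longrightarrow> has_taylor F f (\<lambda>n. \<Gamma> (S n h))" using F.ex_has_taylor by blast
  then obtain f where f: "\<And>h. h \<in> carr H \<Longrightarrow> has_taylor F (f h) (\<lambda>n. \<Gamma> (S n h))" by metis
  have tf: "taylor F (f h) = (\<lambda>n. \<Gamma> (S n h))" and fm: "f h \<in> carr (hardy F)" if "h \<in> carr H" for h
    using f[OF that] by (auto intro: F.taylor_eq F.hardy_memI)
  define \<Phi> where "\<Phi> h = (f h, p h)" for h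
  have cO: "x \<in> carr ?K \<longleftrightarrow> fst x \<in> carr (hardy F) \<and> snd x \<in> wold_core" for x
    by (auto simp: oplus_def mem_Times_iff)
  have "linear_op H (hardy F) f"
  proof -
    have "f (x + y) = f x + f y" if "x \<in> carr H" "y \<in> carr H" for x y
      using f[of "x + y"] F.has_taylor_add[OF f[OF that(1)] f[OF that(2)]] that
      by (intro F.has_taylor_unique_fun) (auto simp: mem linear_opD(2)[OF lin])
    moreover have "f (c *\<^sub>C x) = c *\<^sub>C f x" if "x \<in> carr H" for c x
      using f[of "c *\<^sub>C x"] F.has_taylor_scale[OF f[OF that]] that
      by (intro F.has_taylor_unique_fun) (auto simp: mem linear_opD(3)[OF lin])
    ultimately show ?thesis by (simp add: linear_op_def fm)
  qed
  hence "linear_op H ?K \<Phi>"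
    using linear_op_wold_core_projection[OF p orth]
    by (simp add: linear_op_def cO \<Phi>_def scaleC_prod_def)
  moreover have "hnorm ?K (\<Phi> h) = hnorm H h" if h: "h \<in> carr H" for h
  proof -
    have "(hnorm ?K (\<Phi> h))\<^sup>2 = (hnorm (hardy F) (f h))\<^sup>2 + (hnorm H (p h))\<^sup>2"
      using hnorm_oplus[OF HF.hilbert_space_axioms K.hilbert_space_axioms, of "\<Phi> h"]
      by (simp add: \<Phi>_def cO fm p h)
    also have "\<dots> = (hnorm H h)\<^sup>2"
      using sums[OF h] by (simp add: F.hardy_norm_sq fm h tf sums_iff)
    finally show ?thesis using O.hnorm_nonneg[of "\<Phi> h"] hnorm_nonneg[OF h]
      by (simp add: power2_eq_iff_nonneg cO \<Phi>_def fm p h)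
  qed
  ultimately have iso: "isometry_op H ?K \<Phi>" by (simp add: isometry_op_def)
  have "unitary_op H ?K \<Phi>"
  proof (rule isometry_unitaryI[OF hilbert_space_axioms O.hilbert_space_axioms iso])
    fix y assume y: "y \<in> carr ?K" and *: "\<And>x. x \<in> carr H \<Longrightarrow> ip ?K y (\<Phi> x) = 0"
    obtain g k where gk: "y = (g, k)" "g \<in> carr (hardy F)" "k \<in> wold_core" using y by (cases y) (auto simp: cO)
    have kH: "k \<in> carr H" using gk wold_core_subset by auto
    have gF: "taylor F g n \<in> carr F" for n using F.taylor_l2[OF gk(2)] by (simp add: F.l2_def)
    have ip0: "(\<Sum>n. ip F (taylor F g n) (\<Gamma> (S n x))) + ip H k (p x) = 0" if "x \<in> carr H" for x
      using *[OF that] by (simp add: gk(1) \<Phi>_def oplus_def F.hardy_ip tf that)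
    have coeff: "taylor F g n = 0" for n
    proof -
      have "taylor F g n \<in> \<Gamma> ` carr H" using gF[of n] by (simp add: \<Gamma>(2))
      then obtain x where x: "x \<in> carr H" "\<Gamma> x = taylor F g n" by auto
      \<comment> \<open>The wandering part of \<open>x\<close>: \<open>\<Gamma>\<close> does not
        notice the change because it kills the range of \<open>T\<close>, while \<open>T*\<close>
        now annihilates the vector.\<close>
      define x' where "x' = x - T (adj H H T x)"
      have x': "x' \<in> carr H" "adj H H T x' = 0" "\<Gamma> x' = taylor F g n"
        using x by (simp_all add: x'_def mem iso_mem[OF T] adj_mem[OF T] adj_diff[OF T] adj_cancel[OF T]
            linear_op_diff[OF hilbert_space_axioms \<Gamma>(1)] kill)
      have hH: "(T ^^ n) x' \<in> carr H" by (rule funpow_mem[OF x'(1)])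
      \<comment> \<open>\<open>T^n x'\<close> is sent to a monomial of degree \<open>n\<close>. For
        \<open>m < n\<close> the vector \<open>T*^m T^n x'\<close> still lies in the range of
        \<open>T\<close>, which \<open>\<Gamma>\<close> kills; for \<open>m > n\<close> a factor
        \<open>T*\<close> reaches \<open>x'\<close>.\<close>
      have co: "\<Gamma> (S m ((T ^^ n) x')) = (if m = n then taylor F g n else 0)" for m
      proof (cases m n rule: linorder_cases)
        case less
        then obtain j where j: "n = m + Suc j" using less_imp_Suc_add by auto
        have "S m ((T ^^ n) x') = T ((T ^^ j) x')"
          unfolding j funpow_add S_def by (simp add: adj_funpow_cancel funpow_mem[of _ "Suc j", simplified] x')
        thus ?thesis using less by (simp add: kill funpow_mem x')
      next
        case equal
        thus ?thesis by (simp add: S_def adj_funpow_cancel x')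
      next
        case greater
        then obtain j where j: "m = Suc j + n" using less_imp_Suc_add by (metis add.commute add_Suc)
        have "S m ((T ^^ n) x') = (adj H H T ^^ j) (adj H H T x')"
          unfolding j funpow_add S_def by (simp add: adj_funpow_cancel x' funpow_swap1)
        also have "\<dots> = 0"
          using linear_op_zero[OF hilbert_space_axioms linear_op_adj_funpow] by (simp add: x')
        finally show ?thesis using greater linear_op_zero[OF hilbert_space_axioms \<Gamma>(1)] by simp
      qed
      have "p ((T ^^ n) x') = 0"
      proof (rule wold_core_projection_unique[OF hH p[OF hH] orth[OF hH]])
        fix u assume "u \<in> wold_core"
        \<comment> \<open>One power more than in \<open>T^n x'\<close>: after cancelling
          \<open>T^n\<close>, the vector \<open>x'\<close> is tested against \<open>T v\<close>,
          where \<open>T* x' = 0\<close> applies.\<close>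
        then obtain v where v: "v \<in> carr H" "u = (T ^^ Suc n) v" by (rule wold_coreE)
        have "ip H x' (T v) = cnj (ip H v (adj H H T x'))"
          using adj_ip[OF T x'(1) v(1)] ip_sym[of "T v" x'] by (simp add: x' iso_mem[OF T] v)
        also have "\<dots> = 0" using ip_zero_right v by (simp add: x')
        finally show "ip H ((T ^^ n) x' - 0) u = 0"
          using iso_ip[OF isometry_op_funpow[OF T], of x' "T v" n]
          by (simp add: v funpow_swap1 x' iso_mem[OF T])
      qed (use K.zero_mem in auto)
      hence "(\<Sum>m. ip F (taylor F g m) (if m = n then taylor F g n else 0)) = 0"
        using ip0[OF hH] by (simp add: co ip_zero_right kH)
      moreover have "(\<lambda>m. ip F (taylor F g m) (if m = n then taylor F g n else 0)) sums ip F (taylor F g n) (taylor F g n)"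
        using sums_single[of n "\<lambda>m. ip F (taylor F g m) (taylor F g n)"]
        by (rule sums_cong[THEN iffD1, rotated]) (auto simp: F.ip_zero_right gF)
      ultimately have "ip F (taylor F g n) (taylor F g n) = 0" by (simp add: sums_iff)
      thus ?thesis using F.hnorm_eq_0[OF gF[of n]] by (simp add: hnorm_def)
    qed
    have "g = 0"
      using F.has_taylor_unique_fun[OF _ F.has_taylor_zero, of g] gk(2) coeff by (simp add: F.hardy_carr fun_eq_iff)
         (metis ext)
    moreover have "k = 0"
    proof -
      \<comment> \<open>With all coefficients of \<open>g\<close> known to vanish, testing against
        \<open>\<Phi> k\<close> leaves \<open>ip H k (p k)\<close>.\<close>
      have "p k = k"
        by (rule wold_core_projection_unique[OF kH p[OF kH] orth[OF kH] gk(3)])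
          (use wold_core_subset in \<open>auto simp: ip_zero\<close>)
      hence "ip H k k = 0"
        using ip0[OF kH] by (simp add: coeff F.ip_zero linear_opD(1)[OF lin kH])
      thus ?thesis using hnorm_eq_0[OF kH] by (simp add: hnorm_def)
    qed
    ultimately show "y = 0" by (simp add: gk zero_prod_def)
  qed
  hence "wold_model F \<Gamma> \<Phi>" using f p orth by (simp add: wold_model_def \<Phi>_def S_def)
  thus ?thesis by blast
qed

text \<open>Because \<open>S\<close> maps the core onto itself, each test vector is
  \<open>S v\<close> with \<open>v\<close> in the core, and \<open>S\<close> can be cancelled. So
  \<open>S\<close> also preserves the orthogonal complement of the core.\<close>

lemma wold_core_projection_intertwines:
  assumes S: "isometry_op H H S" "S ` wold_core = wold_core" and h: "h \<in> carr H"
    and p: "p \<in> wold_core" "\<And>u. u \<in> wold_core \<Longrightarrow> ip H (h - p) u = 0"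
    and p': "p' \<in> wold_core" "\<And>u. u \<in> wold_core \<Longrightarrow> ip H (S h - p') u = 0"
  shows "p' = S p"
proof (rule wold_core_projection_unique[OF iso_mem[OF S(1) h] p'])
  have pH: "p \<in> carr H" using p wold_core_subset by auto
  show "S p \<in> wold_core" using p(1) S(2) by auto
  fix u assume "u \<in> wold_core"
  then obtain v where v: "v \<in> wold_core" "u = S v" using S(2) by blast
  moreover have "v \<in> carr H" using v wold_core_subset by auto
  ultimately show "ip H (S h - S p) u = 0"
    using iso_ip[OF S(1), of "h - p" v] p(2)[of v] by (simp add: h pH mem iso_diff[OF S(1)])
qed

end

end

section \<open>Weighted shifts and their tensor products\<close>

lemma hconv_complex_hilb: "hconv complex_hilb X l \<longleftrightarrow> X \<longlonglongrightarrow> l"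
  by (simp add: hconv_def hnorm_complex tendsto_norm_zero_iff LIM_zero_iff)

lemma has_taylor_complex_iff:
  "has_taylor complex_hilb f a \<longleftrightarrow> summable (\<lambda>n. (cmod (a n))\<^sup>2) \<and>
    (\<forall>z. if cmod z < 1 then (\<lambda>n. z ^ n * a n) sums f z else f z = 0)"
  by (simp add: has_taylor_def hnorm_complex hconv_complex_hilb sums_def scaleC_complex_def)
     (simp add: complex_hilb_def)

lemma has_taylor_rot:
  assumes "has_taylor complex_hilb f a" "cmod c = 1"
  shows "has_taylor complex_hilb (rot c f) (\<lambda>n. c ^ n * a n)"
  unfolding has_taylor_complex_iff
proof (intro conjI allI)
  show "summable (\<lambda>n. (cmod (c ^ n * a n))\<^sup>2)"
    using assms by (simp add: has_taylor_complex_iff norm_mult norm_power)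
  fix z
  have "if cmod (c * z) < 1 then (\<lambda>n. (c * z) ^ n * a n) sums f (c * z) else f (c * z) = 0"
    using assms(1) unfolding has_taylor_complex_iff by blast
  thus "if cmod z < 1 then (\<lambda>n. z ^ n * (c ^ n * a n)) sums rot c f z else rot c f z = 0"
    by (cases "cmod z < 1") (simp_all add: rot_def norm_mult assms(2) power_mult_distrib mult_ac)
qed

lemma has_taylor_mult_z:
  assumes "has_taylor complex_hilb f a"
  shows "has_taylor complex_hilb (mult_z f) (\<lambda>n. if n < 1 then 0 else a (n - 1))"
  unfolding has_taylor_complex_iff
proof (intro conjI allI)
  show "summable (\<lambda>n. (cmod (if n < 1 then 0 else a (n - 1)))\<^sup>2)"
    using assms by (subst summable_Suc_iff[symmetric]) (simp add: has_taylor_complex_iff)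
  fix z
  have "(\<lambda>n. z ^ n * (if n < 1 then 0 else a (n - 1))) sums (z * f z)" if "(\<lambda>n. z ^ n * a n) sums f z"
    using sums_mult[OF that, of z] sums_Suc[of "\<lambda>n. z ^ n * (if n < 1 then 0 else a (n - 1))" "z * f z"]
    by (simp add: mult.assoc)
  thus "if cmod z < 1 then (\<lambda>n. z ^ n * (if n < 1 then 0 else a (n - 1))) sums mult_z f z else mult_z f z = 0"
    using assms unfolding has_taylor_complex_iff mult_z_def by (metis mult_zero_right)
qed

text \<open>The action on Taylor coefficients of the scalar operators in the models. The weight is
  taken at the new degree \<open>n\<close>, which makes it \<open>c ^ (n - 1)\<close> for
  \<open>mult_z \<circ> rot c\<close> and \<open>c ^ n\<close> for
  \<open>rot c \<circ> mult_z\<close>.\<close>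

definition weighted_shift :: "nat \<Rightarrow> (nat \<Rightarrow> complex) \<Rightarrow> (nat \<Rightarrow> 'a::complex_vector) \<Rightarrow> nat \<Rightarrow> 'a"
  where "weighted_shift k w a n = (if n < k then 0 else w n *\<^sub>C a (n - k))"

text \<open>Weights of modulus one preserve the norm of a coefficient sequence, so
  \<open>S \<otimes> X\<close> is bounded by any bound for \<open>X\<close>.\<close>

definition unimodular_shift :: "((complex \<Rightarrow> complex) \<Rightarrow> complex \<Rightarrow> complex) \<Rightarrow> nat \<Rightarrow> (nat \<Rightarrow> complex) \<Rightarrow> bool"
  where "unimodular_shift S k w \<longleftrightarrow> (\<forall>n. cmod (w n) = 1) \<and>
    (\<forall>f a. has_taylor complex_hilb f a \<longrightarrow> has_taylor complex_hilb (S f) (weighted_shift k w a))"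

lemma unimodular_shift_rot: "cmod c = 1 \<Longrightarrow> unimodular_shift (rot c) 0 (\<lambda>n. c ^ n)"
  using has_taylor_rot
  by (simp add: unimodular_shift_def norm_power weighted_shift_def[abs_def] scaleC_complex_def)

lemma unimodular_shift_mult_z_rot: "cmod c = 1 \<Longrightarrow> unimodular_shift (mult_z \<circ> rot c) 1 (\<lambda>n. c ^ (n - 1))"
  using has_taylor_mult_z[OF has_taylor_rot]
  by (simp add: unimodular_shift_def norm_power weighted_shift_def[abs_def] scaleC_complex_def if_distrib cong: if_cong)

lemma unimodular_shift_rot_mult_z: "cmod c = 1 \<Longrightarrow> unimodular_shift (rot c \<circ> mult_z) 1 (\<lambda>n. c ^ n)"
  using has_taylor_rot[OF has_taylor_mult_z]
  by (simp add: unimodular_shift_def norm_power weighted_shift_def[abs_def] scaleC_complex_def if_distrib cong: if_cong)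

context hilbert_space
begin

lemma sums_weighted_shift:
  assumes a: "\<And>n. a n \<in> carr H" and w: "\<And>n. cmod (w n) = 1" and s: "(\<lambda>n. (hnorm H (a n))\<^sup>2) sums s"
  shows "(\<lambda>n. (hnorm H (weighted_shift k w a n))\<^sup>2) sums s"
proof -
  have "(\<lambda>n. (hnorm H (weighted_shift k w a (n + k)))\<^sup>2) sums s"
    using s a w by (simp add: weighted_shift_def hnorm_scale)
  moreover have "(\<Sum>i<k. (hnorm H (weighted_shift k w a i))\<^sup>2) = 0"
    by (simp add: weighted_shift_def hnorm_zero)
  ultimately show ?thesis by (subst (asm) sums_iff_shift) simp
qed

lemma weighted_shift_mem: "(\<And>n. a n \<in> carr H) \<Longrightarrow> weighted_shift k w a n \<in> carr H"
  by (simp add: weighted_shift_def mem)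

text \<open>The candidate for \<open>tensor_op\<close>: \<open>X\<close> acts on each coefficient,
  then the weighted shift is applied. It vanishes off the Hardy space, as the description of
  \<open>tensor_op\<close> requires.\<close>

lemma ex_tensor_weighted_shift:
  assumes X: "bounded_op H H X" and w: "\<And>n. cmod (w n) = 1"
  shows "\<exists>L. bounded_op (hardy H) (hardy H) L \<and> (\<forall>u. u \<notin> carr (hardy H) \<longrightarrow> L u = 0) \<and>
    (\<forall>f\<in>carr (hardy H). has_taylor H (L f) (weighted_shift k w (\<lambda>n. X (taylor H f n))))"
proof -
  obtain M where lin: "linear_op H H X" and M: "\<And>x. x \<in> carr H \<Longrightarrow> hnorm H (X x) \<le> M * hnorm H x"
    using X by (auto simp: bounded_op_def)
  note tm = l2_mem[OF taylor_l2]
  have Mn: "(hnorm H (X x))\<^sup>2 \<le> M\<^sup>2 * (hnorm H x)\<^sup>2" if "x \<in> carr H" for x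
    using power_mono[OF M[OF that] hnorm_nonneg[OF linear_opD(1)[OF lin that]], of 2] by (simp add: power_mult_distrib)
  define b where "b f n = X (taylor H f n)" for f n
  have bm: "b f n \<in> carr H" if "f \<in> carr (hardy H)" for f n
    unfolding b_def by (rule linear_opD(1)[OF lin tm[OF that]])
  have st: "summable (\<lambda>n. (hnorm H (taylor H f n))\<^sup>2)" if "f \<in> carr (hardy H)" for f
    using taylor_l2[OF that] by (simp add: l2_def)
  have sb: "summable (\<lambda>n. (hnorm H (b f n))\<^sup>2)" if "f \<in> carr (hardy H)" for f
    by (rule summable_comparison_test'[OF summable_mult[OF st[OF that]], of 0 _ "M\<^sup>2"])
      (use Mn[OF tm[OF that]] in \<open>simp add: b_def\<close>)
  have sw: "(\<lambda>n. (hnorm H (weighted_shift k w (b f) n))\<^sup>2) sums (\<Sum>n. (hnorm H (b f n))\<^sup>2)" if "f \<in> carr (hardy H)" for f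
    by (rule sums_weighted_shift[OF bm[OF that] w summable_sums[OF sb[OF that]]])
  have "\<forall>f. \<exists>g. f \<in> carr (hardy H) \<longrightarrow> has_taylor H g (weighted_shift k w (b f))"
  proof
    fix f
    have "l2 (weighted_shift k w (b f))" if "f \<in> carr (hardy H)"
      using sw[OF that] weighted_shift_mem[OF bm[OF that]] by (auto simp: l2_def sums_iff)
    thus "\<exists>g. f \<in> carr (hardy H) \<longrightarrow> has_taylor H g (weighted_shift k w (b f))"
      using ex_has_taylor by blast
  qed
  from choice[OF this] obtain G where G: "\<And>f. f \<in> carr (hardy H) \<Longrightarrow> has_taylor H (G f) (weighted_shift k w (b f))"
    by blast
  define L where "L f = (if f \<in> carr (hardy H) then G f else 0)" for f
  have L: "has_taylor H (L f) (weighted_shift k w (b f))" if "f \<in> carr (hardy H)" for f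
    using G that by (simp add: L_def)
  have Lm: "L f \<in> carr (hardy H)" if "f \<in> carr (hardy H)" for f by (rule hardy_memI[OF L[OF that]])
  \<comment> \<open>\<open>M\<close> may be negative (if the carrier is trivial), and squaring the
    estimate loses its sign.\<close>
  have "bounded_op (hardy H) (hardy H) L"
  proof (rule bounded_opI[where M = "\<bar>M\<bar>"])
    have "L (f + g) = L f + L g" if fg: "f \<in> carr (hardy H)" "g \<in> carr (hardy H)" for f g
    proof (rule has_taylor_unique_fun[OF L[OF hardy_add[OF fg]]])
      have "weighted_shift k w (b (f + g)) = (\<lambda>n. weighted_shift k w (b f) n + weighted_shift k w (b g) n)"
        by (simp add: fun_eq_iff weighted_shift_def b_def taylor_add fg linear_opD(2)[OF lin] tm scaleC_add_right)
      thus "has_taylor H (L f + L g) (weighted_shift k w (b (f + g)))"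
        using has_taylor_add[OF L L, OF fg] by simp
    qed
    moreover have "L (c *\<^sub>C f) = c *\<^sub>C L f" if f: "f \<in> carr (hardy H)" for c f
    proof (rule has_taylor_unique_fun[OF L[OF hardy_scale[OF f]]])
      have "weighted_shift k w (b (c *\<^sub>C f)) = (\<lambda>n. c *\<^sub>C weighted_shift k w (b f) n)"
        by (simp add: fun_eq_iff weighted_shift_def b_def taylor_scale f linear_opD(3)[OF lin] tm scaleC_scaleC mult.commute)
      thus "has_taylor H (c *\<^sub>C L f) (weighted_shift k w (b (c *\<^sub>C f)))"
        using has_taylor_scale[OF L[OF f]] by simp
    qed
    ultimately show "linear_op (hardy H) (hardy H) L" by (simp add: linear_op_def Lm)
    fix f assume f: "f \<in> carr (hardy H)"
    have "(hnorm (hardy H) (L f))\<^sup>2 = (\<Sum>n. (hnorm H (b f n))\<^sup>2)"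
      using sw[OF f] by (simp add: hardy_norm_sq[OF Lm[OF f]] taylor_eq[OF L[OF f]] sums_iff)
    also have "\<dots> \<le> (\<Sum>n. M\<^sup>2 * (hnorm H (taylor H f n))\<^sup>2)"
      using Mn[OF tm[OF f]] by (intro suminf_le sb f summable_mult st) (simp add: b_def)
    also have "\<dots> = (\<bar>M\<bar> * hnorm (hardy H) f)\<^sup>2"
      by (simp add: suminf_mult st f power_mult_distrib hardy_norm_sq)
    finally show "hnorm (hardy H) (L f) \<le> \<bar>M\<bar> * hnorm (hardy H) f"
      using f by (rule_tac power2_le_imp_le) (auto simp: hardy_norm suminf_nonneg st)
  qed
  moreover have "\<forall>u. u \<notin> carr (hardy H) \<longrightarrow> L u = 0" by (simp add: L_def)
  ultimately show ?thesis using L unfolding b_def[abs_def] by blast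
qed

text \<open>Replaces the description of \<open>tensor_op\<close> by a coefficient formula. The
  description has only one solution, as two bounded solutions agree on elementary tensors and hence
  on the closure of their finite sums.\<close>

theorem has_taylor_tensor_op:
  assumes X: "bounded_op H H X" and shift: "unimodular_shift S k w" and f: "f \<in> carr (hardy H)"
  shows "has_taylor H (tensor_op H S X f) (weighted_shift k w (\<lambda>n. X (taylor H f n)))"
proof -
  interpret C: hilbert_space complex_hilb by (rule hilbert_space_complex)
  have w: "cmod (w n) = 1" for n using shift by (simp add: unimodular_shift_def)
  have S: "has_taylor complex_hilb (S g) (weighted_shift k w (taylor complex_hilb g))" if "g \<in> carr H2" for g
    using shift that by (simp add: unimodular_shift_def H2_def C.hardy_carr)
  have lin: "linear_op H H X" using X by (simp add: bounded_op_def)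
  have T: "hilbert_tensor_product H2 H (hardy H) elem_tensor"
    by (rule hardy_is_tensor_product[OF hilbert_space_axioms])
  obtain L where L: "bounded_op (hardy H) (hardy H) L" "\<And>u. u \<notin> carr (hardy H) \<Longrightarrow> L u = 0"
    "\<And>f. f \<in> carr (hardy H) \<Longrightarrow> has_taylor H (L f) (weighted_shift k w (\<lambda>n. X (taylor H f n)))"
    using ex_tensor_weighted_shift[where w = w and k = k, OF X w] by (elim exE conjE) simp
  have mem2: "elem_tensor g x \<in> carr (hardy H)" if "g \<in> carr H2" "x \<in> carr H" for g x
    using T that by (auto simp: hilbert_tensor_product_def linear_op_def)
  have "tensor_op H S X = L" unfolding tensor_op_def
  proof (rule the_equality)
    have "L (elem_tensor g x) = elem_tensor (S g) (X x)" if g: "g \<in> carr H2" and x: "x \<in> carr H" for g x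
    proof (rule has_taylor_unique_fun)
      have tg: "has_taylor complex_hilb g (taylor complex_hilb g)" using g by (simp add: H2_def C.hardy_carr)
      have "taylor H (elem_tensor g x) = (\<lambda>n. taylor complex_hilb g n *\<^sub>C x)"
        by (rule taylor_eq[OF has_taylor_elem_tensor[OF hilbert_space_axioms tg x]])
      thus "has_taylor H (L (elem_tensor g x)) (\<lambda>n. weighted_shift k w (taylor complex_hilb g) n *\<^sub>C X x)"
        using L(3)[OF mem2[OF g x]]
        by (simp add: weighted_shift_def[abs_def] linear_opD(3)[OF lin x] scaleC_scaleC scaleC_complex_def if_distribR
            if_distrib[of "\<lambda>c. c *\<^sub>C X x"] cong: if_cong)
      show "has_taylor H (elem_tensor (S g) (X x)) (\<lambda>n. weighted_shift k w (taylor complex_hilb g) n *\<^sub>C X x)"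
        by (rule has_taylor_elem_tensor[OF hilbert_space_axioms S[OF g] linear_opD(1)[OF lin x]])
    qed
    thus L': "bounded_op (hardy H) (hardy H) L \<and>
      (\<forall>f\<in>carr H2. \<forall>x\<in>carr H. L (elem_tensor f x) = elem_tensor (S f) (X x)) \<and>
      (\<forall>u. u \<notin> carr (hardy H) \<longrightarrow> L u = 0)" using L by blast
    fix L' assume L'': "bounded_op (hardy H) (hardy H) L' \<and>
      (\<forall>f\<in>carr H2. \<forall>x\<in>carr H. L' (elem_tensor f x) = elem_tensor (S f) (X x)) \<and>
      (\<forall>u. u \<notin> carr (hardy H) \<longrightarrow> L' u = 0)"
    define D where "D = {\<Sum>k<n. elem_tensor (a k) (b k) | (n::nat) a b. range a \<subseteq> carr H2 \<and> range b \<subseteq> carr H}"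
    interpret HH: hilbert_space "hardy H" by (rule hilbert_space_hardy)
    have D: "hclosure (hardy H) D = carr (hardy H)" using T by (simp add: hilbert_tensor_product_def D_def)
    have "D \<subseteq> carr (hardy H)" unfolding D_def by (auto intro!: HH.sum_mem mem2 simp: image_subset_iff)
    moreover have "L' u = L u" if uD: "u \<in> D" for u
    proof -
      obtain n :: nat and a b where u: "u = (\<Sum>k<n. elem_tensor (a k) (b k))" "range a \<subseteq> carr H2" "range b \<subseteq> carr H"
        using uD unfolding D_def by blast
      have ab: "a i \<in> carr H2" "b i \<in> carr H" for i using u by auto
      have "Q u = (\<Sum>i<n. Q (elem_tensor (a i) (b i)))" if "bounded_op (hardy H) (hardy H) Q" for Q
        unfolding u(1) using that
        by (intro linear_op_sum[OF HH.hilbert_space_axioms]) (auto simp: bounded_op_def mem2 ab)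
      thus ?thesis using L' L'' by (simp add: ab)
    qed
    ultimately have "L' u = L u" if "u \<in> carr (hardy H)" for u
      using HH.bounded_op_eq_on_hclosure[OF HH.hilbert_space_axioms, of L' L D u] L' L'' that D by blast
    thus "L' = L" using L' L'' by (metis ext)
  qed
  thus ?thesis using L(3)[OF f] by simp
qed

end

section \<open>Products of q-commuting isometries\<close>

lemma oprod_simps [simp]:
  "oprod V [] = id" "oprod V (j # js) x = V j (oprod V js x)"
  by (simp_all add: oprod_def)

lemma oprod_append [simp]: "oprod V (xs @ ys) x = oprod V xs (oprod V ys x)"
  by (induction xs) simp_all

lemma cmod_prod_list: "(\<And>x. x \<in> set xs \<Longrightarrow> cmod x = 1) \<Longrightarrow> cmod (prod_list xs) = 1"
  by (induction xs) (simp_all add: norm_mult)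

locale q_commuting_isometries = hilbert_space H for H :: "'a::complex_vector hilb" +
  fixes d :: nat and q :: "nat \<Rightarrow> nat \<Rightarrow> complex" and V :: "nat \<Rightarrow> 'a \<Rightarrow> 'a"
  assumes q_norm: "i \<in> {1..d} \<Longrightarrow> j \<in> {1..d} \<Longrightarrow> cmod (q i j) = 1"
    and q_diag: "i \<in> {1..d} \<Longrightarrow> q i i = 1"
    and V_isometry: "i \<in> {1..d} \<Longrightarrow> isometry_op H H (V i)"
    and V_commute: "i \<in> {1..d} \<Longrightarrow> j \<in> {1..d} \<Longrightarrow> h \<in> carr H \<Longrightarrow> V i (V j h) = q i j *\<^sub>C V j (V i h)"
begin

lemma isometry_oprod: "set js \<subseteq> {1..d} \<Longrightarrow> isometry_op H H (oprod V js)"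
proof (induction js)
  case Nil
  show ?case by (simp add: isometry_op_def linear_op_def)
next
  case (Cons j js)
  then show ?case using isometry_op_comp[of H H "oprod V js" H "V j"] V_isometry[of j]
    by (simp add: oprod_simps(2)[abs_def])
qed

lemma oprod_commute:
  assumes i: "i \<in> {1..d}" and js: "set js \<subseteq> {1..d}" and h: "h \<in> carr H"
  shows "V i (oprod V js h) = (\<Prod>j\<leftarrow>js. q i j) *\<^sub>C oprod V js (V i h)"
  using js
proof (induction js)
  case Nil
  show ?case by (simp add: scaleC_one)
next
  case (Cons j js)
  hence j: "j \<in> {1..d}" and js: "set js \<subseteq> {1..d}" by auto
  have m: "oprod V js h \<in> carr H" "oprod V js (V i h) \<in> carr H"
    using iso_mem[OF isometry_oprod[OF js]] iso_mem[OF V_isometry[OF i]] h by auto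
  show ?case
    using Cons.IH[OF js] V_commute[OF i j m(1)] linear_opD(3)[OF isometry_opD(1)[OF V_isometry[OF j]] m(2)]
    by (simp add: scaleC_scaleC)
qed

text \<open>Adjoints reverse the order of a product; this allows the original order to be restored
  at the cost of a scalar of modulus one.\<close>

lemma oprod_rev:
  assumes js: "set js \<subseteq> {1..d}"
  obtains c where "cmod c = 1" "\<And>h. h \<in> carr H \<Longrightarrow> oprod V (rev js) h = c *\<^sub>C oprod V js h"
proof -
  have "\<exists>c. cmod c = 1 \<and> (\<forall>h\<in>carr H. oprod V (rev js) h = c *\<^sub>C oprod V js h)" using js
  proof (induction js)
    case Nil
    show ?case by (rule exI[of _ 1]) (simp add: scaleC_one)
  next
    case (Cons j js)
    hence j: "j \<in> {1..d}" and js: "set js \<subseteq> {1..d}" by auto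
    obtain c where c: "cmod c = 1" "\<And>h. h \<in> carr H \<Longrightarrow> oprod V (rev js) h = c *\<^sub>C oprod V js h"
      using Cons.IH[OF js] by blast
    define p where "p = (\<Prod>k\<leftarrow>js. q j k)"
    have p: "cmod p = 1" unfolding p_def by (rule cmod_prod_list) (use js j q_norm in auto)
    hence "p \<noteq> 0" by auto
    hence p0: "inverse p * p = 1" by simp
    \<comment> \<open>In the reversed product \<open>V j\<close> acts first; moving it to the front
      past \<open>js\<close> costs \<open>inverse p\<close>.\<close>
    have "oprod V (rev (j # js)) h = (c * inverse p) *\<^sub>C oprod V (j # js) h" if h: "h \<in> carr H" for h
    proof -
      have "V j (oprod V js h) = p *\<^sub>C oprod V js (V j h)"
        using oprod_commute[OF j js h] by (simp add: p_def)
      thus ?thesis using c(2)[of "V j h"] p0 iso_mem[OF V_isometry[OF j] h]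
        by (simp add: scaleC_scaleC mult.assoc)
    qed
    thus ?case using c p by (intro exI[of _ "c * inverse p"]) (simp add: norm_mult norm_inverse)
  qed
  thus ?thesis using that by blast
qed

lemma oprod_adj:
  assumes "set js \<subseteq> {1..d}" "h \<in> carr H"
  shows "oprod (\<lambda>k. adj H H (V k)) js h = adj H H (oprod V (rev js)) h"
  using assms(1)
proof (induction js)
  case Nil
  show ?case using adj_eqI[OF hilbert_space_axioms assms(2,2), of "\<lambda>x. x"] by (simp add: id_def)
next
  case (Cons j js)
  hence j: "j \<in> {1..d}" and js: "set js \<subseteq> {1..d}" by auto
  have "adj H H (oprod V (rev (j # js))) h = adj H H (V j) (adj H H (oprod V (rev js)) h)"
    by (rule adj_comp[OF isometry_oprod V_isometry[OF j] _ assms(2)]) (use js in auto)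
  thus ?case using Cons.IH[OF js] by (simp only: oprod_simps)
qed

lemma linear_op_oprod_adj: "set js \<subseteq> {1..d} \<Longrightarrow> linear_op H H (oprod (\<lambda>k. adj H H (V k)) js)"
  using adj_linear[OF isometry_oprod[of "rev js"]] by (simp add: linear_op_def oprod_adj mem)

text \<open>Norms do not see the unimodular factor between a product and its reversal.\<close>

lemma hnorm_oprod_adj:
  assumes js: "set js \<subseteq> {1..d}" and h: "h \<in> carr H"
  shows "hnorm H (oprod (\<lambda>k. adj H H (V k)) js h) = hnorm H (adj H H (oprod V js) h)"
proof -
  obtain c where c: "cmod c = 1" "\<And>h. h \<in> carr H \<Longrightarrow> oprod V (rev js) h = c *\<^sub>C oprod V js h"
    using oprod_rev[OF js] by blast
  have "adj H H (oprod V (rev js)) h = cnj c *\<^sub>C adj H H (oprod V js) h"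
    by (rule adj_scaled[OF isometry_oprod[OF js] c(2) h])
  thus ?thesis using c(1) by (simp add: oprod_adj[OF js h] hnorm_scale adj_mem[OF isometry_oprod[OF js] h])
qed

abbreviation omitted :: "nat \<Rightarrow> nat list"
  where "omitted i \<equiv> filter (\<lambda>j. j \<noteq> i) [1..<Suc d]"

lemma set_omitted: "set (omitted i) = {1..d} - {i}"
  by auto

lemma isometry_omit_prod: "isometry_op H H (omit_prod d V i)"
  unfolding omit_prod_def by (rule isometry_oprod) auto

lemma omit_prod_commute:
  assumes i: "i \<in> {1..d}" and h: "h \<in> carr H"
  shows "V i (omit_prod d V i h) = qprod d q i *\<^sub>C omit_prod d V i (V i h)"
proof -
  \<comment> \<open>The omitted index contributes \<open>q i i = 1\<close>, so the product over the
    remaining indices is all of \<open>qprod d q i\<close>.\<close>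
  have "(\<Prod>j\<leftarrow>omitted i. q i j) = (\<Prod>j\<in>{1..d} - {i}. q i j)"
    by (subst set_omitted[symmetric], rule prod.distinct_set_conv_list[symmetric]) simp
  also have "\<dots> = qprod d q i"
    unfolding qprod_def using i q_diag[OF i] by (subst (2) prod.remove[of _ i]) auto
  finally show ?thesis using oprod_commute[OF i _ h, of "omitted i"] unfolding omit_prod_def set_omitted by auto
qed

lemma cmod_qprod: "i \<in> {1..d} \<Longrightarrow> cmod (qprod d q i) = 1"
  unfolding qprod_def prod_norm[symmetric] by (rule prod.neutral) (simp add: q_norm)

text \<open>Needed to compare the core of \<open>V_i V_(i)\<close>, which depends on
  \<open>i\<close>, with that of the ordered product, which does not.\<close>

lemma full_product:
  assumes i: "i \<in> {1..d}"
  obtains c where "cmod c = 1" "\<And>h. h \<in> carr H \<Longrightarrow> oprod V [1..<Suc d] h = c *\<^sub>C V i (omit_prod d V i h)"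
proof -
  have spl: "[1..<Suc d] = [1..<i] @ i # [Suc i..<Suc d]"
    using i upt_add_eq_append[of 1 i "Suc d - i"] by (simp add: upt_conv_Cons)
  have om: "omitted i = [1..<i] @ [Suc i..<Suc d]"
    unfolding spl by (simp add: filter_id_conv del: upt_Suc)
  \<comment> \<open>The scalar collected when \<open>V i\<close> passes the factors with index below
    \<open>i\<close>.\<close>
  define p where "p = (\<Prod>k\<leftarrow>[1..<i]. q i k)"
  have p: "cmod p = 1" unfolding p_def by (rule cmod_prod_list) (use i q_norm in auto)
  hence "p \<noteq> 0" by auto
  hence p0: "inverse p * p = 1" by simp
  have "oprod V [1..<Suc d] h = inverse p *\<^sub>C V i (omit_prod d V i h)" if h: "h \<in> carr H" for h
  proof -
    have g: "oprod V [Suc i..<Suc d] h \<in> carr H" by (rule iso_mem[OF isometry_oprod h]) auto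
    have "set [1..<i] \<subseteq> {1..d}" using i by auto
    from oprod_commute[OF i this g]
    have "V i (omit_prod d V i h) = p *\<^sub>C oprod V [1..<i] (V i (oprod V [Suc i..<Suc d] h))"
      by (simp only: omit_prod_def om p_def oprod_append)
    thus ?thesis unfolding spl by (simp add: scaleC_scaleC p0 scaleC_one del: upt_Suc)
  qed
  thus ?thesis using that p by (metis inverse_1 norm_inverse)
qed

section \<open>Splitting the defect space of a product\<close>

text \<open>For \<open>js = [j\<^sub>1, \<dots>, j\<^sub>k]\<close> the components telescope to \<open>\<parallel>h\<parallel>\<^sup>2 - \<parallel>C* h\<parallel>\<^sup>2\<close> with the reversed product
  \<open>C = V\<^bsub>j\<^sub>k\<^esub> \<cdots> V\<^bsub>j\<^sub>1\<^esub>\<close>; by q-commutativity \<open>C\<close> differs from \<open>oprod V js\<close> only by a unimodular factor,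
  so both have the same defect operator.\<close>

fun defect_chain :: "nat list \<Rightarrow> 'a \<Rightarrow> nat \<Rightarrow> 'a"
  where
    "defect_chain [] h = (\<lambda>_. 0)"
  | "defect_chain (j # js) h = (defect_chain js h)(j := defect_adj H (V j) (oprod (\<lambda>k. adj H H (V k)) js h))"

abbreviation defect_sum :: "nat set \<Rightarrow> (nat \<Rightarrow> 'a) hilb"
  where "defect_sum I \<equiv> dsum I (\<lambda>j. defect_space H (V j))"

text \<open>Links the recursion, which suits induction, to the closed formula in
  \<open>explicit_tuple\<close>. Component \<open>j\<close> sees only the factors after
  \<open>j\<close>, hence the lower bound \<open>Suc j\<close>.\<close>

lemma defect_chain_filter_upt:
  "defect_chain (filter P [m..<n]) h =
    (\<lambda>j. if j \<in> {m..<n} \<and> P j then defect_adj H (V j) (oprod (\<lambda>k. adj H H (V k)) (filter P [Suc j..<n]) h) else 0)"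
proof (induction "n - m" arbitrary: m)
  case 0
  thus ?case by auto
next
  case (Suc k)
  hence "[m..<n] = m # [Suc m..<n]" by (simp add: upt_conv_Cons)
  moreover have "{m..<n} = insert m {Suc m..<n}" using Suc(2) by auto
  ultimately show ?case using Suc(1)[of "Suc m"] Suc(2) by (auto simp: fun_eq_iff)
qed

lemma carr_defect_sum:
  "I \<subseteq> {1..d} \<Longrightarrow> x \<in> carr (defect_sum I) \<longleftrightarrow>
    (\<forall>j\<in>I. x j \<in> carr H \<and> adj H H (V j) (x j) = 0) \<and> (\<forall>j. j \<notin> I \<longrightarrow> x j = 0)"
  by (auto simp: dsum_def carr_defect_space[OF V_isometry] subset_iff)

lemma hilbert_space_defect_sum: "I \<subseteq> {1..d} \<Longrightarrow> hilbert_space (defect_sum I)"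
  by (intro hilbert_space_dsum hilbert_space_defect_space V_isometry) (auto intro: finite_subset)

lemma hnorm_defect_sum:
  assumes I: "I \<subseteq> {1..d}" and x: "x \<in> carr (defect_sum I)"
  shows "(hnorm (defect_sum I) x)\<^sup>2 = (\<Sum>j\<in>I. (hnorm H (x j))\<^sup>2)"
proof -
  have "finite I" using I finite_subset by blast
  from hnorm_dsum[OF this hilbert_space_defect_space[OF V_isometry] x] I
  have "(hnorm (defect_sum I) x)\<^sup>2 = (\<Sum>j\<in>I. (hnorm (defect_space H (V j)) (x j))\<^sup>2)" by blast
  also have "\<dots> = (\<Sum>j\<in>I. (hnorm H (x j))\<^sup>2)"
    using I by (intro sum.cong) (auto simp: defect_space_def)
  finally show ?thesis .
qed

lemma
  assumes I: "I \<subseteq> {1..d}" and i: "i \<in> {1..d}" "i \<notin> I"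
    and x: "x \<in> carr H" "adj H H (V i) x = 0" and y: "y \<in> carr (defect_sum I)"
  shows defect_sum_upd_mem: "y(i := x) \<in> carr (defect_sum (insert i I))"
    and hnorm_defect_sum_upd: "(hnorm (defect_sum (insert i I)) (y(i := x)))\<^sup>2 = (hnorm H x)\<^sup>2 + (hnorm (defect_sum I) y)\<^sup>2"
proof -
  have I': "insert i I \<subseteq> {1..d}" using I i by auto
  show m: "y(i := x) \<in> carr (defect_sum (insert i I))"
    using x y i by (auto simp: carr_defect_sum[OF I'] carr_defect_sum[OF I])
  have "finite I" using I finite_subset by blast
  thus "(hnorm (defect_sum (insert i I)) (y(i := x)))\<^sup>2 = (hnorm H x)\<^sup>2 + (hnorm (defect_sum I) y)\<^sup>2"
    using i(2) by (simp add: hnorm_defect_sum[OF I' m] hnorm_defect_sum[OF I y]) (auto intro: sum.cong)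
qed

lemma defect_chain:
  assumes "set js \<subseteq> {1..d}" "distinct js"
  shows linear_op_defect_chain: "linear_op H (defect_sum (set js)) (defect_chain js)"
    and hnorm_defect_chain: "\<And>h. h \<in> carr H \<Longrightarrow> (hnorm (defect_sum (set js)) (defect_chain js h))\<^sup>2 =
      (hnorm H h)\<^sup>2 - (hnorm H (adj H H (oprod V js) h))\<^sup>2"
    and defect_chain_onto: "defect_chain js ` carr H = carr (defect_sum (set js))"
proof -
  \<comment> \<open>The induction uses the chain of adjoints, from which one factor peels off at a
    time; the adjoint of the product enters only at the end, where just its norm matters.\<close>
  let ?adj = "oprod (\<lambda>k. adj H H (V k))"
  have "linear_op H (defect_sum (set js)) (defect_chain js) \<and>
    (\<forall>h\<in>carr H. (hnorm (defect_sum (set js)) (defect_chain js h))\<^sup>2 = (hnorm H h)\<^sup>2 - (hnorm H (?adj js h))\<^sup>2) \<and>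
    carr (defect_sum (set js)) \<subseteq> defect_chain js ` carr H"
    using assms
  proof (induction js)
    case Nil
    have "hnorm (defect_sum {}) (\<lambda>_. 0) = 0" by (simp add: hnorm_def dsum_def)
    thus ?case using zero_mem by (auto simp: linear_op_def dsum_def scaleC_fun_def fun_eq_iff)
  next
    case (Cons j js)
    hence j: "j \<in> {1..d}" "j \<notin> set js" and js: "set js \<subseteq> {1..d}" by auto
    note IH = Cons.IH[OF js]
    have lin: "linear_op H (defect_sum (set js)) (defect_chain js)"
      and norm: "\<And>h. h \<in> carr H \<Longrightarrow> (hnorm (defect_sum (set js)) (defect_chain js h))\<^sup>2 = (hnorm H h)\<^sup>2 - (hnorm H (?adj js h))\<^sup>2"
      and onto: "carr (defect_sum (set js)) \<subseteq> defect_chain js ` carr H"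
      using IH Cons.prems by auto
    note la = linear_op_oprod_adj[OF js]
    note ld = linear_op_defect_adj[OF V_isometry[OF j(1)]]
    note am = linear_opD(1)[OF la] and cm = linear_opD(1)[OF lin]
    note D = defect_adj_mem[OF V_isometry[OF j(1)]] adj_defect[OF V_isometry[OF j(1)]]
      defect_adj_hnorm_sq[OF V_isometry[OF j(1)]]
    note upd = defect_sum_upd_mem[OF js j] hnorm_defect_sum_upd[OF js j]
    have "linear_op H (defect_sum (set (j # js))) (defect_chain (j # js))"
      unfolding linear_op_def using upd D am cm
      by (auto simp: linear_opD(2,3)[OF lin] linear_opD(2,3)[OF la] linear_opD(2,3)[OF ld] scaleC_fun_def fun_eq_iff)
    moreover have "(hnorm (defect_sum (set (j # js))) (defect_chain (j # js) h))\<^sup>2 =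
        (hnorm H h)\<^sup>2 - (hnorm H (?adj (j # js) h))\<^sup>2" if h: "h \<in> carr H" for h
      using upd(2)[OF D(1)[OF am[OF h]] D(2)[OF am[OF h]] cm[OF h]] D(3)[OF am[OF h]] norm[OF h] by simp
    moreover have "x \<in> defect_chain (j # js) ` carr H" if x: "x \<in> carr (defect_sum (set (j # js)))" for x
    proof -
      let ?C = "oprod V (rev js)"
      have C: "isometry_op H H ?C" by (rule isometry_oprod) (use js in auto)
      have xj: "x j \<in> carr H" "adj H H (V j) (x j) = 0" using x Cons.prems(1) by (auto simp: carr_defect_sum)
      have "x(j := 0) \<in> carr (defect_sum (set js))"
        using x Cons.prems(1) js j(2) by (auto simp: carr_defect_sum)
      then obtain g where g: "g \<in> carr H" "defect_chain js g = x(j := 0)" using onto by (metis imageE subsetD)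
      \<comment> \<open>The preimage \<open>g\<close> has the right later components;
        \<open>z\<close> is the error in the argument of the component at \<open>j\<close>. Adding
        \<open>C z\<close> corrects it, since the adjoint chain maps \<open>C z\<close> to
        \<open>z\<close>.\<close>
      define z where "z = x j - ?adj js g"
      have z: "z \<in> carr H" using g xj by (simp add: z_def mem am)
      have Cz: "?C z \<in> carr H" by (rule iso_mem[OF C z])
      have aC: "?adj js (?C z) = z" using adj_cancel[OF C z] by (simp add: oprod_adj[OF js Cz])
      \<comment> \<open>The squared norm is
        \<open>\<parallel>C z\<parallel>^2 - \<parallel>z\<parallel>^2\<close>, so the correction
        leaves the later components alone.\<close>
      have "hnorm (defect_sum (set js)) (defect_chain js (?C z)) = 0"
        using norm[OF Cz] iso_norm[OF C z] by (simp add: aC)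
      hence "defect_chain js (?C z) = 0"
        using hilbert_space.hnorm_eq_0[OF hilbert_space_defect_sum[OF js] cm[OF Cz]] by simp
      hence "defect_chain js (g + ?C z) = x(j := 0)" by (simp add: linear_opD(2)[OF lin] g Cz)
      moreover have "?adj js (g + ?C z) = x j"
        by (simp add: linear_opD(2)[OF la] g Cz aC) (simp add: z_def)
      ultimately have "defect_chain (j # js) (g + ?C z) = x"
        by (simp add: defect_adj_id[OF V_isometry[OF j(1)] xj])
      thus ?thesis using g Cz by (metis add_mem image_eqI)
    qed
    ultimately show ?case by blast
  qed
  thus "linear_op H (defect_sum (set js)) (defect_chain js)"
    "\<And>h. h \<in> carr H \<Longrightarrow> (hnorm (defect_sum (set js)) (defect_chain js h))\<^sup>2 =
      (hnorm H h)\<^sup>2 - (hnorm H (adj H H (oprod V js) h))\<^sup>2"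
    "defect_chain js ` carr H = carr (defect_sum (set js))"
    by (auto simp: hnorm_oprod_adj[OF assms(1)] linear_op_def)
qed

end

section \<open>Intertwining relations\<close>

lemma bounded_op_comp:
  assumes B: "hilbert_space B" and TS: "bounded_op A B T" "bounded_op B C S"
  shows "bounded_op A C (S \<circ> T)"
proof -
  obtain M N where M: "\<And>x. x \<in> carr A \<Longrightarrow> hnorm B (T x) \<le> M * hnorm A x"
    and N: "\<And>x. x \<in> carr B \<Longrightarrow> hnorm C (S x) \<le> N * hnorm B x"
    and lin: "linear_op A B T" "linear_op B C S"
    using TS by (auto simp: bounded_op_def)
  show ?thesis
  proof (rule bounded_opI[where M = "\<bar>N\<bar> * M"])
    show "linear_op A C (S \<circ> T)" using linear_op_comp[OF lin] by (simp add: comp_def)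
    fix x assume x: "x \<in> carr A"
    have Tx: "T x \<in> carr B" by (rule linear_opD(1)[OF lin(1) x])
    have "hnorm C (S (T x)) \<le> \<bar>N\<bar> * hnorm B (T x)"
      using N[OF Tx] mult_right_mono[OF abs_ge_self hilbert_space.hnorm_nonneg[OF B Tx], of N] by linarith
    also have "\<dots> \<le> \<bar>N\<bar> * (M * hnorm A x)" by (rule mult_left_mono[OF M[OF x]]) simp
    finally show "hnorm C ((S \<circ> T) x) \<le> \<bar>N\<bar> * M * hnorm A x" by (simp add: mult.assoc)
  qed
qed

lemma weighted_shift_linear:
  assumes "hilbert_space A" "linear_op A B X" "\<And>m. a m \<in> carr A"
  shows "X (weighted_shift k w a n) = weighted_shift k w (\<lambda>m. X (a m)) n"
  using assms by (simp add: weighted_shift_def linear_op_zero linear_opD(3))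

context hilbert_space
begin

lemma bounded_op_compl:
  assumes "bounded_op H H P"
  shows "bounded_op H H (compl_op P)"
proof -
  obtain M where M: "\<And>x. x \<in> carr H \<Longrightarrow> hnorm H (P x) \<le> M * hnorm H x" and lin: "linear_op H H P"
    using assms by (auto simp: bounded_op_def)
  note Pm = linear_opD(1)[OF lin]
  show ?thesis
  proof (rule bounded_opI[where M = "1 + M"])
    show "linear_op H H (compl_op P)"
      by (simp add: linear_op_def compl_op_def mem Pm linear_opD(2,3)[OF lin] scaleC_diff_right)
    show "hnorm H (compl_op P x) \<le> (1 + M) * hnorm H x" if "x \<in> carr H" for x
      using hnorm_triangle_diff[OF that Pm[OF that]] M[OF that] by (simp add: compl_op_def algebra_simps)
  qed
qed

text \<open>\<open>X T^n = c^n T^n X\<close>, and the scalar can be absorbed into the argument of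
  \<open>T^n\<close>, so \<open>X\<close> preserves membership in each range.\<close>

lemma wold_core_invariant:
  assumes T: "isometry_op H H T" and X: "isometry_op H H X"
    and comm: "\<And>h. h \<in> carr H \<Longrightarrow> X (T h) = c *\<^sub>C T (X h)"
  shows "X ` wold_core T \<subseteq> wold_core T"
proof -
  have pow: "X ((T ^^ n) v) = c ^ n *\<^sub>C (T ^^ n) (X v)" if v: "v \<in> carr H" for n v
  proof (induction n)
    case 0
    show ?case by (simp add: scaleC_one)
  next
    case (Suc n)
    show ?case
      using comm[OF funpow_mem[OF T v, of n]] Suc iso_scale[OF T funpow_mem[OF T iso_mem[OF X v]], of "c ^ n" n]
      by (simp add: scaleC_scaleC)
  qed
  show ?thesis
  proof safe
    fix u assume u: "u \<in> wold_core T"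
    have "X u \<in> (T ^^ n) ` carr H" for n
    proof -
      obtain v where v: "v \<in> carr H" "u = (T ^^ n) v" using u by (rule wold_coreE[OF T])
      have "X u = (T ^^ n) (c ^ n *\<^sub>C X v)"
        using pow[OF v(1)] v by (simp add: iso_scale[OF isometry_op_funpow[OF T] iso_mem[OF X v(1)]])
      thus ?thesis using v by (auto simp: scale_mem iso_mem[OF X])
    qed
    thus "X u \<in> wold_core T" by (simp add: wold_core_def[OF T])
  qed
qed

lemma wold_core_image:
  assumes T: "isometry_op H H T"
  shows "T ` wold_core T = wold_core T"
proof
  show "T ` wold_core T \<subseteq> wold_core T"
    by (rule wold_core_invariant[OF T T, of 1]) (simp add: scaleC_one)
  show "wold_core T \<subseteq> T ` wold_core T"
  proof
    fix u assume u: "u \<in> wold_core T"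
    obtain v where v: "v \<in> carr H" "u = (T ^^ 1) v" using u by (rule wold_coreE[OF T])
    have "v \<in> (T ^^ n) ` carr H" for n
    proof -
      \<comment> \<open>By injectivity of \<open>T\<close>, writing \<open>u\<close> with one more
        power of \<open>T\<close> exhibits its preimage \<open>v\<close> as
        \<open>T^n w\<close>.\<close>
      obtain w where w: "w \<in> carr H" "u = (T ^^ Suc n) w" using u by (rule wold_coreE[OF T])
      have "v = (T ^^ n) w"
        using adj_cancel[OF T v(1)] adj_cancel[OF T funpow_mem[OF T w(1), of n]] v w by simp
      thus ?thesis using w by blast
    qed
    thus "u \<in> T ` wold_core T" using v by (auto simp: wold_core_def[OF T])
  qed
qed

text \<open>The factor \<open>c ^ n\<close> is invertible and can be moved into the argument, so the
  ranges of the powers agree.\<close>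

lemma wold_core_scaled:
  assumes T: "isometry_op H H T" and T': "isometry_op H H T'" and c: "cmod c = 1"
    and eq: "\<And>h. h \<in> carr H \<Longrightarrow> T' h = c *\<^sub>C T h"
  shows "wold_core T' = wold_core T"
proof -
  have pow: "(T' ^^ n) v = (T ^^ n) (c ^ n *\<^sub>C v)" if v: "v \<in> carr H" for n v
  proof (induction n)
    case 0
    show ?case by (simp add: scaleC_one)
  next
    case (Suc n)
    have m: "(T ^^ n) (c ^ n *\<^sub>C v) \<in> carr H" by (rule funpow_mem[OF T scale_mem[OF v]])
    have "(T' ^^ Suc n) v = c *\<^sub>C (T ^^ Suc n) (c ^ n *\<^sub>C v)"
      using Suc by (simp add: eq m)
    also have "\<dots> = (T ^^ Suc n) (c *\<^sub>C c ^ n *\<^sub>C v)"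
      using iso_scale[OF isometry_op_funpow[OF T] scale_mem[OF v], of "Suc n" c "c ^ n"] by simp
    finally show ?case by (simp add: scaleC_scaleC)
  qed
  have "c \<noteq> 0" using c by auto
  hence "v = c ^ n *\<^sub>C inverse (c ^ n) *\<^sub>C v" for n and v :: 'a by (simp add: scaleC_scaleC scaleC_one)
  hence "(T' ^^ n) ` carr H = (T ^^ n) ` carr H" for n
    using pow scale_mem by (intro equalityI subsetI) (auto, metis image_eqI)
  thus ?thesis by (simp add: wold_core_def[OF T] wold_core_def[OF T'])
qed

text \<open>Reduces an operator identity in the model to the identity \<open>coeff\<close> between
  Taylor coefficients; the core component is handled by
  \<open>wold_core_projection_intertwines\<close>.\<close>

lemma unitary_equiv_via_tensor_model:
  fixes F :: "'f::complex_vector hilb"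
  assumes T: "isometry_op H H T" and F: "hilbert_space F"
    and model: "wold_model T F \<Gamma> \<Phi>"
    and X: "isometry_op H H X" "X ` wold_core T = wold_core T"
    and Y: "bounded_op F F Y" "bounded_op F F Z"
    and shift: "unimodular_shift R k v" "unimodular_shift S l w"
    and coeff: "\<And>h n. h \<in> carr H \<Longrightarrow> \<Gamma> ((adj H H T ^^ n) (X h)) =
      weighted_shift k v (\<lambda>m. Y (\<Gamma> ((adj H H T ^^ m) h))) n + weighted_shift l w (\<lambda>m. Z (\<Gamma> ((adj H H T ^^ m) h))) n"
  shows "unitary_equiv_via \<Phi> H X (oplus (hardy F) (sub_hilb H (wold_core T)))
    (map_prod (tensor_op F R Y + tensor_op F S Z) X)"
  unfolding unitary_equiv_via_def
proof (intro conjI ballI)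
  note \<Phi> = model[unfolded wold_model_def[OF T]]
  show "unitary_op H (oplus (hardy F) (sub_hilb H (wold_core T))) \<Phi>" using \<Phi> by blast
  interpret F: hilbert_space F by fact
  fix h assume h: "h \<in> carr H"
  have Xh: "X h \<in> carr H" by (rule iso_mem[OF X(1) h])
  have taylor: "has_taylor F (fst (\<Phi> h)) (\<lambda>n. \<Gamma> ((adj H H T ^^ n) h))"
    and core: "snd (\<Phi> h) \<in> wold_core T" "\<And>u. u \<in> wold_core T \<Longrightarrow> ip H (h - snd (\<Phi> h)) u = 0"
    if "h \<in> carr H" for h using \<Phi> that by blast+
  have t: "taylor F (fst (\<Phi> h)) = (\<lambda>n. \<Gamma> ((adj H H T ^^ n) h))" and fm: "fst (\<Phi> h) \<in> carr (hardy F)"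
    using taylor[OF h] by (auto intro: F.taylor_eq F.hardy_memI)
  have "has_taylor F (tensor_op F R Y (fst (\<Phi> h)) + tensor_op F S Z (fst (\<Phi> h))) (\<lambda>n. \<Gamma> ((adj H H T ^^ n) (X h)))"
    using F.has_taylor_add[OF F.has_taylor_tensor_op[OF Y(1) shift(1) fm] F.has_taylor_tensor_op[OF Y(2) shift(2) fm]]
    by (simp add: t coeff[OF h])
  hence "fst (\<Phi> (X h)) = (tensor_op F R Y + tensor_op F S Z) (fst (\<Phi> h))"
    using F.has_taylor_unique_fun[OF taylor[OF Xh]] by simp
  moreover have "snd (\<Phi> (X h)) = X (snd (\<Phi> h))"
    by (rule wold_core_projection_intertwines[OF T X h core[OF h] core[OF Xh]])
  ultimately show "\<Phi> (X h) = map_prod (tensor_op F R Y + tensor_op F S Z) X (\<Phi> h)"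
    by (cases "\<Phi> h", cases "\<Phi> (X h)") simp
qed

section \<open>Two isometries that commute up to a unimodular scalar\<close>

context
  fixes A B :: "'a \<Rightarrow> 'a" and r :: complex
  assumes A: "isometry_op H H A" and B: "isometry_op H H B" and r: "cmod r = 1"
    and AB: "\<forall>h\<in>carr H. A (B h) = r *\<^sub>C B (A h)"
begin

abbreviation (input) pair_adj :: "nat \<Rightarrow> 'a \<Rightarrow> 'a"
  where "pair_adj n \<equiv> adj H H (\<lambda>h. A (B h)) ^^ n"

lemma pair_isometry: "isometry_op H H (\<lambda>h. A (B h))"
  by (rule isometry_op_comp[OF B A])

lemmas pair_adj_mem = adj_funpow_mem[OF pair_isometry]
lemmas pair_adj_scale = linear_opD(3)[OF linear_op_adj_funpow[OF pair_isometry]]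

lemma adj_pair: "h \<in> carr H \<Longrightarrow> adj H H (\<lambda>h. A (B h)) h = adj H H B (adj H H A h)"
  by (rule adj_comp[OF A B]) auto

lemma cnj_r: "cnj r * r = 1" "r * cnj r = 1"
  using r complex_norm_square[of r] by (simp_all add: mult.commute)

text \<open>Taking adjoints conjugates the scalar and reverses both products; the two effects
  compensate, so the adjoints satisfy the relation with the same \<open>r\<close>.\<close>

lemma adj_AB: "h \<in> carr H \<Longrightarrow> adj H H A (adj H H B h) = r *\<^sub>C adj H H B (adj H H A h)"
  using adj_scaled[OF isometry_op_comp[OF A B], of "\<lambda>h. A (B h)" r h] AB
    adj_comp[OF B A, of "\<lambda>h. B (A h)" h]
  by (simp add: adj_pair scaleC_scaleC cnj_r scaleC_one)

lemma pair_adj_A: "h \<in> carr H \<Longrightarrow> pair_adj (Suc n) (A h) = pair_adj n (adj H H B h)"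
  by (simp add: funpow_swap1 adj_pair iso_mem[OF A] adj_cancel[OF A])

lemma adj_BA: "h \<in> carr H \<Longrightarrow> adj H H B (adj H H A h) = cnj r *\<^sub>C adj H H A (adj H H B h)"
  by (simp add: adj_AB scaleC_scaleC cnj_r scaleC_one)

lemma pair_adj_B: "h \<in> carr H \<Longrightarrow> pair_adj (Suc n) (B h) = cnj r *\<^sub>C pair_adj n (adj H H A h)"
  by (simp add: funpow_swap1 adj_pair adj_BA iso_mem[OF B] adj_cancel[OF B] pair_adj_scale adj_mem[OF A])

lemma pair_adj_adj_B: "h \<in> carr H \<Longrightarrow> pair_adj n (adj H H B h) = r ^ n *\<^sub>C adj H H B (pair_adj n h)"
proof (induction n)
  case 0
  show ?case by (simp add: scaleC_one)
next
  case (Suc n)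
  have m: "pair_adj n h \<in> carr H" by (rule pair_adj_mem[OF Suc.prems])
  have "pair_adj (Suc n) (adj H H B h) = r ^ n *\<^sub>C adj H H (\<lambda>h. A (B h)) (adj H H B (pair_adj n h))"
    using Suc by (simp add: adj_scale[OF pair_isometry] adj_mem[OF B] m)
  also have "\<dots> = r ^ n *\<^sub>C r *\<^sub>C adj H H B (pair_adj (Suc n) h)"
    using m by (simp add: adj_pair adj_AB adj_mem[OF A] adj_mem[OF B] adj_scale[OF B])
  finally show ?case by (simp add: scaleC_scaleC mult.commute)
qed

lemma pair_adj_adj_A: "h \<in> carr H \<Longrightarrow> pair_adj n (adj H H A h) = cnj r ^ n *\<^sub>C adj H H A (pair_adj n h)"
proof (induction n)
  case 0
  show ?case by (simp add: scaleC_one)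
next
  case (Suc n)
  have m: "pair_adj n h \<in> carr H" by (rule pair_adj_mem[OF Suc.prems])
  have "pair_adj (Suc n) (adj H H A h) = cnj r ^ n *\<^sub>C adj H H (\<lambda>h. A (B h)) (adj H H A (pair_adj n h))"
    using Suc by (simp add: adj_scale[OF pair_isometry] adj_mem[OF A] m)
  also have "\<dots> = cnj r ^ n *\<^sub>C cnj r *\<^sub>C adj H H A (pair_adj (Suc n) h)"
    using m by (simp add: adj_pair adj_mem[OF A] adj_BA[OF adj_mem[OF A m]])
  finally show ?case by (simp add: scaleC_scaleC mult.commute)
qed

end

end

section \<open>The explicit models\<close>

context q_commuting_isometries
begin

declare One_nat_def [simp del] upt_Suc [simp del]

section \<open>Coefficient formulas and unitaries for a fixed index\<close>

context
  fixes i :: nat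
  assumes i: "i \<in> {1..d}"
begin

abbreviation (input) A :: "'a \<Rightarrow> 'a" where "A \<equiv> V i"
abbreviation (input) B :: "'a \<Rightarrow> 'a" where "B \<equiv> omit_prod d V i"
abbreviation (input) F :: "(nat \<Rightarrow> 'a) hilb" where "F \<equiv> defect_sum {1..d}"
abbreviation (input) T_adj :: "nat \<Rightarrow> 'a \<Rightarrow> 'a" where "T_adj n \<equiv> adj H H (\<lambda>h. V i (omit_prod d V i h)) ^^ n"

text \<open>\<open>glue x y\<close> is \<open>D\<^bsub>A*\<^esub> x \<oplus> \<Delta>\<^sub>i D\<^bsub>B*\<^esub> y\<close>.\<close>

definition glue :: "'a \<Rightarrow> 'a \<Rightarrow> nat \<Rightarrow> 'a"
  where "glue x y = (defect_chain (omitted i) y)(i := defect_adj H A x)"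

definition coord_proj :: "(nat \<Rightarrow> 'a) \<Rightarrow> nat \<Rightarrow> 'a"
  where "coord_proj x = (\<lambda>j. if j = i then x i else 0)"

lemmas V_i_isometry = V_isometry[OF i]
lemmas omit_isometry = isometry_omit_prod[of i]

lemma V_omit_commute: "\<forall>h\<in>carr H. A (B h) = qprod d q i *\<^sub>C B (A h)"
  using omit_prod_commute[OF i] by blast

lemmas qprod_norm = cmod_qprod[OF i]
lemmas adj_AB_i = adj_AB[where A = "V i" and B = "omit_prod d V i" and r = "qprod d q i",
    OF V_i_isometry omit_isometry qprod_norm V_omit_commute]
lemmas adj_pair_i = adj_pair[where A = "V i" and B = "omit_prod d V i" and r = "qprod d q i",
    OF V_i_isometry omit_isometry qprod_norm V_omit_commute]
lemmas pair_adj_mem_i = pair_adj_mem[where A = "V i" and B = "omit_prod d V i" and r = "qprod d q i",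
    OF V_i_isometry omit_isometry qprod_norm V_omit_commute]
lemmas pair_adj_A_i = pair_adj_A[where A = "V i" and B = "omit_prod d V i" and r = "qprod d q i",
    OF V_i_isometry omit_isometry qprod_norm V_omit_commute]
lemmas pair_adj_B_i = pair_adj_B[where A = "V i" and B = "omit_prod d V i" and r = "qprod d q i",
    OF V_i_isometry omit_isometry qprod_norm V_omit_commute]
lemmas pair_adj_adj_A_i = pair_adj_adj_A[where A = "V i" and B = "omit_prod d V i" and r = "qprod d q i",
    OF V_i_isometry omit_isometry qprod_norm V_omit_commute]
lemmas pair_adj_adj_B_i = pair_adj_adj_B[where A = "V i" and B = "omit_prod d V i" and r = "qprod d q i",
    OF V_i_isometry omit_isometry qprod_norm V_omit_commute]

lemma hilbert_space_F: "hilbert_space F"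
  by (rule hilbert_space_defect_sum) simp

lemma omitted_sub: "set (omitted i) \<subseteq> {1..d}" "distinct (omitted i)" "i \<notin> set (omitted i)"
  by auto

lemmas chain = linear_op_defect_chain[OF omitted_sub(1,2)] hnorm_defect_chain[OF omitted_sub(1,2), folded omit_prod_def]
  defect_chain_onto[OF omitted_sub(1,2)]

lemma insert_omitted: "insert i (set (omitted i)) = {1..d}"
  using i by (auto simp: set_omitted)

lemma chain_at_i: "defect_chain (omitted i) h i = 0"
  by (simp add: defect_chain_filter_upt)

text \<open>The norm identity gives
  \<open>\<parallel>B h\<parallel>^2 - \<parallel>h\<parallel>^2 = 0\<close>.\<close>

lemma chain_B: "h \<in> carr H \<Longrightarrow> defect_chain (omitted i) (B h) = 0"
  using chain(2)[OF iso_mem[OF omit_isometry], of h] linear_opD(1)[OF chain(1) iso_mem[OF omit_isometry], of h]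
    hilbert_space.hnorm_eq_0[OF hilbert_space_defect_sum[OF omitted_sub(1)]]
  by (simp add: adj_cancel[OF omit_isometry] iso_norm[OF omit_isometry])

lemma glue_mem: "x \<in> carr H \<Longrightarrow> y \<in> carr H \<Longrightarrow> glue x y \<in> carr F"
  using defect_sum_upd_mem[OF omitted_sub(1) i omitted_sub(3) defect_adj_mem[OF V_i_isometry] adj_defect[OF V_i_isometry] linear_opD(1)[OF chain(1)]]
  unfolding insert_omitted glue_def by blast

lemma hnorm_glue:
  assumes "x \<in> carr H" "y \<in> carr H"
  shows "(hnorm F (glue x y))\<^sup>2 = ((hnorm H x)\<^sup>2 - (hnorm H (adj H H A x))\<^sup>2) + ((hnorm H y)\<^sup>2 - (hnorm H (adj H H B y))\<^sup>2)"
  using hnorm_defect_sum_upd[OF omitted_sub(1) i omitted_sub(3) defect_adj_mem[OF V_i_isometry assms(1)] adj_defect[OF V_i_isometry assms(1)]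
      linear_opD(1)[OF chain(1) assms(2)]]
  unfolding insert_omitted glue_def chain(2)[OF assms(2)] defect_adj_hnorm_sq[OF V_i_isometry assms(1)] .

lemma glue_add:
  "x \<in> carr H \<Longrightarrow> y \<in> carr H \<Longrightarrow> x' \<in> carr H \<Longrightarrow> y' \<in> carr H \<Longrightarrow> glue (x + x') (y + y') = glue x y + glue x' y'"
  by (simp add: glue_def fun_eq_iff linear_opD(2)[OF chain(1)] linear_opD(2)[OF linear_op_defect_adj[OF V_i_isometry]])

lemma glue_scale: "x \<in> carr H \<Longrightarrow> y \<in> carr H \<Longrightarrow> glue (c *\<^sub>C x) (c *\<^sub>C y) = c *\<^sub>C glue x y"
  by (simp add: glue_def fun_eq_iff linear_opD(3)[OF chain(1)] linear_opD(3)[OF linear_op_defect_adj[OF V_i_isometry]] scaleC_fun_def)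

text \<open>The component \<open>x i\<close> is its own preimage, because the defect projection
  fixes the kernel of \<open>A*\<close>.\<close>

lemma glue_surj:
  assumes "x \<in> carr F"
  obtains y where "y \<in> carr H" "x i \<in> carr H" "adj H H A (x i) = 0" "x = glue (x i) y"
proof -
  have x: "x i \<in> carr H" "adj H H A (x i) = 0" using assms i by (auto simp: carr_defect_sum)
  have "x(i := 0) \<in> carr (defect_sum (set (omitted i)))"
    using assms i unfolding set_omitted carr_defect_sum[OF Diff_subset] carr_defect_sum[OF subset_refl] by auto
  then obtain y where "y \<in> carr H" "defect_chain (omitted i) y = x(i := 0)" using chain(3) by (metis imageE)
  hence "x = glue (x i) y" by (simp add: glue_def defect_adj_id[OF V_i_isometry x])
  thus ?thesis using that x \<open>y \<in> carr H\<close> by blast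
qed

lemma coord_proj_glue: "y \<in> carr H \<Longrightarrow> coord_proj (glue x y) = glue x 0"
  using linear_op_zero[OF hilbert_space_axioms chain(1)] by (auto simp: glue_def coord_proj_def fun_eq_iff)

lemma compl_coord_proj_glue: "compl_op coord_proj (glue x y) = glue 0 y"
  using linear_op_zero[OF hilbert_space_axioms linear_op_defect_adj[OF V_i_isometry]]
  by (auto simp: glue_def coord_proj_def compl_op_def fun_eq_iff chain_at_i)

lemma is_projection_coord_proj: "is_projection F coord_proj"
  unfolding is_projection_def
proof (intro conjI ballI)
  have lin: "linear_op F F coord_proj"
    using i by (auto simp: linear_op_def coord_proj_def carr_defect_sum fun_eq_iff scaleC_fun_def mem adj_zero[OF V_isometry])
  have "hnorm F (coord_proj x) \<le> 1 * hnorm F x" if x: "x \<in> carr F" for x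
    unfolding mult_1
  proof (rule power2_le_imp_le)
    show "(hnorm F (coord_proj x))\<^sup>2 \<le> (hnorm F x)\<^sup>2"
      using x linear_opD(1)[OF lin x]
      by (simp add: hnorm_defect_sum) (rule sum_mono, auto simp: coord_proj_def hnorm_zero)
    show "0 \<le> hnorm F x" by (rule hilbert_space.hnorm_nonneg[OF hilbert_space_F x])
  qed
  thus "bounded_op F F coord_proj" by (rule bounded_opI[OF lin])
  show "coord_proj (coord_proj x) = coord_proj x" for x by (auto simp: coord_proj_def)
  show "ip F (coord_proj x) y = ip F x (coord_proj y)" if x: "x \<in> carr F" and y: "y \<in> carr F" for x y
  proof -
    have "ip H (coord_proj x j) (y j) = ip H (x j) (coord_proj y j)" if "j \<in> {1..d}" for j
      using that x y by (auto simp: coord_proj_def carr_defect_sum ip_zero ip_zero_right)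
    hence "(\<Sum>j\<in>{1..d}. ip H (coord_proj x j) (y j)) = (\<Sum>j\<in>{1..d}. ip H (x j) (coord_proj y j))"
      by (rule sum.cong[OF refl])
    thus ?thesis by (simp add: dsum_def defect_space_def)
  qed
qed

definition \<Gamma>\<^sub>1 :: "'a \<Rightarrow> nat \<Rightarrow> 'a" where "\<Gamma>\<^sub>1 h = glue h (adj H H A h)"
definition \<Gamma>\<^sub>2 :: "'a \<Rightarrow> nat \<Rightarrow> 'a" where "\<Gamma>\<^sub>2 h = glue (adj H H B h) h"

lemma linear_\<Gamma>: "linear_op H F \<Gamma>\<^sub>1" "linear_op H F \<Gamma>\<^sub>2"
  by (simp_all add: linear_op_def \<Gamma>\<^sub>1_def \<Gamma>\<^sub>2_def glue_mem adj_mem[OF V_i_isometry] adj_mem[OF omit_isometry] adj_add[OF V_i_isometry] adj_add[OF omit_isometry]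
      adj_scale[OF V_i_isometry] adj_scale[OF omit_isometry] glue_add glue_scale)

text \<open>The two summands of \<open>hnorm_glue\<close> telescope through \<open>A* h\<close> or
  \<open>B* h\<close>. The final terms contain \<open>B* A* h\<close> and \<open>A* B* h\<close>,
  which differ by a unimodular factor.\<close>

lemma hnorm_\<Gamma>:
  assumes h: "h \<in> carr H"
  shows "(hnorm F (\<Gamma>\<^sub>1 h))\<^sup>2 = (hnorm H h)\<^sup>2 - (hnorm H (adj H H (\<lambda>h. A (B h)) h))\<^sup>2"
    and "(hnorm F (\<Gamma>\<^sub>2 h))\<^sup>2 = (hnorm H h)\<^sup>2 - (hnorm H (adj H H (\<lambda>h. A (B h)) h))\<^sup>2"
proof -
  have "hnorm H (adj H H A (adj H H B h)) = hnorm H (adj H H B (adj H H A h))"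
    using qprod_norm by (simp add: adj_AB_i h hnorm_scale adj_mem[OF V_i_isometry] adj_mem[OF omit_isometry])
  thus "(hnorm F (\<Gamma>\<^sub>1 h))\<^sup>2 = (hnorm H h)\<^sup>2 - (hnorm H (adj H H (\<lambda>h. A (B h)) h))\<^sup>2"
    "(hnorm F (\<Gamma>\<^sub>2 h))\<^sup>2 = (hnorm H h)\<^sup>2 - (hnorm H (adj H H (\<lambda>h. A (B h)) h))\<^sup>2"
    by (simp_all add: \<Gamma>\<^sub>1_def \<Gamma>\<^sub>2_def hnorm_glue h adj_mem[OF V_i_isometry] adj_mem[OF omit_isometry] adj_pair_i)
qed

lemma \<Gamma>_onto: "\<Gamma>\<^sub>1 ` carr H = carr F" "\<Gamma>\<^sub>2 ` carr H = carr F"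
proof -
  have "x \<in> \<Gamma>\<^sub>1 ` carr H \<and> x \<in> \<Gamma>\<^sub>2 ` carr H" if x: "x \<in> carr F" for x
  proof -
    obtain y where y: "y \<in> carr H" "x i \<in> carr H" "adj H H A (x i) = 0" "x = glue (x i) y"
      using glue_surj[OF x] by metis
    note m = iso_mem[OF V_i_isometry] iso_mem[OF omit_isometry] adj_mem[OF V_i_isometry] adj_mem[OF omit_isometry] mem y(1,2)
    \<comment> \<open>The summand \<open>A y\<close> sets \<open>A*\<close> of the sum to
      \<open>y\<close> and is invisible to the defect operator of \<open>A\<close>.\<close>
    have "\<Gamma>\<^sub>1 (A y + x i) = x"
    proof -
      have "adj H H A (A y + x i) = y" by (simp add: adj_add[OF V_i_isometry] m y(3) adj_cancel[OF V_i_isometry])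
      moreover have "defect_adj H A (A y + x i) = defect_adj H A (x i)"
        by (simp add: linear_opD(2)[OF linear_op_defect_adj[OF V_i_isometry]] m defect_adj_range_zero[OF V_i_isometry])
      ultimately show ?thesis by (subst y(4)) (simp add: \<Gamma>\<^sub>1_def glue_def)
    qed
    moreover have "\<Gamma>\<^sub>2 (y + B (x i - adj H H B y)) = x"
    proof -
      have "adj H H B (y + B (x i - adj H H B y)) = x i" by (simp add: adj_add[OF omit_isometry] m adj_cancel[OF omit_isometry])
      moreover have "defect_chain (omitted i) (y + B (x i - adj H H B y)) = defect_chain (omitted i) y"
        by (simp add: linear_opD(2)[OF chain(1)] m chain_B)
      ultimately show ?thesis by (subst y(4)) (simp add: \<Gamma>\<^sub>2_def glue_def)
    qed
    ultimately show ?thesis using m by (metis image_eqI)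
  qed
  thus "\<Gamma>\<^sub>1 ` carr H = carr F" "\<Gamma>\<^sub>2 ` carr H = carr F" using linear_opD(1)[OF linear_\<Gamma>(1)] linear_opD(1)[OF linear_\<Gamma>(2)] by blast+
qed

text \<open>With \<open>g = T*^k h\<close> one has
  \<open>\<Gamma>\<^sub>1 (B* g) = glue (B* g) (r T* g)\<close>. Its component at \<open>i\<close>
  is that of \<open>\<Gamma>\<^sub>2 g\<close>, its other components are those of
  \<open>r \<Gamma>\<^sub>2 (T* g)\<close>; hence the part under \<open>coord_proj\<close> is
  shifted by one degree and the other is not.\<close>

lemma coeff_A:
  assumes h: "h \<in> carr H"
  shows "\<Gamma>\<^sub>1 (T_adj n (A h)) =
    weighted_shift 0 (\<lambda>n. qprod d q i ^ n) (\<lambda>m. compl_op coord_proj (\<Gamma>\<^sub>2 (T_adj m h))) n +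
    weighted_shift 1 (\<lambda>n. qprod d q i ^ (n - 1)) (\<lambda>m. coord_proj (\<Gamma>\<^sub>2 (T_adj m h))) n"
proof -
  note m = adj_mem[OF V_i_isometry] adj_mem[OF omit_isometry] pair_adj_mem_i h mem
  show ?thesis
  proof (cases n)
    case 0
    \<comment> \<open>In degree zero there is no earlier coefficient to shift in, and the defect
      operator of \<open>A\<close> kills \<open>A h\<close>.\<close>
    have "glue (A h) h = glue 0 h"
      by (simp add: glue_def defect_adj_range_zero[OF V_i_isometry h] linear_op_zero[OF hilbert_space_axioms linear_op_defect_adj[OF V_i_isometry]])
    thus ?thesis using 0 by (simp add: weighted_shift_def \<Gamma>\<^sub>1_def \<Gamma>\<^sub>2_def adj_cancel[OF V_i_isometry h] compl_coord_proj_glue scaleC_one)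
  next
    case (Suc k)
    let ?g = "T_adj k h" and ?r = "qprod d q i"
    have g: "?g \<in> carr H" and Sg: "adj H H B (adj H H A ?g) = T_adj n h"
      using Suc by (simp_all add: m adj_pair_i)
    have "T_adj n (A h) = ?r ^ k *\<^sub>C adj H H B ?g"
      unfolding Suc pair_adj_A_i[OF h] by (rule pair_adj_adj_B_i[OF h])
    hence "\<Gamma>\<^sub>1 (T_adj n (A h)) = ?r ^ k *\<^sub>C \<Gamma>\<^sub>1 (adj H H B ?g)"
      by (simp add: linear_opD(3)[OF linear_\<Gamma>(1)] m)
    also have "\<Gamma>\<^sub>1 (adj H H B ?g) = glue (adj H H B ?g + 0) (0 + ?r *\<^sub>C T_adj n h)"
      by (simp add: \<Gamma>\<^sub>1_def adj_AB_i[OF g] Sg)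
    also have "\<dots> = glue (adj H H B ?g) 0 + ?r *\<^sub>C glue 0 (T_adj n h)"
      using glue_scale[of 0 "T_adj n h" ?r] by (subst glue_add) (simp_all add: m del: funpow.simps)
    finally show ?thesis using Suc
      by (simp add: weighted_shift_def \<Gamma>\<^sub>2_def coord_proj_glue compl_coord_proj_glue m scaleC_add_right scaleC_scaleC
          fun_eq_iff scaleC_fun_def add.commute mult.commute del: funpow.simps)
  qed
qed

text \<open>Mirror image of \<open>coeff_A\<close>:
  \<open>\<Gamma>\<^sub>2 (A* g) = glue (T* g) (A* g)\<close>, so now the components off
  \<open>i\<close> are the shifted ones.\<close>

lemma coeff_B:
  assumes h: "h \<in> carr H"
  shows "\<Gamma>\<^sub>2 (T_adj n (B h)) =
    weighted_shift 0 (\<lambda>n. cnj (qprod d q i) ^ n) (\<lambda>m. coord_proj (\<Gamma>\<^sub>1 (T_adj m h))) n +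
    weighted_shift 1 (\<lambda>n. cnj (qprod d q i) ^ n) (\<lambda>m. compl_op coord_proj (\<Gamma>\<^sub>1 (T_adj m h))) n"
proof -
  note m = adj_mem[OF V_i_isometry] adj_mem[OF omit_isometry] pair_adj_mem_i h mem
  show ?thesis
  proof (cases n)
    case 0
    have "glue h (B h) = glue h 0"
      by (simp add: glue_def chain_B[OF h] linear_op_zero[OF hilbert_space_axioms chain(1)])
    thus ?thesis using 0 by (simp add: weighted_shift_def \<Gamma>\<^sub>1_def \<Gamma>\<^sub>2_def adj_cancel[OF omit_isometry h] coord_proj_glue m scaleC_one)
  next
    case (Suc k)
    let ?g = "T_adj k h" and ?r = "cnj (qprod d q i)"
    have g: "?g \<in> carr H" and Sg: "adj H H B (adj H H A ?g) = T_adj n h"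
      using Suc by (simp_all add: m adj_pair_i)
    have "T_adj n (B h) = ?r ^ n *\<^sub>C adj H H A ?g"
      unfolding Suc pair_adj_B_i[OF h] pair_adj_adj_A_i[OF h] by (simp add: scaleC_scaleC)
    hence "\<Gamma>\<^sub>2 (T_adj n (B h)) = ?r ^ n *\<^sub>C \<Gamma>\<^sub>2 (adj H H A ?g)"
      by (simp add: linear_opD(3)[OF linear_\<Gamma>(2)] m)
    also have "\<Gamma>\<^sub>2 (adj H H A ?g) = glue (T_adj n h + 0) (0 + adj H H A ?g)"
      by (simp add: \<Gamma>\<^sub>2_def Sg)
    also have "\<dots> = glue (T_adj n h) 0 + glue 0 (adj H H A ?g)"
      by (subst glue_add) (simp_all add: m del: funpow.simps)
    finally show ?thesis using Suc
      by (simp add: weighted_shift_def \<Gamma>\<^sub>1_def coord_proj_glue compl_coord_proj_glue m scaleC_add_right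
          fun_eq_iff scaleC_fun_def del: funpow.simps)
  qed
qed

lemma isometry_V_omit: "isometry_op H H (\<lambda>h. A (B h))"
  by (rule isometry_op_comp[OF omit_isometry V_i_isometry])

lemma wold_core_full: "wold_core (oprod V [1..<Suc d]) = wold_core (\<lambda>h. A (B h))"
proof -
  obtain c where "cmod c = 1" "\<And>h. h \<in> carr H \<Longrightarrow> oprod V [1..<Suc d] h = c *\<^sub>C V i (omit_prod d V i h)"
    using full_product[OF i] by blast
  thus ?thesis by (intro wold_core_scaled[OF isometry_V_omit isometry_oprod]) auto
qed

text \<open>For \<open>T = A B\<close> the relations \<open>A T = r T A\<close> and
  \<open>B T = cnj r T B\<close> give the inclusions. Since \<open>T\<close> maps the core onto
  itself and \<open>T = A B = r B A\<close>, every core vector is also an image under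
  \<open>A\<close> and under \<open>B\<close>.\<close>

lemma image_wold_core:
  "A ` wold_core (\<lambda>h. A (B h)) = wold_core (\<lambda>h. A (B h))"
  "B ` wold_core (\<lambda>h. A (B h)) = wold_core (\<lambda>h. A (B h))"
proof -
  note A = V_i_isometry and B = omit_isometry
  let ?K = "wold_core (\<lambda>h. A (B h))" and ?r = "qprod d q i"
  have AB: "A (B h) = ?r *\<^sub>C B (A h)" if "h \<in> carr H" for h
    by (rule omit_prod_commute[OF i that])
  have rr: "cnj ?r * ?r = 1"
    using cmod_qprod[OF i] complex_norm_square[of ?r] by (simp add: mult.commute)
  have subA: "A ` ?K \<subseteq> ?K"
    by (rule wold_core_invariant[OF isometry_V_omit A, of ?r])
      (simp add: AB iso_mem[OF A] iso_mem[OF B] iso_scale[OF A])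
  have subB: "B ` ?K \<subseteq> ?K"
    by (rule wold_core_invariant[OF isometry_V_omit B, of "cnj ?r"])
      (simp add: AB iso_mem[OF A] iso_mem[OF B] scaleC_scaleC rr scaleC_one)
  have "u \<in> A ` ?K \<and> u \<in> B ` ?K" if u: "u \<in> ?K" for u
  proof -
    have "u \<in> (\<lambda>h. A (B h)) ` ?K" using u by (simp only: wold_core_image[OF isometry_V_omit])
    then obtain v where v: "v \<in> ?K" "u = A (B v)" by blast
    have vH: "v \<in> carr H" using v(1) wold_core_subset[OF isometry_V_omit] by blast
    have "?r *\<^sub>C v \<in> ?K" using hilbert_space.scale_mem[OF hilbert_space_wold_core[OF isometry_V_omit]] v(1) by simp
    moreover have "u = B (A (?r *\<^sub>C v))"
      using v(2) vH by (simp add: AB iso_mem[OF A] iso_scale[OF A] iso_scale[OF B])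
    ultimately show ?thesis using v subA subB by blast
  qed
  thus "A ` ?K = ?K" "B ` ?K = ?K" using subA subB by blast+
qed

lemma ex_explicit_unitaries:
  "\<exists>\<Delta> U. unitary_op (defect_space H B) (defect_sum ({1..d} - {i})) \<Delta> \<and>
    (\<forall>h\<in>carr H. \<Delta> (defect_adj H B h) = defect_chain (omitted i) h) \<and>
    unitary_op F F U \<and> (\<forall>h\<in>carr H. U (\<Gamma>\<^sub>1 h) = \<Gamma>\<^sub>2 h)"
proof -
  note B = isometry_omit_prod[of i]
  have "hnorm (defect_space H B) (defect_adj H B h) = hnorm (defect_sum ({1..d} - {i})) (defect_chain (omitted i) h)"
    if h: "h \<in> carr H" for h
  proof (rule power2_eq_imp_eq)
    show "(hnorm (defect_space H B) (defect_adj H B h))\<^sup>2 = (hnorm (defect_sum ({1..d} - {i})) (defect_chain (omitted i) h))\<^sup>2"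
      using chain(2)[OF h, unfolded set_omitted] by (simp add: defect_adj_hnorm_sq[OF B h] defect_space_simps[OF B])
    show "0 \<le> hnorm (defect_sum ({1..d} - {i})) (defect_chain (omitted i) h)"
      using linear_opD(1)[OF chain(1) h] unfolding set_omitted
      by (rule hilbert_space.hnorm_nonneg[OF hilbert_space_defect_sum[OF Diff_subset]])
    show "0 \<le> hnorm (defect_space H B) (defect_adj H B h)"
      using hnorm_nonneg[OF defect_adj_mem[OF B h]] by (simp add: defect_space_simps[OF B])
  qed
  moreover have "linear_op H (defect_space H B) (defect_adj H B)"
    using linear_op_defect_adj[OF B] adj_defect[OF B] by (simp add: linear_op_def carr_defect_space[OF B])
  moreover have "defect_adj H B ` carr H = carr (defect_space H B)"
    by (simp add: defect_adj_image[OF B] carr_defect_space[OF B])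
  ultimately have "\<exists>\<Delta>. unitary_op (defect_space H B) (defect_sum ({1..d} - {i})) \<Delta> \<and>
      (\<forall>h\<in>carr H. \<Delta> (defect_adj H B h) = defect_chain (omitted i) h)"
    using chain(1,3) unfolding set_omitted
    by (intro ex_unitary_of_equal_norms[OF hilbert_space_axioms hilbert_space_defect_space[OF B] hilbert_space_defect_sum[OF Diff_subset]])
  moreover have "hnorm F (\<Gamma>\<^sub>1 h) = hnorm F (\<Gamma>\<^sub>2 h)" if h: "h \<in> carr H" for h
  proof (rule power2_eq_imp_eq)
    show "(hnorm F (\<Gamma>\<^sub>1 h))\<^sup>2 = (hnorm F (\<Gamma>\<^sub>2 h))\<^sup>2" using hnorm_\<Gamma>[OF h] by simp
  qed (auto intro!: hilbert_space.hnorm_nonneg[OF hilbert_space_F] linear_opD(1)[OF linear_\<Gamma>(1) h] linear_opD(1)[OF linear_\<Gamma>(2) h])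
  hence "\<exists>U. unitary_op F F U \<and> (\<forall>h\<in>carr H. U (\<Gamma>\<^sub>1 h) = \<Gamma>\<^sub>2 h)"
    by (intro ex_unitary_of_equal_norms[OF hilbert_space_axioms hilbert_space_F hilbert_space_F]
        linear_\<Gamma> \<Gamma>_onto)
  ultimately show ?thesis by blast
qed

section \<open>The two models for a fixed index\<close>

context
  fixes U :: "(nat \<Rightarrow> 'a) \<Rightarrow> nat \<Rightarrow> 'a"
  assumes U: "unitary_op F F U" and U\<Gamma>: "\<forall>h\<in>carr H. U (\<Gamma>\<^sub>1 h) = \<Gamma>\<^sub>2 h"
begin

abbreviation (input) K :: "'a hilb" where "K \<equiv> sub_hilb H (wold_core (oprod V [1..<Suc d]))"
abbreviation (input) P :: "(nat \<Rightarrow> 'a) \<Rightarrow> nat \<Rightarrow> 'a" where "P \<equiv> coord_proj"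
abbreviation (input) U_adj :: "(nat \<Rightarrow> 'a) \<Rightarrow> nat \<Rightarrow> 'a" where "U_adj \<equiv> adj F F U"

lemmas bd_P = is_projection_coord_proj[unfolded is_projection_def, THEN conjunct1]
lemmas bd_P' = hilbert_space.bounded_op_compl[OF hilbert_space_F bd_P]
lemmas bd_U = isometry_op_bounded[OF unitary_opD(1)[OF U]]
lemmas uni_U_adj = unitary_op_adj[OF hilbert_space_F hilbert_space_F U]
lemmas bd_U_adj = isometry_op_bounded[OF unitary_opD(1)[OF uni_U_adj]]
lemmas bd_U_adj_adj = isometry_op_bounded[OF unitary_opD(1)[OF unitary_op_adj[OF hilbert_space_F hilbert_space_F uni_U_adj]]]
lemmas lin_U = isometry_opD(1)[OF unitary_opD(1)[OF U]]
lemmas lin_U_adj = isometry_opD(1)[OF unitary_opD(1)[OF uni_U_adj]]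
lemmas \<Gamma>_mem = linear_opD(1)[OF linear_\<Gamma>(1)] linear_opD(1)[OF linear_\<Gamma>(2)]

lemma P_mem: "x \<in> carr F \<Longrightarrow> P x \<in> carr F" "x \<in> carr F \<Longrightarrow> compl_op P x \<in> carr F"
  using bd_P bd_P' by (auto simp: bounded_op_def linear_op_def)

lemma U_adj_\<Gamma>: "h \<in> carr H \<Longrightarrow> U_adj (\<Gamma>\<^sub>2 h) = \<Gamma>\<^sub>1 h"
  using adj_isometry_cancel[OF hilbert_space_F hilbert_space_F unitary_opD(1)[OF U] \<Gamma>_mem(1)] U\<Gamma> by simp

lemmas shifts = unimodular_shift_rot[OF cmod_qprod[OF i]] unimodular_shift_mult_z_rot[OF cmod_qprod[OF i]]
  unimodular_shift_rot[of "cnj (qprod d q i)", unfolded complex_mod_cnj, OF cmod_qprod[OF i]]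
  unimodular_shift_rot_mult_z[of "cnj (qprod d q i)", unfolded complex_mod_cnj, OF cmod_qprod[OF i]]

lemma shift_sum:
  assumes X: "linear_op F F X" and a: "\<And>m. a m \<in> carr F" "\<And>m. b m \<in> carr F"
  shows "X (weighted_shift k v a n + weighted_shift l w b n) = weighted_shift k v (\<lambda>m. X (a m)) n + weighted_shift l w (\<lambda>m. X (b m)) n"
  using linear_opD(2)[OF X hilbert_space.weighted_shift_mem[OF hilbert_space_F a(1), where k = k and w = v and n = n] hilbert_space.weighted_shift_mem[OF hilbert_space_F a(2), where k = l and w = w and n = n]]
  by (simp add: weighted_shift_linear[OF hilbert_space_F X] a)

text \<open>The Wold decomposition is taken with \<open>\<Gamma>\<^sub>1\<close>. For
  \<open>A\<close> the values of \<open>\<Gamma>\<^sub>2\<close> in \<open>coeff_A\<close> are read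
  as \<open>U \<Gamma>\<^sub>1\<close>; for \<open>B\<close> the adjoint of \<open>U\<close> is
  applied to \<open>coeff_B\<close>. This explains on which side the projections stand.\<close>

lemma model_1:
  "\<exists>\<Phi>. unitary_equiv_via \<Phi> H A (oplus (hardy F) K)
      (map_prod (tensor_op F (rot (qprod d q i)) (compl_op P \<circ> U) + tensor_op F (mult_z \<circ> rot (qprod d q i)) (P \<circ> U)) A) \<and>
    unitary_equiv_via \<Phi> H B (oplus (hardy F) K)
      (map_prod (tensor_op F (rot (cnj (qprod d q i))) (U_adj \<circ> P)
        + tensor_op F (rot (cnj (qprod d q i)) \<circ> mult_z) (U_adj \<circ> compl_op P)) B)"
proof -
  obtain \<Phi> where \<Phi>: "wold_model (\<lambda>h. A (B h)) F (\<Gamma>\<^sub>1) \<Phi>"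
    using wold_decomposition[OF isometry_V_omit hilbert_space_F linear_\<Gamma>(1) \<Gamma>_onto(1)] hnorm_\<Gamma>(1) by blast
  note equiv = unitary_equiv_via_tensor_model[OF isometry_V_omit hilbert_space_F \<Phi>]
  show ?thesis unfolding wold_core_full
  proof (intro exI conjI)
    show "unitary_equiv_via \<Phi> H A (oplus (hardy F) (sub_hilb H (wold_core (\<lambda>h. A (B h)))))
      (map_prod (tensor_op F (rot (qprod d q i)) (compl_op P \<circ> U) + tensor_op F (mult_z \<circ> rot (qprod d q i)) (P \<circ> U)) A)"
    proof (rule equiv[OF V_isometry[OF i] image_wold_core(1) bounded_op_comp[OF hilbert_space_F bd_U bd_P'] bounded_op_comp[OF hilbert_space_F bd_U bd_P]
          shifts(1) shifts(2)])
      fix h n assume h: "h \<in> carr H"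
      thus "\<Gamma>\<^sub>1 ((adj H H (\<lambda>h. A (B h)) ^^ n) (A h)) =
        weighted_shift 0 (\<lambda>n. qprod d q i ^ n) (\<lambda>m. (compl_op P \<circ> U) (\<Gamma>\<^sub>1 ((adj H H (\<lambda>h. A (B h)) ^^ m) h))) n +
        weighted_shift 1 (\<lambda>n. qprod d q i ^ (n - 1)) (\<lambda>m. (P \<circ> U) (\<Gamma>\<^sub>1 ((adj H H (\<lambda>h. A (B h)) ^^ m) h))) n"
        using U\<Gamma> pair_adj_mem_i by (simp add: coeff_A)
    qed
    show "unitary_equiv_via \<Phi> H B (oplus (hardy F) (sub_hilb H (wold_core (\<lambda>h. A (B h)))))
      (map_prod (tensor_op F (rot (cnj (qprod d q i))) (U_adj \<circ> P)
        + tensor_op F (rot (cnj (qprod d q i)) \<circ> mult_z) (U_adj \<circ> compl_op P)) B)"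
    proof (rule equiv[OF isometry_omit_prod image_wold_core(2) bounded_op_comp[OF hilbert_space_F bd_P bd_U_adj] bounded_op_comp[OF hilbert_space_F bd_P' bd_U_adj]
          shifts(3) shifts(4)])
      fix h n assume h: "h \<in> carr H"
      have "\<Gamma>\<^sub>1 ((adj H H (\<lambda>h. A (B h)) ^^ n) (B h)) = U_adj (\<Gamma>\<^sub>2 ((adj H H (\<lambda>h. A (B h)) ^^ n) (B h)))"
        using h by (simp add: U_adj_\<Gamma> pair_adj_mem_i iso_mem[OF isometry_omit_prod])
      thus "\<Gamma>\<^sub>1 ((adj H H (\<lambda>h. A (B h)) ^^ n) (B h)) =
        weighted_shift 0 (\<lambda>n. cnj (qprod d q i) ^ n) (\<lambda>m. (U_adj \<circ> P) (\<Gamma>\<^sub>1 ((adj H H (\<lambda>h. A (B h)) ^^ m) h))) n +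
        weighted_shift 1 (\<lambda>n. cnj (qprod d q i) ^ n) (\<lambda>m. (U_adj \<circ> compl_op P) (\<Gamma>\<^sub>1 ((adj H H (\<lambda>h. A (B h)) ^^ m) h))) n"
        using h by (simp add: coeff_B[OF h] shift_sum[OF lin_U_adj] P_mem \<Gamma>_mem pair_adj_mem_i)
    qed
  qed
qed

text \<open>The roles are exchanged: with \<open>\<Gamma>\<^sub>2\<close> the operator
  \<open>U\<close>, written as the adjoint of \<open>U_adj\<close>, is applied to
  \<open>coeff_A\<close>, while \<open>\<Gamma>\<^sub>1 = U_adj \<Gamma>\<^sub>2\<close> rewrites
  \<open>coeff_B\<close>.\<close>

lemma model_2:
  "\<exists>\<Phi>. unitary_equiv_via \<Phi> H A (oplus (hardy F) K)
      (map_prod (tensor_op F (rot (qprod d q i)) (adj F F U_adj \<circ> compl_op P)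
        + tensor_op F (mult_z \<circ> rot (qprod d q i)) (adj F F U_adj \<circ> P)) A) \<and>
    unitary_equiv_via \<Phi> H B (oplus (hardy F) K)
      (map_prod (tensor_op F (rot (cnj (qprod d q i))) (P \<circ> U_adj)
        + tensor_op F (rot (cnj (qprod d q i)) \<circ> mult_z) (compl_op P \<circ> U_adj)) B)"
proof -
  obtain \<Phi> where \<Phi>: "wold_model (\<lambda>h. A (B h)) F (\<Gamma>\<^sub>2) \<Phi>"
    using wold_decomposition[OF isometry_V_omit hilbert_space_F linear_\<Gamma>(2) \<Gamma>_onto(2)] hnorm_\<Gamma>(2) by blast
  note equiv = unitary_equiv_via_tensor_model[OF isometry_V_omit hilbert_space_F \<Phi>]
  have UU: "adj F F U_adj x = U x" if "x \<in> carr F" for x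
    by (rule adj_adj_unitary[OF hilbert_space_F hilbert_space_F U that])
  show ?thesis unfolding wold_core_full
  proof (intro exI conjI)
    show "unitary_equiv_via \<Phi> H A (oplus (hardy F) (sub_hilb H (wold_core (\<lambda>h. A (B h)))))
      (map_prod (tensor_op F (rot (qprod d q i)) (adj F F U_adj \<circ> compl_op P)
        + tensor_op F (mult_z \<circ> rot (qprod d q i)) (adj F F U_adj \<circ> P)) A)"
    proof (rule equiv[OF V_isometry[OF i] image_wold_core(1) bounded_op_comp[OF hilbert_space_F bd_P' bd_U_adj_adj]
          bounded_op_comp[OF hilbert_space_F bd_P bd_U_adj_adj] shifts(1) shifts(2)])
      fix h n assume h: "h \<in> carr H"
      have "\<Gamma>\<^sub>2 ((adj H H (\<lambda>h. A (B h)) ^^ n) (A h)) = U (\<Gamma>\<^sub>1 ((adj H H (\<lambda>h. A (B h)) ^^ n) (A h)))"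
        using h U\<Gamma> by (simp add: pair_adj_mem_i iso_mem[OF V_isometry[OF i]])
      thus "\<Gamma>\<^sub>2 ((adj H H (\<lambda>h. A (B h)) ^^ n) (A h)) =
        weighted_shift 0 (\<lambda>n. qprod d q i ^ n) (\<lambda>m. (adj F F U_adj \<circ> compl_op P) (\<Gamma>\<^sub>2 ((adj H H (\<lambda>h. A (B h)) ^^ m) h))) n +
        weighted_shift 1 (\<lambda>n. qprod d q i ^ (n - 1)) (\<lambda>m. (adj F F U_adj \<circ> P) (\<Gamma>\<^sub>2 ((adj H H (\<lambda>h. A (B h)) ^^ m) h))) n"
        using h by (simp add: coeff_A[OF h] shift_sum[OF lin_U] P_mem \<Gamma>_mem pair_adj_mem_i UU)
    qed
    show "unitary_equiv_via \<Phi> H B (oplus (hardy F) (sub_hilb H (wold_core (\<lambda>h. A (B h)))))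
      (map_prod (tensor_op F (rot (cnj (qprod d q i))) (P \<circ> U_adj)
        + tensor_op F (rot (cnj (qprod d q i)) \<circ> mult_z) (compl_op P \<circ> U_adj)) B)"
    proof (rule equiv[OF isometry_omit_prod image_wold_core(2) bounded_op_comp[OF hilbert_space_F bd_U_adj bd_P]
          bounded_op_comp[OF hilbert_space_F bd_U_adj bd_P'] shifts(3) shifts(4)])
      fix h n assume h: "h \<in> carr H"
      thus "\<Gamma>\<^sub>2 ((adj H H (\<lambda>h. A (B h)) ^^ n) (B h)) =
        weighted_shift 0 (\<lambda>n. cnj (qprod d q i) ^ n) (\<lambda>m. (P \<circ> U_adj) (\<Gamma>\<^sub>2 ((adj H H (\<lambda>h. A (B h)) ^^ m) h))) n +
        weighted_shift 1 (\<lambda>n. cnj (qprod d q i) ^ n) (\<lambda>m. (compl_op P \<circ> U_adj) (\<Gamma>\<^sub>2 ((adj H H (\<lambda>h. A (B h)) ^^ m) h))) n"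
        by (simp add: coeff_B[OF h] U_adj_\<Gamma> pair_adj_mem_i)
    qed
  qed
qed

end

end

section \<open>Assembling the explicit tuple over all indices\<close>

lemma image_wold_core_V:
  assumes "i \<in> {1..d}"
  shows "V i ` wold_core (oprod V [1..<Suc d]) = wold_core (oprod V [1..<Suc d])"
  unfolding wold_core_full[OF assms] by (rule image_wold_core(1)[OF assms])

lemma isometry_full: "isometry_op H H (oprod V [1..<Suc d])"
  by (rule isometry_oprod) auto

lemma Ku_explicit_eq: "Ku_explicit d H V = sub_hilb H (wold_core (oprod V [1..<Suc d]))"
  by (simp add: Ku_explicit_def wold_core_def[OF isometry_full])

lemma unitary_op_core:
  assumes i: "i \<in> {1..d}"
  shows "unitary_op (Ku_explicit d H V) (Ku_explicit d H V) (V i)"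
proof -
  let ?K = "wold_core (oprod V [1..<Suc d])"
  note V = V_isometry[OF i] and K = wold_core_subset[OF isometry_full]
  have "V i x \<in> ?K" if "x \<in> ?K" for x using image_wold_core_V[OF i] that by blast
  thus ?thesis unfolding Ku_explicit_eq unitary_op_def isometry_op_def linear_op_def
    using image_wold_core_V[OF i] K by (auto simp: iso_add[OF V] iso_scale[OF V] iso_norm[OF V] subset_iff)
qed

lemma is_projection_onto_coord_proj:
  assumes i: "i \<in> {1..d}"
  shows "is_projection_onto (defect_sum {1..d}) {x \<in> carr (defect_sum {1..d}). \<forall>j. j \<noteq> i \<longrightarrow> x j = 0} (coord_proj i)"
proof -
  have P: "is_projection (defect_sum {1..d}) (coord_proj i)" by (rule is_projection_coord_proj[OF i])
  have "x \<in> coord_proj i ` carr (defect_sum {1..d})"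
    if "x \<in> carr (defect_sum {1..d})" "\<forall>j. j \<noteq> i \<longrightarrow> x j = 0" for x
    by (rule image_eqI[OF _ that(1)]) (use that(2) in \<open>auto simp: coord_proj_def[OF i]\<close>)
  moreover have "coord_proj i x \<in> carr (defect_sum {1..d})" if "x \<in> carr (defect_sum {1..d})" for x
    using P that by (simp add: is_projection_def bounded_op_def linear_op_def)
  ultimately show ?thesis using P by (auto simp: is_projection_onto_def coord_proj_def[OF i])
qed

lemma defect_chain_omitted:
  "defect_chain (omitted i) h = (\<lambda>j. if j \<in> {1..d} - {i}
    then defect_adj H (V j) (oprod (\<lambda>k. adj H H (V k)) (filter (\<lambda>k. k \<noteq> i) [Suc j..<Suc d]) h) else 0)"
  unfolding defect_chain_filter_upt by auto

theorem explicit_models: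
  "\<exists>\<Delta> P U. explicit_tuple d H V \<Delta> P U \<and>
    BCL1_model d q H V (F_explicit d H V) (Ku_explicit d H V) P U V \<and>
    BCL2_model d q H V (F_explicit d H V) (Ku_explicit d H V) P
      (\<lambda>i. adj (F_explicit d H V) (F_explicit d H V) (U i)) V"
proof -
  let ?F = "defect_sum {1..d}"
  have F: "F_explicit d H V = ?F" by (simp add: F_explicit_def)
  have hF: "hilbert_space ?F" by (rule hilbert_space_defect_sum) simp
  have hK: "hilbert_space (Ku_explicit d H V)"
    unfolding Ku_explicit_eq by (rule hilbert_space_wold_core[OF isometry_full])
  have qK: "q_commutative d q (Ku_explicit d H V) V"
    unfolding Ku_explicit_eq q_commutative_def carr_sub_hilb
    by (intro ballI V_commute subsetD[OF wold_core_subset[OF isometry_full]])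
  define Q where "Q i \<Delta> U \<longleftrightarrow>
    unitary_op (defect_space H (omit_prod d V i)) (defect_sum ({1..d} - {i})) \<Delta> \<and>
    (\<forall>h\<in>carr H. \<Delta> (defect_adj H (omit_prod d V i) h) = defect_chain (omitted i) h) \<and>
    unitary_op ?F ?F U \<and> (\<forall>h\<in>carr H. U (\<Gamma>\<^sub>1 i h) = \<Gamma>\<^sub>2 i h)" for i \<Delta> U
  have "\<forall>i\<in>{1..d}. \<exists>\<Delta> U. Q i \<Delta> U"
    unfolding Q_def by (intro ballI ex_explicit_unitaries)
  then obtain \<Delta> U where "\<And>i. i \<in> {1..d} \<Longrightarrow> Q i (\<Delta> i) (U i)" by metis
  note * = this[unfolded Q_def]
  have U: "unitary_op ?F ?F (U i)" and U\<Gamma>: "\<forall>h\<in>carr H. U i (\<Gamma>\<^sub>1 i h) = \<Gamma>\<^sub>2 i h" if "i \<in> {1..d}" for i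
    using *[OF that] by blast+
  have "explicit_tuple d H V \<Delta> coord_proj U"
    unfolding explicit_tuple_def F
  proof (intro ballI conjI)
    fix i assume i: "i \<in> {1..d}"
    show "unitary_op (defect_space H (omit_prod d V i)) (defect_sum ({1..d} - {i})) (\<Delta> i)"
      "unitary_op ?F ?F (U i)" using *[OF i] by blast+
    show "is_projection_onto ?F {x \<in> carr ?F. \<forall>j. j \<noteq> i \<longrightarrow> x j = 0} (coord_proj i)"
      by (rule is_projection_onto_coord_proj[OF i])
    fix h assume h: "h \<in> carr H"
    show "\<Delta> i (defect_adj H (omit_prod d V i) h) = (\<lambda>j. if j \<in> {1..d} - {i}
        then defect_adj H (V j) (oprod (\<lambda>k. adj H H (V k)) (filter (\<lambda>k. k \<noteq> i) [Suc j..<Suc d]) h) else 0)"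
      using *[OF i] h by (simp only: defect_chain_omitted[symmetric])
    \<comment> \<open>By the formula for \<open>\<Delta>\<close>, the two glued families are
      \<open>\<Gamma>\<^sub>1 h\<close> and \<open>\<Gamma>\<^sub>2 h\<close>.\<close>
    show "U i ((\<Delta> i (defect_adj H (omit_prod d V i) (adj H H (V i) h)))(i := defect_adj H (V i) h)) =
        (\<Delta> i (defect_adj H (omit_prod d V i) h))(i := defect_adj H (V i) (adj H H (omit_prod d V i) h))"
      using *[OF i] h adj_mem[OF V_isometry[OF i] h]
      by (simp add: \<Gamma>\<^sub>1_def[OF i] \<Gamma>\<^sub>2_def[OF i] glue_def[OF i])
  qed
  moreover have "BCL1_model d q H V (F_explicit d H V) (Ku_explicit d H V) coord_proj U V"
    unfolding BCL1_model_def model_data_def F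
    by (intro conjI ballI hF hK qK U unitary_op_core is_projection_coord_proj model_1[OF _ U U\<Gamma>, folded Ku_explicit_eq])
  moreover have "BCL2_model d q H V (F_explicit d H V) (Ku_explicit d H V) coord_proj
      (\<lambda>i. adj (F_explicit d H V) (F_explicit d H V) (U i)) V"
    unfolding BCL2_model_def model_data_def F
    by (intro conjI ballI hF hK qK unitary_op_adj[OF hF hF U] unitary_op_core is_projection_coord_proj
        model_2[OF _ U U\<Gamma>, folded Ku_explicit_eq])
  ultimately show ?thesis by blast
qed

end

theorem theorem5p2:
  fixes d :: nat and q :: "nat \<Rightarrow> nat \<Rightarrow> complex"
    and H :: "'a::complex_vector hilb" and V :: "nat \<Rightarrow> 'a \<Rightarrow> 'a"
  assumes "2 \<le> d"
    and "\<forall>i\<in>{1..d}. \<forall>j\<in>{1..d}. cmod (q i j) = 1"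
    and "\<forall>i\<in>{1..d}. q i i = 1"
    and "\<forall>i\<in>{1..d}. \<forall>j\<in>{1..d}. q i j = cnj (q j i)"
    and "hilbert_space H"
    and "\<forall>i\<in>{1..d}. isometry_op H H (V i)"
    and "q_commutative d q H V"
  shows "(\<exists>(F :: (nat \<Rightarrow> 'a) hilb) (Ku :: 'a hilb) P U W. BCL1_model d q H V F Ku P U W) \<and>
    (\<exists>(F' :: (nat \<Rightarrow> 'a) hilb) (Ku' :: 'a hilb) P' U' W'. BCL2_model d q H V F' Ku' P' U' W') \<and>
    (\<exists>\<Delta> P U. explicit_tuple d H V \<Delta> P U \<and>
      BCL1_model d q H V (F_explicit d H V) (Ku_explicit d H V) P U V \<and>
      BCL2_model d q H V (F_explicit d H V) (Ku_explicit d H V) P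
        (\<lambda>i. adj (F_explicit d H V) (F_explicit d H V) (U i)) V)"
proof -
  have "q_commuting_isometries H d q V"
  proof (rule q_commuting_isometries.intro[OF assms(5)], rule q_commuting_isometries_axioms.intro)
    show "V i (V j h) = q i j *\<^sub>C V j (V i h)" if "i \<in> {1..d}" "j \<in> {1..d}" "h \<in> carr H" for i j h
      using assms(7) that unfolding q_commutative_def by blast
  qed (use assms(2,3,6) in blast)+
  \<comment> \<open>The explicit tuple also witnesses both existence statements, the second with the
    adjoints of the \<open>U i\<close>.\<close>
  note models = q_commuting_isometries.explicit_models[OF this]
  then obtain P U where "BCL1_model d q H V (F_explicit d H V) (Ku_explicit d H V) P U V"
    "BCL2_model d q H V (F_explicit d H V) (Ku_explicit d H V) P
        (\<lambda>i. adj (F_explicit d H V) (F_explicit d H V) (U i)) V"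
    by (elim exE conjE)
  thus ?thesis by (intro conjI exI models)
qed

end
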